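(* Let $F:\mathbb{R}_+\to\mathbb{R}$ be measurable, positive and locally bounded. Let $\alpha\in\mathbb{R}$, $\mathrm{K}\in\mathscr{W}_\alpha$ and $A\in\mathscr{A}^\infty_0$. The following hold. (1) If $F\in\mathrm{2RV}^\infty_{\alpha,0}(A)$, then $\mathrm{K}\overset{\rm M}{*}F\in\mathrm{2RV}^\infty_{\alpha,0}(A)$. (2) If $\mathrm{K}\overset{\rm M}{*}F\in\mathrm{2RV}^\infty_{\alpha,0}(A)$ and $F\in\mathscr{M}^\infty_{\alpha,0}$, then $F\in\mathrm{2RV}^\infty_{\alpha,0}(A)$.
   Context: A measurable function $F$ (defined on $\mathbb{R}_+$ or $(0,\infty)$) is regularly varying at infinity with index $\alpha\in\mathbb{R}$, written $F\in\mathrm{RV}^\infty_\alpha$, if it has constant sign near infinity and $\lim_{t\to\infty}F(tx)/F(t)=x^\alpha$ for every $x>0$. A function $F\in\mathrm{RV}^\infty_\alpha$ belongs to $\mathrm{2RV}^\infty_{\alpha,0}(A)$ (where $A$ is an eventually positive or eventually negative function) if for every $x>0$ $$\lim_{t\to\infty}\frac{F(tx)/F(t)-x^\alpha}{A(t)}=x^\alpha\log x .$$ $\mathscr{A}^\infty_0:=\{A\in\mathrm{RV}^\infty_0:\lim_{t\to\infty}A(t)=0\}$. For a locally integrable function (kernel) $\mathrm{K}$ on $\mathbb{R}_+$ (integrable near $0$ as well), the Mellin convolution of $F$ associated with $\mathrm{K}$ is $\mathrm{K}\overset{\rm M}{*}F(\lambda):=\int_0^\infty \mathrm{K}(x)F(\lambda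 x)\,dx$, $\lambda>0$. For $\alpha\in\mathbb{R}$, $\mathscr{W}_\alpha$ is the set of non-negative locally integrable kernels $\mathrm{K}$ on $\mathbb{R}_+$ satisfying the Wiener condition: for some $\delta>0$ and every $z\in\mathbb{R}$, $$\int_0^\infty (t^{\alpha+\delta}\vee t^{\alpha-\delta})\,\mathrm{K}(t)\,dt<\infty\quad\text{and}\quad \int_0^\infty t^{\alpha-\mathtt{i}z}\,\mathrm{K}(t)\,dt\neq0,$$ where $\mathtt{i}$ is the imaginary unit. For $\kappa\in\mathbb{R}$, $\mathscr{M}^\infty_{\kappa,0}$ is the set of functions $F:\mathbb{R}_+\to\mathbb{R}$ that are locally bounded, eventually positive or eventually negative, and such that $t^{-\kappa}F(t)$ is eventually monotone. *)

theory Defs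
  imports "HOL-Analysis.Analysis"
begin

text \<open>
  Functions on \<open>[0,\<infinity>)\<close> or \<open>(0,\<infinity>)\<close> are total functions \<^typ>\<open>real \<Rightarrow> real\<close>; no definition
  depends on their values outside the half-line. Measurability is Lebesgue measurability.
\<close>

definition const_sign_at_top :: "(real \<Rightarrow> real) \<Rightarrow> bool" where
  "const_sign_at_top F \<longleftrightarrow> (\<forall>\<^sub>F t in at_top. F t > 0) \<or> (\<forall>\<^sub>F t in at_top. F t < 0)"

definition RV :: "real \<Rightarrow> (real \<Rightarrow> real) set" where
  "RV \<alpha> = {F. F \<in> borel_measurable (lebesgue_on {0<..}) \<and> const_sign_at_top F \<and>
     (\<forall>x>0. ((\<lambda>t. F (t * x) / F t) \<longlongrightarrow> x powr \<alpha>) at_top)}"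

text \<open>The second-order class with second-order index \<open>0\<close>.\<close>

definition RV2_0 :: "real \<Rightarrow> (real \<Rightarrow> real) \<Rightarrow> (real \<Rightarrow> real) set" where
  "RV2_0 \<alpha> A = {F. F \<in> RV \<alpha> \<and> const_sign_at_top A \<and>
     (\<forall>x>0. ((\<lambda>t. (F (t * x) / F t - x powr \<alpha>) / A t) \<longlongrightarrow> x powr \<alpha> * ln x) at_top)}"

definition aux_class_0 :: "(real \<Rightarrow> real) set" where
  "aux_class_0 = {A. A \<in> RV 0 \<and> (A \<longlongrightarrow> 0) at_top}"

definition mellin_conv :: "(real \<Rightarrow> real) \<Rightarrow> (real \<Rightarrow> real) \<Rightarrow> real \<Rightarrow> real" where
  "mellin_conv K F l = (LINT x:{0<..}|lebesgue. K x * F (l * x))"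

text \<open>Local integrability is on \<open>[0,\<infinity>)\<close>, so it includes integrability near \<open>0\<close>.\<close>

definition wiener_kernels :: "real \<Rightarrow> (real \<Rightarrow> real) set" where
  "wiener_kernels \<alpha> = {K. (\<forall>t\<ge>0. K t \<ge> 0) \<and> (\<forall>b\<ge>0. set_integrable lebesgue {0..b} K) \<and>
     (\<exists>\<delta>>0. \<forall>z::real.
        set_integrable lebesgue {0<..} (\<lambda>t. max (t powr (\<alpha> + \<delta>)) (t powr (\<alpha> - \<delta>)) * K t) \<and>
        (LINT t:{0<..}|lebesgue.
           complex_of_real t powr (complex_of_real \<alpha> - \<i> * complex_of_real z)
             * complex_of_real (K t)) \<noteq> 0)}"

text \<open>On \<open>[0,\<infinity>)\<close>, locally bounded means bounded on every \<open>[0,b]\<close>, up to and including \<open>0\<close>.\<close>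

definition locally_bounded :: "(real \<Rightarrow> real) \<Rightarrow> bool" where
  "locally_bounded F \<longleftrightarrow> (\<forall>b\<ge>0. bounded (F ` {0..b}))"

definition M_class_0 :: "real \<Rightarrow> (real \<Rightarrow> real) set" where
  "M_class_0 \<kappa> = {F. locally_bounded F \<and> const_sign_at_top F \<and>
     (\<exists>T>0. mono_on {T..} (\<lambda>t. t powr (-\<kappa>) * F t) \<or>
            antimono_on {T..} (\<lambda>t. t powr (-\<kappa>) * F t))}"

end

theory Submission
  imports Defs "HOL-Probability.Sinc_Integral"
begin

text \<open>
  In additive coordinates \<open>t = e\<^sup>s\<close>, put \<open>\<phi> s = e\<^bsup>-\<alpha>s\<^esup> F (e\<^sup>s)\<close>,
  \<open>\<kappa> w = e\<^bsup>(\<alpha>+1)w\<^esup> K (e\<^sup>w)\<close> and \<open>B s = A (e\<^sup>s)\<close>. The Mellin convolution becomes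
  \<open>G s = \<integral> \<kappa> w \<phi> (s + w) dw\<close>, and \<open>F \<in> 2RV\<close> becomes
  \<open>(\<phi> (s + v) - \<phi> s) / a s \<longlonglongrightarrow> v\<close> with the slowly varying normalisation \<open>a = B \<phi>\<close>.
  The Abelian half is dominated convergence under Potter's bound.

  For the Tauberian half normalise by \<open>a = B G\<close>. Monotonicity of \<open>\<phi>\<close> and positivity of \<open>\<kappa>\<close> give
  \<open>\<phi> (s + 1) - \<phi> s = O(a s)\<close>, so \<open>q\<^sub>v u = (\<phi> (u + v) - \<phi> u) / a u\<close> is bounded and its convolution
  with \<open>\<kappa>\<close> tends to \<open>v\<close>. Wiener's theorem transfers this limit from \<open>\<kappa>\<close> to narrow Fejer
  kernels, and a sandwich by monotonicity turns these averages of \<open>q\<^sub>v\<close> into pointwise limits.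
\<close>

section \<open>Uniform convergence and Potter's bound\<close>

text \<open>Near \<open>t = 0\<close> the function \<open>F\<close> is merely bounded, so for
  \<alpha> > 0 the function \<phi> may grow like \<open>exp (-\<alpha> * s)\<close> at minus
  infinity. The kernel therefore has to absorb a one-sided exponential weight besides the two-sided
  one that Potter's bound costs; integrability of \<open>K\<close> near 0 pays for the first, the
  Wiener condition for the second. In the Tauberian half nothing is known in advance about the
  growth of \<phi>, whereas \<open>G\<close> varies slowly by hypothesis; this is why the
  normalisation is built from \<open>G\<close>. The ratio of \<phi> to \<open>G\<close> is
  identified only at the end, where an error of order \<open>a = B * G\<close> is negligible against
  \<open>G\<close> because \<open>B\<close> tends to 0. The exponential moments of the kernel make
  its Fourier transform smooth, so Wiener's division becomes an explicit quotient handled by two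
  integrations by parts. Monotonicity holds only near infinity: \<phi> is frozen to the left of a
  point, and the discarded part has a convolution of order o(a).\<close>

lemma lebesgue_distr_translate: "distr lebesgue lebesgue (\<lambda>x. t + x) = (lebesgue :: real measure)"
  using lebesgue_real_affine[of 1 t] by (simp add: density_1 one_ennreal_def[symmetric])

lemma measurable_lebesgue_translate [measurable]: "(\<lambda>x::real. t + x) \<in> lebesgue \<rightarrow>\<^sub>M lebesgue"
  using lebesgue_affine_measurable[of "\<lambda>_::real. 1" t] by simp

lemma borel_measurable_lebesgue_translate:
  fixes f :: "real \<Rightarrow> 'a::topological_space"
  assumes "f \<in> borel_measurable lebesgue"
  shows "(\<lambda>x. f (t + x)) \<in> borel_measurable lebesgue"
  using measurable_compose[OF measurable_lebesgue_translate assms] .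

lemma integrable_lebesgue_translate:
  fixes f :: "real \<Rightarrow> 'a::{banach, second_countable_topology}"
  assumes "integrable lebesgue f"
  shows "integrable lebesgue (\<lambda>x. f (t + x))"
proof -
  have "integrable (distr lebesgue lebesgue (\<lambda>x. t + x)) f"
    using assms by (simp add: lebesgue_distr_translate)
  then show ?thesis
    by (subst (asm) integrable_distr_eq) (use assms in auto)
qed

lemma integral_lebesgue_translate:
  fixes f :: "real \<Rightarrow> 'a::{banach, second_countable_topology}"
  assumes "f \<in> borel_measurable lebesgue"
  shows "(LINT x|lebesgue. f (t + x)) = (LINT x|lebesgue. f x)"
proof -
  have "(LINT x|lebesgue. f x) = (LINT x|distr lebesgue lebesgue (\<lambda>x. t + x). f x)"
    by (simp add: lebesgue_distr_translate)
  also have "\<dots> = (LINT x|lebesgue. f (t + x))"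
    by (rule integral_distr) (use assms in auto)
  finally show ?thesis by simp
qed

text \<open>
  The uniform convergence theorem. With \<open>d\<close> the metric truncated at 1, put
  \<open>I s = \<integral>\<^bsub>0\<^esub>\<^bsup>2\<^esup> d (g (s + y), g s) dy\<close>; averaging the triangle inequality through \<open>g (s + y)\<close> over
  \<open>y \<in> [1, 2]\<close> gives \<open>d (g (s + w), g s) \<le> I s + I (s + w)\<close> for \<open>w \<in> [0, 1]\<close>, and \<open>I\<close> tends to 0
  by dominated convergence.
\<close>

lemma uniform_convergence_increments:
  fixes g :: "real \<Rightarrow> real"
  assumes g: "g \<in> borel_measurable lebesgue"
    and lim: "\<And>w. ((\<lambda>s. g (s + w) - g s) \<longlongrightarrow> 0) at_top" and "e > 0"
  shows "\<exists>S. \<forall>s\<ge>S. \<forall>w\<in>{0..1}. \<bar>g (s + w) - g s\<bar> < e"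
proof -
  define d where "d x y = min 1 \<bar>x - y :: real\<bar>" for x y
  define I where "I s = (LINT y|lebesgue. indicator {0..2} y * d (g (s + y)) (g s))" for s
  have ind: "integrable lebesgue (indicator {a..b} :: real \<Rightarrow> real)" for a b :: real
    by (cases "a \<le> b") (simp_all add: integrable_indicator_iff)
  have meas: "(\<lambda>y. indicator {a..b} y * d (g (s + y)) c) \<in> borel_measurable lebesgue" for a b s c
    unfolding d_def by (intro borel_measurable_times borel_measurable_indicator borel_measurable_min
        borel_measurable_const borel_measurable_abs borel_measurable_diff
        borel_measurable_lebesgue_translate g) auto
  have int: "integrable lebesgue (\<lambda>y. indicator {a..b} y * d (g (s + y)) c)" for a b s c
    by (rule Bochner_Integration.integrable_bound[OF ind[of a b]])
      (use meas in \<open>auto simp: d_def indicator_def\<close>)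
  have "(I \<longlongrightarrow> (LINT y::real|lebesgue. 0)) at_top"
    unfolding I_def
  proof (rule integral_dominated_convergence_at_top[where w = "indicator {0..2}"])
    show "AE y in lebesgue. ((\<lambda>s. indicator {0..2} y * d (g (s + y)) (g s)) \<longlongrightarrow> 0) at_top"
    proof (rule AE_I2)
      fix y :: real
      have "((\<lambda>s. indicator {0..2} y * min 1 \<bar>g (s + y) - g s\<bar>) \<longlongrightarrow> indicator {0..2} y * min 1 \<bar>0\<bar>) at_top"
        by (intro tendsto_intros lim)
      then show "((\<lambda>s. indicator {0..2} y * d (g (s + y)) (g s)) \<longlongrightarrow> 0) at_top"
        by (simp add: d_def)
    qed
  qed (use ind meas in \<open>auto simp: d_def indicator_def intro!: always_eventually\<close>)
  \<comment> \<open>The minimum with 1 lets the truncation drop out at the end: a truncated distance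
    below 1 is the true distance.\<close>
  then have "\<forall>\<^sub>F s in at_top. I s < min e 1 / 2"
    using \<open>e > 0\<close> by (intro order_tendstoD(2)[of _ 0]) auto
  then obtain S where S: "\<And>s. s \<ge> S \<Longrightarrow> I s < min e 1 / 2"
    by (auto simp: eventually_at_top_linorder)
  have "\<bar>g (s + w) - g s\<bar> < e" if s: "s \<ge> S" and w: "w \<in> {0..1}" for s w
  proof -
    \<comment> \<open>The interval [1, 2] has length 1, and for every \<open>w\<close> in [0, 1] it
      lies in both [0, 2] and [w, w + 2], the ranges of integration of \<open>I s\<close> and, after
      translation by \<open>w\<close>, of \<open>I (s + w)\<close>.\<close>
    have "d (g (s + w)) (g s) = (LINT y:{1..2::real}|lebesgue. d (g (s + w)) (g s))"
      by (simp add: set_lebesgue_integral_def)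
    also have "\<dots> \<le> (LINT y|lebesgue. indicator {0..2} y * d (g (s + y)) (g s)
        + indicator {0..2} (-w + y) * d (g (s + w + (-w + y))) (g (s + w)))"
      unfolding set_lebesgue_integral_def
    proof (intro integral_mono Bochner_Integration.integrable_add int)
      show "integrable lebesgue (\<lambda>x. indicator {0..2} (- w + x) * d (g (s + w + (- w + x))) (g (s + w)))"
        using integrable_lebesgue_translate[OF int[of 0 2 "s + w" "g (s + w)"], of "-w"] .
      show "integrable lebesgue (\<lambda>x. indicator {1..2::real} x *\<^sub>R d (g (s + w)) (g s))"
        using ind[of 1 2] by (auto intro: integrable_mult_left)
    next
      fix y :: real
      have "d (g (s + w)) (g s) \<le> d (g (s + y)) (g s) + d (g (s + y)) (g (s + w))"
        by (auto simp: d_def)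
      moreover have "0 \<le> d u v" for u v by (auto simp: d_def)
      ultimately show "indicator {1..2} y *\<^sub>R d (g (s + w)) (g s)
          \<le> indicator {0..2} y * d (g (s + y)) (g s)
            + indicator {0..2} (-w + y) * d (g (s + w + (-w + y))) (g (s + w))"
        using w by (auto simp: indicator_def)
    qed
    also have "\<dots> = I s + (LINT y|lebesgue. indicator {0..2} (-w + y) * d (g (s + w + (-w + y))) (g (s + w)))"
      unfolding I_def by (intro Bochner_Integration.integral_add int
          integrable_lebesgue_translate[OF int[of 0 2 "s + w" "g (s + w)"], of "-w"])
    also have "\<dots> = I s + I (s + w)"
      using integral_lebesgue_translate[OF meas[of 0 2 "s + w" "g (s + w)"], of "-w"]
      unfolding I_def by simp
    also have "\<dots> < min e 1"
      using S[of s] S[of "s + w"] s w by auto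
    finally show ?thesis
      by (auto simp: d_def min_def split: if_splits)
  qed
  then show ?thesis by blast
qed

lemma filterlim_plus_const_at_top: "filterlim (\<lambda>s::real. s + w) at_top at_top"
proof -
  have "filterlim (\<lambda>s. w + s) at_top at_top"
    by (rule filterlim_tendsto_add_at_top[OF tendsto_const filterlim_ident])
  then show ?thesis by (simp add: add.commute)
qed

text \<open>Slow variation at infinity of \<open>t \<mapsto> a (ln t)\<close>. No sign is imposed:
  the auxiliary function may be eventually negative, and the decreasing case of the Tauberian half
  passes to \<open>- a\<close>.\<close>

definition additively_slow :: "(real \<Rightarrow> real) \<Rightarrow> bool" where
  "additively_slow a \<longleftrightarrow>
     a \<in> borel_measurable lebesgue \<and> (\<forall>v. ((\<lambda>s. a (s + v) / a s) \<longlongrightarrow> 1) at_top)"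

lemma additively_slow_eventually_nonzero:
  assumes "additively_slow a"
  shows "\<forall>\<^sub>F s in at_top. a s \<noteq> 0"
proof -
  \<comment> \<open>At shift 0 the ratio is 1 where \<open>a s\<close> is nonzero and, by the
    convention for division, 0 where \<open>a s\<close> vanishes; convergence to 1 excludes zeros
    eventually.\<close>
  have "((\<lambda>s. a (s + 0) / a s) \<longlongrightarrow> 1) at_top"
    using assms unfolding additively_slow_def by blast
  then have "\<forall>\<^sub>F s in at_top. a (s + 0) / a s > 0"
    by (rule order_tendstoD) simp
  then show ?thesis by eventually_elim auto
qed

lemma additively_slow_mult:
  assumes "additively_slow a" "additively_slow b"
  shows "additively_slow (\<lambda>s. a s * b s)"
  unfolding additively_slow_def
proof (intro conjI allI)
  show "(\<lambda>s. a s * b s) \<in> borel_measurable lebesgue"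
    using assms unfolding additively_slow_def by auto
  fix v
  have "((\<lambda>s. (a (s + v) / a s) * (b (s + v) / b s)) \<longlongrightarrow> 1 * 1) at_top"
    using assms unfolding additively_slow_def by (intro tendsto_mult) auto
  then show "((\<lambda>s. a (s + v) * b (s + v) / (a s * b s)) \<longlongrightarrow> 1) at_top"
    by simp
qed

lemma additively_slow_uminus:
  "additively_slow a \<Longrightarrow> additively_slow (\<lambda>s. - a s)"
  unfolding additively_slow_def by auto

lemma additively_slow_log_uniform:
  assumes a: "additively_slow a" and "e > 0"
  shows "\<exists>S. \<forall>s\<ge>S. \<forall>w\<in>{0..1}. \<bar>ln \<bar>a (s + w)\<bar> - ln \<bar>a s\<bar>\<bar> < e"
proof (rule uniform_convergence_increments)
  show "(\<lambda>s. ln \<bar>a s\<bar>) \<in> borel_measurable lebesgue"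
    using a unfolding additively_slow_def by auto
  fix w
  have 1: "((\<lambda>s. ln \<bar>a (s + w) / a s\<bar>) \<longlongrightarrow> ln \<bar>1\<bar>) at_top"
    using a unfolding additively_slow_def by (intro tendsto_intros) auto
  have nz: "\<forall>\<^sub>F s in at_top. a s \<noteq> 0"
    by (rule additively_slow_eventually_nonzero[OF a])
  have "\<forall>\<^sub>F s in at_top. a (s + w) \<noteq> 0"
    by (rule eventually_compose_filterlim[OF nz filterlim_plus_const_at_top])
  then have "\<forall>\<^sub>F s in at_top. ln \<bar>a (s + w) / a s\<bar> = ln \<bar>a (s + w)\<bar> - ln \<bar>a s\<bar>"
    using nz by eventually_elim (simp add: abs_divide ln_div add.commute)
  then show "((\<lambda>s. ln \<bar>a (s + w)\<bar> - ln \<bar>a s\<bar>) \<longlongrightarrow> 0) at_top"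
    using 1 by (auto elim: Lim_transform_eventually)
qed fact

text \<open>A unit step changes \<open>ln \<bar>a\<bar>\<close> by less than \<open>e\<close>, and
  at most \<open>\<bar>t - s\<bar> + 1\<close> steps lead from \<open>s\<close> to \<open>t\<close>.
  The extra 1 in the exponent plays the part of the multiplicative constant in the usual form of
  Potter's bound.\<close>

lemma potter_bound:
  assumes a: "additively_slow a" and "e > 0"
  obtains S where "S \<ge> 0"
    "\<And>s t. s \<ge> S \<Longrightarrow> t \<ge> S \<Longrightarrow> a s \<noteq> 0 \<and> \<bar>a t\<bar> \<le> exp (e * (\<bar>t - s\<bar> + 1)) * \<bar>a s\<bar>"
proof -
  obtain S1 where S1: "\<forall>s\<ge>S1. \<forall>w\<in>{0..1}. \<bar>ln \<bar>a (s + w)\<bar> - ln \<bar>a s\<bar>\<bar> < e"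
    using additively_slow_log_uniform[OF assms] by blast
  obtain S2 where S2: "\<And>s. s \<ge> S2 \<Longrightarrow> a s \<noteq> 0"
    using additively_slow_eventually_nonzero[OF a] by (auto simp: eventually_at_top_linorder)
  define S where "S = max 0 (max S1 S2)"
  define g where "g s = ln \<bar>a s\<bar>" for s
  have step: "\<bar>g y - g x\<bar> \<le> e * real n" if "x \<ge> S" "x \<le> y" "y \<le> x + real n" for x y n
    using that
  proof (induction n arbitrary: y)
    case 0
    then show ?case by simp
  next
    case (Suc n)
    show ?case
    proof (cases "y \<le> x + 1")
      case True
      have "\<bar>g (x + (y - x)) - g x\<bar> < e"
        unfolding g_def by (rule S1[rule_format]) (use Suc.prems True in \<open>auto simp: S_def\<close>)
      moreover have "e \<le> e * real (Suc n)" using \<open>e > 0\<close> by simp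
      ultimately show ?thesis by simp
    next
      case False
      have "\<bar>g (y - 1 + 1) - g (y - 1)\<bar> < e"
        unfolding g_def by (rule S1[rule_format]) (use Suc.prems False in \<open>auto simp: S_def\<close>)
      moreover have "\<bar>g (y - 1) - g x\<bar> \<le> e * real n"
        using Suc.prems False by (intro Suc.IH) auto
      ultimately show ?thesis by (simp add: algebra_simps)
    qed
  qed
  have step': "\<bar>g y - g x\<bar> \<le> e * (y - x + 1)" if "x \<ge> S" "x \<le> y" for x y
  proof -
    have "\<bar>g y - g x\<bar> \<le> e * real (nat \<lceil>y - x\<rceil>)"
      by (rule step) (use that in linarith)+
    also have "\<dots> \<le> e * (y - x + 1)"
      using \<open>e > 0\<close> that by (intro mult_left_mono) linarith+
    finally show ?thesis .
  qed
  have main: "a s \<noteq> 0 \<and> \<bar>a t\<bar> \<le> exp (e * (\<bar>t - s\<bar> + 1)) * \<bar>a s\<bar>" if st: "s \<ge> S" "t \<ge> S" for s t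
  proof
    show nz: "a s \<noteq> 0" using S2 st by (auto simp: S_def)
    have nzt: "a t \<noteq> 0" using S2 st by (auto simp: S_def)
    have "\<bar>g t - g s\<bar> \<le> e * (\<bar>t - s\<bar> + 1)"
      using step'[of s t] step'[of t s] st by (cases "s \<le> t") (auto simp: abs_minus_commute)
    then have "g t \<le> e * (\<bar>t - s\<bar> + 1) + g s" by linarith
    then have "exp (g t) \<le> exp (e * (\<bar>t - s\<bar> + 1)) * exp (g s)"
      by (simp add: exp_add[symmetric])
    then show "\<bar>a t\<bar> \<le> exp (e * (\<bar>t - s\<bar> + 1)) * \<bar>a s\<bar>"
      using nz nzt by (simp add: g_def)
  qed
  show thesis
    by (rule that[of S]) (use main in \<open>auto simp: S_def\<close>)
qed

section \<open>Convolutions of slowly varying functions\<close>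

text \<open>The two weights serve two regions. \<open>exp (\<delta> * \<bar>w\<bar>)\<close> absorbs
  Potter's bound where \<open>s + w\<close> is large; \<open>exp (-\<theta> * w)\<close> absorbs the
  growth at minus infinity of a function known there only through an exponential bound. The relation
  \<open>\<delta> \<le> \<theta>\<close> lets \<open>exp (-\<theta> * s)\<close> outweigh the Potter
  factor between a fixed point and \<open>s\<close>.\<close>

locale exp_kernel =
  fixes \<kappa> :: "real \<Rightarrow> real" and \<theta> \<delta> :: real
  assumes kernel_measurable [measurable]: "\<kappa> \<in> borel_measurable lebesgue"
    and kernel_nonneg: "\<kappa> w \<ge> 0"
    and \<delta>_pos: "\<delta> > 0" and \<delta>_le_\<theta>: "\<delta> \<le> \<theta>"
    and kernel_weighted: "integrable lebesgue (\<lambda>w. \<kappa> w * (exp (-\<theta> * w) + exp (\<delta> * \<bar>w\<bar>)))"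
begin

lemma integrable_dominated:
  fixes f :: "real \<Rightarrow> 'a::{banach, second_countable_topology}"
  assumes "f \<in> borel_measurable lebesgue"
    and "\<And>w. norm (f w) \<le> \<kappa> w * (C * (exp (-\<theta> * w) + exp (\<delta> * \<bar>w\<bar>)))"
  shows "integrable lebesgue f"
proof (rule Bochner_Integration.integrable_bound[OF integrable_mult_left[OF kernel_weighted, of C]])
  show "AE w in lebesgue. norm (f w) \<le> norm (\<kappa> w * (exp (-\<theta> * w) + exp (\<delta> * \<bar>w\<bar>)) * C)"
  proof (rule AE_I2)
    fix w
    have "norm (f w) \<le> \<kappa> w * (exp (-\<theta> * w) + exp (\<delta> * \<bar>w\<bar>)) * C"
      using assms(2)[of w] by (simp add: mult_ac)
    then show "norm (f w) \<le> norm (\<kappa> w * (exp (-\<theta> * w) + exp (\<delta> * \<bar>w\<bar>)) * C)"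
      by simp
  qed
qed fact

lemma one_le_weight: "1 \<le> exp (-\<theta> * w) + exp (\<delta> * \<bar>w\<bar>)"
proof -
  have "1 \<le> exp (\<delta> * \<bar>w\<bar>)" using \<delta>_pos by simp
  then show ?thesis by (smt (verit) exp_ge_zero)
qed

lemma kernel_integrable: "integrable lebesgue \<kappa>"
proof (rule integrable_dominated[where C = 1])
  fix w
  show "norm (\<kappa> w) \<le> \<kappa> w * (1 * (exp (-\<theta> * w) + exp (\<delta> * \<bar>w\<bar>)))"
    using mult_left_mono[OF one_le_weight[of w] kernel_nonneg[of w]] kernel_nonneg[of w] by simp
qed measurable

text \<open>Potter's bound works only to the right of a threshold \<open>S\<close>. To its left the
  crude exponential bound applies, and the factor \<open>\<bar>a s\<bar>\<close> is inserted by
  comparing \<open>a S\<close> with \<open>a s\<close>: this loses about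
  \<open>exp (\<delta> * s)\<close>, which \<open>exp (-\<theta> * s)\<close> pays for since
  \<open>S \<ge> 0\<close>. The two summands of \<open>C\<close> belong to these two cases.\<close>

lemma convolution_domination:
  assumes a: "additively_slow a"
    and lim: "((\<lambda>s. h s / a s) \<longlongrightarrow> L) at_top"
    and bound: "\<And>b. \<exists>C. \<forall>u\<le>b. \<bar>h u\<bar> \<le> C * exp (-\<theta> * u)"
  obtains S C where "\<And>s w. s \<ge> S \<Longrightarrow>
    \<bar>h (s + w)\<bar> \<le> C * \<bar>a s\<bar> * (exp (-\<theta> * w) + exp (\<delta> * \<bar>w\<bar>))"
proof -
  obtain S0 where S0: "S0 \<ge> 0"
    "\<And>s t. s \<ge> S0 \<Longrightarrow> t \<ge> S0 \<Longrightarrow> a s \<noteq> 0 \<and> \<bar>a t\<bar> \<le> exp (\<delta> * (\<bar>t - s\<bar> + 1)) * \<bar>a s\<bar>"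
    using potter_bound[OF a \<delta>_pos] by blast
  have "\<forall>\<^sub>F s in at_top. \<bar>h s / a s\<bar> < \<bar>L\<bar> + 1"
    by (rule order_tendstoD(2)[OF tendsto_rabs[OF lim]]) simp
  then obtain S1 where S1: "\<And>s. s \<ge> S1 \<Longrightarrow> \<bar>h s / a s\<bar> < \<bar>L\<bar> + 1"
    by (auto simp: eventually_at_top_linorder)
  define S where "S = max S0 S1"
  obtain D where D: "\<And>u. u \<le> S \<Longrightarrow> \<bar>h u\<bar> \<le> D * exp (-\<theta> * u)"
    using bound by blast
  have "D * exp (-\<theta> * S) \<ge> 0" using D[of S] by (smt (verit) abs_ge_zero)
  then have D0: "D \<ge> 0" by (simp add: zero_le_mult_iff)
  have aS: "a S \<noteq> 0" using S0(2)[of S S] by (auto simp: S_def)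
  define C where "C = (\<bar>L\<bar> + 1) * exp \<delta> + D * exp \<delta> / \<bar>a S\<bar>"
  have "\<bar>h (s + w)\<bar> \<le> C * \<bar>a s\<bar> * (exp (-\<theta> * w) + exp (\<delta> * \<bar>w\<bar>))" if s: "s \<ge> S" for s w
  proof (cases "s + w \<ge> S")
    case True
    have nz: "a (s + w) \<noteq> 0" using S0(2)[of "s + w" "s + w"] True by (auto simp: S_def)
    have "\<bar>h (s + w)\<bar> \<le> (\<bar>L\<bar> + 1) * \<bar>a (s + w)\<bar>"
      using S1[of "s + w"] True nz by (auto simp: S_def abs_divide divide_simps)
    also have "\<dots> \<le> (\<bar>L\<bar> + 1) * (exp (\<delta> * (\<bar>w\<bar> + 1)) * \<bar>a s\<bar>)"
      using S0(2)[of s "s + w"] True s by (intro mult_left_mono) (auto simp: S_def)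
    also have "\<dots> = (\<bar>L\<bar> + 1) * exp \<delta> * (\<bar>a s\<bar> * exp (\<delta> * \<bar>w\<bar>))"
      by (simp add: algebra_simps exp_add[symmetric])
    also have "\<dots> \<le> C * (\<bar>a s\<bar> * (exp (-\<theta> * w) + exp (\<delta> * \<bar>w\<bar>)))"
      using D0 by (intro mult_mono) (auto simp: C_def)
    finally show ?thesis by (simp add: mult.assoc)
  next
    case False
    have "\<bar>a S\<bar> \<le> exp (\<delta> * (\<bar>S - s\<bar> + 1)) * \<bar>a s\<bar>"
      using S0(2)[of s S] s by (auto simp: S_def)
    then have 1: "1 \<le> exp (\<delta> * (\<bar>S - s\<bar> + 1)) * \<bar>a s\<bar> / \<bar>a S\<bar>"
      using aS by (simp add: divide_simps)
    have "\<delta> * s \<le> \<theta> * s"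
      using s S0(1) \<delta>_le_\<theta> by (intro mult_right_mono) (auto simp: S_def)
    moreover have "0 \<le> \<delta> * S" using S0(1) \<delta>_pos by (auto simp: S_def)
    ultimately have 2: "-\<theta> * (s + w) + \<delta> * (\<bar>S - s\<bar> + 1) \<le> \<delta> + -\<theta> * w"
      using s by (simp add: algebra_simps)
    have "\<bar>h (s + w)\<bar> \<le> D * exp (-\<theta> * (s + w)) * 1"
      using D[of "s + w"] False by simp
    also have "\<dots> \<le> D * exp (-\<theta> * (s + w)) * (exp (\<delta> * (\<bar>S - s\<bar> + 1)) * \<bar>a s\<bar> / \<bar>a S\<bar>)"
      using 1 D0 by (intro mult_left_mono) auto
    also have "\<dots> = D / \<bar>a S\<bar> * \<bar>a s\<bar> * exp (-\<theta> * (s + w) + \<delta> * (\<bar>S - s\<bar> + 1))"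
      unfolding exp_add by simp
    also have "\<dots> \<le> D / \<bar>a S\<bar> * \<bar>a s\<bar> * exp (\<delta> + -\<theta> * w)"
      using 2 D0 by (intro mult_left_mono) auto
    also have "\<dots> = D * exp \<delta> / \<bar>a S\<bar> * (\<bar>a s\<bar> * exp (-\<theta> * w))"
      unfolding exp_add by simp
    also have "\<dots> \<le> C * (\<bar>a s\<bar> * (exp (-\<theta> * w) + exp (\<delta> * \<bar>w\<bar>)))"
      using D0 by (intro mult_mono) (auto simp: C_def)
    finally show ?thesis by (simp add: mult.assoc)
  qed
  then show thesis by (rule that)
qed

text \<open>Pointwise, \<open>h (s + w) / a s\<close> is \<open>h / a\<close> at
  \<open>s + w\<close> times \<open>a (s + w) / a s\<close>, so dominated convergence applies. It is
  used for \<phi> itself, for the increments of \<phi> with second-order normalisation, and with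
  limit 0 for the part of \<phi> on which monotonicity fails.\<close>

lemma convolution_slow_limit:
  assumes a: "additively_slow a"
    and h: "h \<in> borel_measurable lebesgue"
    and lim: "((\<lambda>s. h s / a s) \<longlongrightarrow> L) at_top"
    and bound: "\<And>b. \<exists>C. \<forall>u\<le>b. \<bar>h u\<bar> \<le> C * exp (-\<theta> * u)"
  shows "integrable lebesgue (\<lambda>w. \<kappa> w * h (s + w))"
    and "((\<lambda>s. (LINT w|lebesgue. \<kappa> w * h (s + w)) / a s) \<longlongrightarrow> L * (LINT w|lebesgue. \<kappa> w)) at_top"
proof -
  note [measurable] = borel_measurable_lebesgue_translate[OF h]
  obtain S C where SC: "\<And>s w. s \<ge> S \<Longrightarrow>
      \<bar>h (s + w)\<bar> \<le> C * \<bar>a s\<bar> * (exp (-\<theta> * w) + exp (\<delta> * \<bar>w\<bar>))"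
    using convolution_domination[OF a lim bound] by blast
  show "integrable lebesgue (\<lambda>w. \<kappa> w * h (s + w))"
  proof -
    \<comment> \<open>Integrability is claimed for every \<open>s\<close>, also below the threshold.
      The domination is read at \<open>s + r\<close> with \<open>w - r\<close> in place of
      \<open>w\<close>, which changes the weight by at most the factor
      \<open>exp (\<theta> * r)\<close>.\<close>
    define r where "r = \<bar>S - s\<bar>"
    define C' where "C' = C * \<bar>a (s + r)\<bar>"
    have r: "s + r \<ge> S" "r \<ge> 0" by (auto simp: r_def)
    have "0 \<le> C' * (exp (-\<theta> * 0) + exp (\<delta> * \<bar>0\<bar>))"
      using SC[OF r(1), of 0] unfolding C'_def by (smt (verit) abs_ge_zero)
    then have C': "C' \<ge> 0" by simp
    show ?thesis
    proof (rule integrable_dominated[where C = "C' * exp (\<theta> * r)"])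
      fix w
      have "\<bar>h (s + w)\<bar> \<le> C' * (exp (-\<theta> * (w - r)) + exp (\<delta> * \<bar>w - r\<bar>))"
        using SC[OF r(1), of "w - r"] by (simp add: C'_def)
      also have "\<dots> \<le> C' * (exp (\<theta> * r) * exp (-\<theta> * w) + exp (\<theta> * r) * exp (\<delta> * \<bar>w\<bar>))"
      proof (intro mult_left_mono add_mono C')
        have "\<delta> * \<bar>w - r\<bar> \<le> \<delta> * (r + \<bar>w\<bar>)"
          using \<delta>_pos r by (intro mult_left_mono) auto
        also have "\<dots> \<le> \<theta> * r + \<delta> * \<bar>w\<bar>"
          using r \<delta>_le_\<theta> by (simp add: distrib_left mult_right_mono)
        finally show "exp (\<delta> * \<bar>w - r\<bar>) \<le> exp (\<theta> * r) * exp (\<delta> * \<bar>w\<bar>)"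
          by (simp add: exp_add[symmetric])
      qed (simp add: exp_add[symmetric] algebra_simps)
      finally have "\<bar>h (s + w)\<bar> \<le> C' * exp (\<theta> * r) * (exp (-\<theta> * w) + exp (\<delta> * \<bar>w\<bar>))"
        by (simp add: algebra_simps)
      then show "norm (\<kappa> w * h (s + w)) \<le> \<kappa> w * (C' * exp (\<theta> * r) * (exp (-\<theta> * w) + exp (\<delta> * \<bar>w\<bar>)))"
        using kernel_nonneg[of w] by (simp add: abs_mult mult_left_mono)
    qed measurable
  qed
  obtain S' where S': "\<And>s. s \<ge> S' \<Longrightarrow> a s \<noteq> 0"
    using additively_slow_eventually_nonzero[OF a] by (auto simp: eventually_at_top_linorder)
  have "((\<lambda>s. LINT w|lebesgue. \<kappa> w * h (s + w) / a s) \<longlongrightarrow> (LINT w|lebesgue. \<kappa> w * L)) at_top"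
  proof (rule integral_dominated_convergence_at_top[where w = "\<lambda>w. C * (\<kappa> w * (exp (-\<theta> * w) + exp (\<delta> * \<bar>w\<bar>)))"])
    show "integrable lebesgue (\<lambda>w. C * (\<kappa> w * (exp (-\<theta> * w) + exp (\<delta> * \<bar>w\<bar>))))"
      by (intro integrable_mult_right kernel_weighted)
    show "AE w in lebesgue. ((\<lambda>s. \<kappa> w * h (s + w) / a s) \<longlongrightarrow> \<kappa> w * L) at_top"
    proof (rule AE_I2)
      fix w :: real
      have shift: "filterlim (\<lambda>s. s + w) at_top at_top"
        by (rule filterlim_plus_const_at_top)
      have "((\<lambda>s. \<kappa> w * ((h (s + w) / a (s + w)) * (a (s + w) / a s))) \<longlongrightarrow> \<kappa> w * (L * 1)) at_top"
        using a filterlim_compose[OF lim shift] unfolding additively_slow_def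
        by (intro tendsto_mult tendsto_const) auto
      moreover have "\<forall>\<^sub>F s in at_top. \<kappa> w * ((h (s + w) / a (s + w)) * (a (s + w) / a s)) = \<kappa> w * h (s + w) / a s"
        using eventually_ge_at_top[of "S' - w"] by eventually_elim (use S' in auto)
      ultimately show "((\<lambda>s. \<kappa> w * h (s + w) / a s) \<longlongrightarrow> \<kappa> w * L) at_top"
        by (auto elim: Lim_transform_eventually)
    qed
    show "\<forall>\<^sub>F s in at_top. AE w in lebesgue.
        norm (\<kappa> w * h (s + w) / a s) \<le> C * (\<kappa> w * (exp (-\<theta> * w) + exp (\<delta> * \<bar>w\<bar>)))"
      using eventually_ge_at_top[of "max S S'"]
    proof eventually_elim
      case (elim s)
      have "\<bar>h (s + w) / a s\<bar> \<le> C * (exp (-\<theta> * w) + exp (\<delta> * \<bar>w\<bar>))" for w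
        using SC[of s w] S'[of s] elim by (simp add: abs_divide divide_simps mult_ac)
      then have "\<kappa> w * \<bar>h (s + w) / a s\<bar> \<le> \<kappa> w * (C * (exp (-\<theta> * w) + exp (\<delta> * \<bar>w\<bar>)))" for w
        using kernel_nonneg by (rule mult_left_mono)
      then show ?case
        using kernel_nonneg by (intro AE_I2) (simp add: abs_mult abs_divide mult_ac)
    qed
  qed measurable
  then show "((\<lambda>s. (LINT w|lebesgue. \<kappa> w * h (s + w)) / a s) \<longlongrightarrow> L * (LINT w|lebesgue. \<kappa> w)) at_top"
    by (simp add: mult.commute)
qed

end

section \<open>Wiener's theorem for Fejer kernels\<close>

lemma norm_cis_diff_le: "norm (cis a - cis b) \<le> \<bar>a - b\<bar>"
proof -
  have "cis a - cis b = cis b * (exp (\<i> * of_real (a - b)) - 1)"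
    unfolding cis_conv_exp[symmetric] by (simp add: right_diff_distrib cis_mult)
  then have "norm (cis a - cis b) = 2 * \<bar>sin ((a - b) / 2)\<bar>"
    by (simp add: norm_mult dist_exp_i_1 del: of_real_diff)
  also have "\<dots> \<le> \<bar>a - b\<bar>"
    using abs_sin_x_le_abs_x[of "(a - b) / 2"] by simp
  finally show ?thesis .
qed

lemma has_vector_derivative_complex_quotient:
  fixes f :: "real \<Rightarrow> complex"
  assumes "((\<lambda>h. (f (x + h) - f x) / of_real h) \<longlongrightarrow> D) (at 0)"
  shows "(f has_vector_derivative D) (at x)"
proof -
  have "((\<lambda>h. (Re (f (x + h)) - Re (f x)) / h) \<longlongrightarrow> Re D) (at 0)"
    "((\<lambda>h. (Im (f (x + h)) - Im (f x)) / h) \<longlongrightarrow> Im D) (at 0)"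
    using tendsto_Re[OF assms] tendsto_Im[OF assms] by simp_all
  then show ?thesis
    by (simp add: has_vector_derivative_complex_iff DERIV_def)
qed

definition fourier_int :: "(real \<Rightarrow> complex) \<Rightarrow> real \<Rightarrow> complex" where
  "fourier_int k \<xi> = (LINT w|lborel. k w * cis (- (\<xi> * w)))"

lemma measurable_cis [measurable]: "cis \<in> borel_measurable borel"
  by (intro borel_measurable_continuous_onI continuous_intros)

lemma integrable_mult_cis:
  fixes k :: "'a \<Rightarrow> complex"
  assumes "integrable M k" "f \<in> borel_measurable M"
  shows "integrable M (\<lambda>w. k w * cis (f w))"
  by (rule Bochner_Integration.integrable_bound[OF assms(1)])
    (use assms in \<open>auto simp: norm_mult\<close>)

lemma continuous_fourier_int:
  assumes k: "integrable lborel k"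
  shows "continuous_on UNIV (fourier_int k)"
proof -
  have [measurable]: "k \<in> borel_measurable lborel" using k by auto
  have "fourier_int k \<midarrow>\<xi>\<rightarrow> fourier_int k \<xi>" for \<xi>
    unfolding tendsto_at_iff_sequentially comp_def
  proof (intro allI impI)
    fix X :: "nat \<Rightarrow> real" assume X: "X \<longlonglongrightarrow> \<xi>"
    show "(\<lambda>n. fourier_int k (X n)) \<longlonglongrightarrow> fourier_int k \<xi>"
      unfolding fourier_int_def
    proof (rule integral_dominated_convergence[where w = "\<lambda>w. norm (k w)"])
      show "AE w in lborel. (\<lambda>n. k w * cis (- (X n * w))) \<longlonglongrightarrow> k w * cis (- (\<xi> * w))"
        by (intro AE_I2 tendsto_intros X)
    qed (use k in \<open>auto simp: norm_mult\<close>)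
  qed
  then show ?thesis by (simp add: continuous_on_def)
qed

text \<open>Difference quotients of \<open>cis (- (\<xi> * w))\<close> in \<xi> are at most
  \<open>\<bar>w\<bar>\<close> in norm, so the first moment of \<open>k\<close> dominates them. Two
  applications differentiate the transform of the kernel twice.\<close>

lemma fourier_int_has_vector_derivative:
  assumes k: "integrable lborel k" and wk: "integrable lborel (\<lambda>w. of_real w * k w)"
  shows "(fourier_int k has_vector_derivative fourier_int (\<lambda>w. - \<i> * of_real w * k w) \<xi>) (at \<xi>)"
proof (rule has_vector_derivative_complex_quotient)
  have [measurable]: "k \<in> borel_measurable lborel" using k by auto
  have wk': "integrable lborel (\<lambda>w. norm (of_real w * k w))" using wk by auto
  show "((\<lambda>h. (fourier_int k (\<xi> + h) - fourier_int k \<xi>) / of_real h) \<longlongrightarrow>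
      fourier_int (\<lambda>w. - \<i> * of_real w * k w) \<xi>) (at 0)"
    unfolding tendsto_at_iff_sequentially comp_def
  proof (intro allI impI)
    fix X :: "nat \<Rightarrow> real" assume X: "X \<longlonglongrightarrow> 0" and nz: "\<forall>i. X i \<in> UNIV - {0}"
    have [simp]: "X n \<noteq> 0" for n using nz by auto
    have X': "filterlim X (at 0) sequentially"
      using X by (simp add: filterlim_at)
    have eq: "(fourier_int k (\<xi> + X n) - fourier_int k \<xi>) / of_real (X n) =
        (LINT w|lborel. k w * ((cis (- ((\<xi> + X n) * w)) - cis (- (\<xi> * w))) / of_real (X n)))" for n
    proof -
      have "fourier_int k (\<xi> + X n) - fourier_int k \<xi> =
          (LINT w|lborel. k w * cis (- ((\<xi> + X n) * w)) - k w * cis (- (\<xi> * w)))"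
        unfolding fourier_int_def
        by (intro Bochner_Integration.integral_diff[symmetric] integrable_mult_cis k) auto
      also have "\<dots> / of_real (X n) =
          (LINT w|lborel. (k w * cis (- ((\<xi> + X n) * w)) - k w * cis (- (\<xi> * w))) / of_real (X n))"
        by simp
      finally show ?thesis
        by (simp add: diff_divide_distrib right_diff_distrib)
    qed
    show "(\<lambda>n. (fourier_int k (\<xi> + X n) - fourier_int k \<xi>) / of_real (X n)) \<longlonglongrightarrow>
        fourier_int (\<lambda>w. - \<i> * of_real w * k w) \<xi>"
      unfolding eq unfolding fourier_int_def
    proof (rule integral_dominated_convergence[where w = "\<lambda>w. norm (of_real w * k w)"])
      show "AE w in lborel. (\<lambda>n. k w * ((cis (- ((\<xi> + X n) * w)) - cis (- (\<xi> * w))) / of_real (X n)))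
          \<longlonglongrightarrow> - \<i> * of_real w * k w * cis (- (\<xi> * w))"
      proof (rule AE_I2)
        fix w :: real
        have "((\<lambda>x. cis (- (x * w))) has_vector_derivative (- w) *\<^sub>R (\<i> * cis (- (\<xi> * w)))) (at \<xi>)"
          unfolding has_vector_derivative_def
          by (auto intro!: derivative_eq_intros simp: fun_eq_iff)
        then have "((\<lambda>h. (cis (- ((\<xi> + h) * w)) - cis (- (\<xi> * w))) / of_real h)
            \<longlongrightarrow> (- w) *\<^sub>R (\<i> * cis (- (\<xi> * w)))) (at 0)"
          unfolding has_vector_derivative_complex_iff DERIV_def
          by (intro tendsto_complex_iff[THEN iffD2]) simp
        from filterlim_compose[OF this X']
        have "(\<lambda>n. k w * ((cis (- ((\<xi> + X n) * w)) - cis (- (\<xi> * w))) / of_real (X n)))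
          \<longlonglongrightarrow> k w * ((- w) *\<^sub>R (\<i> * cis (- (\<xi> * w))))"
          by (intro tendsto_mult tendsto_const)
        then show "(\<lambda>n. k w * ((cis (- ((\<xi> + X n) * w)) - cis (- (\<xi> * w))) / of_real (X n)))
          \<longlonglongrightarrow> - \<i> * of_real w * k w * cis (- (\<xi> * w))"
          by (simp add: scaleR_conv_of_real mult_ac)
      qed
      show "AE w in lborel. norm (k w * ((cis (- ((\<xi> + X n) * w)) - cis (- (\<xi> * w))) / of_real (X n)))
          \<le> norm (of_real w * k w)" for n
      proof (rule AE_I2)
        fix w :: real
        have "norm (cis (- ((\<xi> + X n) * w)) - cis (- (\<xi> * w))) \<le> \<bar>X n\<bar> * \<bar>w\<bar>"
          using norm_cis_diff_le[of "- ((\<xi> + X n) * w)" "- (\<xi> * w)"]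
          by (simp add: algebra_simps abs_mult)
        then have "norm ((cis (- ((\<xi> + X n) * w)) - cis (- (\<xi> * w))) / of_real (X n)) \<le> \<bar>w\<bar>"
          by (simp add: norm_divide divide_simps mult.commute)
        then have "norm (k w) * norm ((cis (- ((\<xi> + X n) * w)) - cis (- (\<xi> * w))) / of_real (X n)) \<le> norm (k w) * \<bar>w\<bar>"
          by (intro mult_left_mono) auto
        then show "norm (k w * ((cis (- ((\<xi> + X n) * w)) - cis (- (\<xi> * w))) / of_real (X n)))
          \<le> norm (of_real w * k w)"
          by (simp add: norm_mult mult.commute[of "\<bar>w\<bar>"] del: times_divide_eq_right)
      qed
    qed (use wk' in measurable)
  qed
qed

section \<open>Inverse Fourier transforms of functions cut off by a triangle\<close>

text \<open>One use of the fundamental theorem of calculus for the primitive \<open>G\<close>, in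
  whose derivative the terms with \<open>f'\<close> cancel because \<open>1 / \<i> = - \<i>\<close>.
  The boundary terms are kept exact: those of order \<open>1 / x\<close> have to cancel when two
  intervals are joined.\<close>

lemma fourier_integral_by_parts_twice:
  fixes f f' f'' :: "real \<Rightarrow> complex"
  assumes "a \<le> b" and x: "x \<noteq> 0"
    and f: "\<And>\<xi>. (f has_vector_derivative f' \<xi>) (at \<xi>)"
    and f': "\<And>\<xi>. (f' has_vector_derivative f'' \<xi>) (at \<xi>)"
    and f'': "continuous_on UNIV f''"
  shows "(LINT \<xi>:{a..b}|lborel. f \<xi> * cis (\<xi> * x)) =
    (cis (b * x) * (f b / (\<i> * of_real x) + f' b / of_real (x\<^sup>2))
     - cis (a * x) * (f a / (\<i> * of_real x) + f' a / of_real (x\<^sup>2)))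
    - (LINT \<xi>:{a..b}|lborel. f'' \<xi> * cis (\<xi> * x)) / of_real (x\<^sup>2)"
proof -
  have cf: "continuous_on A f" for A
    using f by (intro continuous_at_imp_continuous_on) (auto intro: has_vector_derivative_continuous)
  have cf'': "continuous_on A f''" for A
    using f'' by (rule continuous_on_subset) auto
  define G where "G \<xi> = cis (\<xi> * x) * (f \<xi> / (\<i> * of_real x) + f' \<xi> / of_real (x\<^sup>2))" for \<xi>
  have G: "(G has_vector_derivative f \<xi> * cis (\<xi> * x) + f'' \<xi> * cis (\<xi> * x) / of_real (x\<^sup>2)) (at \<xi>)" for \<xi>
  proof -
    have cis': "((\<lambda>\<xi>. cis (\<xi> * x)) has_vector_derivative x *\<^sub>R (\<i> * cis (\<xi> * x))) (at \<xi>)"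
      unfolding has_vector_derivative_def
      by (auto intro!: derivative_eq_intros simp: fun_eq_iff)
    have "(G has_vector_derivative (cis (\<xi> * x) * (f' \<xi> / (\<i> * of_real x) + f'' \<xi> / of_real (x\<^sup>2))
       + x *\<^sub>R (\<i> * cis (\<xi> * x)) * (f \<xi> / (\<i> * of_real x) + f' \<xi> / of_real (x\<^sup>2)))) (at \<xi>)"
      unfolding G_def
      by (intro has_vector_derivative_mult has_vector_derivative_add has_vector_derivative_divide cis' f f')
    then show ?thesis
      by (rule has_vector_derivative_eq_rhs)
        (use x in \<open>simp add: scaleR_conv_of_real field_simps power2_eq_square\<close>)
  qed
  have "(LINT \<xi>|lborel. indicator {a..b} \<xi> *\<^sub>R (f \<xi> * cis (\<xi> * x) + f'' \<xi> * cis (\<xi> * x) / of_real (x\<^sup>2))) = G b - G a"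
    by (rule integral_FTC_Icc[OF \<open>a \<le> b\<close> has_vector_derivative_at_within[OF G]])
      (use x in \<open>auto intro!: continuous_intros cf cf''\<close>)
  moreover have "set_integrable lborel {a..b} (\<lambda>\<xi>. f \<xi> * cis (\<xi> * x))"
    "set_integrable lborel {a..b} (\<lambda>\<xi>. f'' \<xi> * cis (\<xi> * x) / of_real (x\<^sup>2))"
    using x by (auto intro!: borel_integrable_atLeastAtMost' continuous_intros cf cf'')
  ultimately have "(LINT \<xi>:{a..b}|lborel. f \<xi> * cis (\<xi> * x))
     + (LINT \<xi>:{a..b}|lborel. f'' \<xi> * cis (\<xi> * x) / of_real (x\<^sup>2)) = G b - G a"
    by (subst set_integral_add(2)[symmetric]) (auto simp: set_lebesgue_integral_def)
  then show ?thesis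
    unfolding G_def by (simp add: algebra_simps)
qed

text \<open>Up to the factor \<open>2 * pi\<close>, the inverse Fourier transform of
  \<open>g\<close> times the triangle function of [-R, R].\<close>

definition triangle_transform :: "real \<Rightarrow> (real \<Rightarrow> complex) \<Rightarrow> real \<Rightarrow> complex" where
  "triangle_transform R g x =
     (LINT \<xi>:{-R..R}|lborel. of_real (1 - \<bar>\<xi>\<bar> / R) * g \<xi> * cis (\<xi> * x))"

text \<open>Every boundary term of order \<open>1 / x\<close> disappears, since the triangle
  vanishes at both ends and is continuous at 0. The surviving values of \<open>g\<close> at 0,
  \<open>R\<close> and \<open>- R\<close> are weighted by the jumps of the slope there.\<close>

lemma triangle_transform_split:
  fixes g g' g'' :: "real \<Rightarrow> complex"
  assumes "R > 0" and x: "x \<noteq> 0"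
    and g: "\<And>\<xi>. (g has_vector_derivative g' \<xi>) (at \<xi>)"
    and g': "\<And>\<xi>. (g' has_vector_derivative g'' \<xi>) (at \<xi>)"
    and g'': "continuous_on UNIV g''"
  shows "triangle_transform R g x =
    (2 * g 0 / of_real R - cis (R * x) * g R / of_real R - cis (- (R * x)) * g (- R) / of_real R
      - (LINT \<xi>:{-R..0}|lborel. (2 * g' \<xi> / of_real R + of_real (1 + \<xi> / R) * g'' \<xi>) * cis (\<xi> * x))
      - (LINT \<xi>:{0..R}|lborel. (- 2 * g' \<xi> / of_real R + of_real (1 - \<xi> / R) * g'' \<xi>) * cis (\<xi> * x)))
    / of_real (x\<^sup>2)"
proof -
  have cg: "continuous_on A g" for A
    using g by (intro continuous_at_imp_continuous_on) (auto intro: has_vector_derivative_continuous)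
  have cg': "continuous_on A g'" for A
    using g' by (intro continuous_at_imp_continuous_on) (auto intro: has_vector_derivative_continuous)
  have cg'': "continuous_on A g''" for A
    using g'' by (rule continuous_on_subset) auto
  \<comment> \<open>One formula covers both halves of the triangle: the slope \<open>c\<close> is
    \<open>1 / R\<close> on the left and \<open>- 1 / R\<close> on the right.\<close>
  have *: "(LINT \<xi>:{a..b}|lborel. of_real (1 + c * \<xi>) * g \<xi> * cis (\<xi> * x)) =
    (cis (b * x) * (of_real (1 + c * b) * g b / (\<i> * of_real x)
        + (of_real c * g b + of_real (1 + c * b) * g' b) / of_real (x\<^sup>2))
     - cis (a * x) * (of_real (1 + c * a) * g a / (\<i> * of_real x)
        + (of_real c * g a + of_real (1 + c * a) * g' a) / of_real (x\<^sup>2)))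
    - (LINT \<xi>:{a..b}|lborel. (2 * of_real c * g' \<xi> + of_real (1 + c * \<xi>) * g'' \<xi>) * cis (\<xi> * x)) / of_real (x\<^sup>2)"
    if "a \<le> b" for a b c
  proof (rule fourier_integral_by_parts_twice[OF that x])
    have lin: "((\<lambda>\<xi>. complex_of_real (1 + c * \<xi>)) has_vector_derivative of_real c) (at \<xi>)" for \<xi>
      by (auto intro!: derivative_eq_intros has_vector_derivative_of_real)
    show "((\<lambda>\<xi>. of_real (1 + c * \<xi>) * g \<xi>) has_vector_derivative
        of_real c * g \<xi> + of_real (1 + c * \<xi>) * g' \<xi>) (at \<xi>)" for \<xi>
      by (rule has_vector_derivative_eq_rhs[OF has_vector_derivative_mult[OF lin g]]) (simp add: algebra_simps)
    show "((\<lambda>\<xi>. of_real c * g \<xi> + of_real (1 + c * \<xi>) * g' \<xi>) has_vector_derivative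
        2 * of_real c * g' \<xi> + of_real (1 + c * \<xi>) * g'' \<xi>) (at \<xi>)" for \<xi>
      by (rule has_vector_derivative_eq_rhs[OF has_vector_derivative_add[OF
          has_vector_derivative_mult_right[OF g] has_vector_derivative_mult[OF lin g']]])
        (simp add: algebra_simps)
    show "continuous_on UNIV (\<lambda>\<xi>. 2 * of_real c * g' \<xi> + of_real (1 + c * \<xi>) * g'' \<xi>)"
      by (intro continuous_intros cg' cg'')
  qed
  have int: "set_integrable lborel {a..b} (\<lambda>\<xi>. of_real (1 - \<bar>\<xi>\<bar> / R) * g \<xi> * cis (\<xi> * x))" for a b
    using \<open>R > 0\<close> by (intro borel_integrable_atLeastAtMost' continuous_intros cg) auto
  have "AE \<xi> in lborel. \<xi> \<noteq> (0 :: real)" by (rule AE_lborel_singleton)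
  then have "triangle_transform R g x =
      (LINT \<xi>|lborel. indicator {-R..0} \<xi> *\<^sub>R (of_real (1 - \<bar>\<xi>\<bar> / R) * g \<xi> * cis (\<xi> * x))
        + indicator {0..R} \<xi> *\<^sub>R (of_real (1 - \<bar>\<xi>\<bar> / R) * g \<xi> * cis (\<xi> * x)))"
    unfolding triangle_transform_def set_lebesgue_integral_def
  proof (intro integral_cong_AE)
    show "AE \<xi> in lborel. indicator {-R..R} \<xi> *\<^sub>R (of_real (1 - \<bar>\<xi>\<bar> / R) * g \<xi> * cis (\<xi> * x)) =
        indicator {-R..0} \<xi> *\<^sub>R (of_real (1 - \<bar>\<xi>\<bar> / R) * g \<xi> * cis (\<xi> * x))
        + indicator {0..R} \<xi> *\<^sub>R (of_real (1 - \<bar>\<xi>\<bar> / R) * g \<xi> * cis (\<xi> * x))"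
      if "AE \<xi> in lborel. \<xi> \<noteq> (0 :: real)"
      using that by eventually_elim (use \<open>R > 0\<close> in \<open>auto simp: indicator_def\<close>)
  qed (use int in \<open>auto simp: set_integrable_def\<close>)
  also have "\<dots> = (LINT \<xi>:{-R..0}|lborel. of_real (1 - \<bar>\<xi>\<bar> / R) * g \<xi> * cis (\<xi> * x))
      + (LINT \<xi>:{0..R}|lborel. of_real (1 - \<bar>\<xi>\<bar> / R) * g \<xi> * cis (\<xi> * x))"
    unfolding set_lebesgue_integral_def
    by (intro Bochner_Integration.integral_add) (use int in \<open>auto simp: set_integrable_def\<close>)
  also have "(LINT \<xi>:{-R..0}|lborel. of_real (1 - \<bar>\<xi>\<bar> / R) * g \<xi> * cis (\<xi> * x)) =
      (LINT \<xi>:{-R..0}|lborel. of_real (1 + (1 / R) * \<xi>) * g \<xi> * cis (\<xi> * x))"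
    by (intro set_lebesgue_integral_cong) (auto simp: abs_of_nonpos)
  also have "(LINT \<xi>:{0..R}|lborel. of_real (1 - \<bar>\<xi>\<bar> / R) * g \<xi> * cis (\<xi> * x)) =
      (LINT \<xi>:{0..R}|lborel. of_real (1 + (- 1 / R) * \<xi>) * g \<xi> * cis (\<xi> * x))"
    by (intro set_lebesgue_integral_cong) auto
  also have "(LINT \<xi>:{-R..0}|lborel. of_real (1 + (1 / R) * \<xi>) * g \<xi> * cis (\<xi> * x)) + \<dots> =
    (2 * g 0 / of_real R - cis (R * x) * g R / of_real R - cis (- (R * x)) * g (- R) / of_real R
      - (LINT \<xi>:{-R..0}|lborel. (2 * g' \<xi> / of_real R + of_real (1 + \<xi> / R) * g'' \<xi>) * cis (\<xi> * x))
      - (LINT \<xi>:{0..R}|lborel. (- 2 * g' \<xi> / of_real R + of_real (1 - \<xi> / R) * g'' \<xi>) * cis (\<xi> * x)))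
    / of_real (x\<^sup>2)"
    using \<open>R > 0\<close> by (subst (1 2) *) (simp_all add: diff_divide_distrib add_divide_distrib)
  finally show ?thesis .
qed

lemma norm_set_integral_mult_cis_le:
  fixes f :: "'a \<Rightarrow> complex"
  shows "norm (LINT x:S|M. f x * cis (h x)) \<le> (LINT x:S|M. norm (f x))"
proof -
  have "norm (LINT x:S|M. f x * cis (h x)) \<le> (LINT x|M. norm (indicator S x *\<^sub>R (f x * cis (h x))))"
    unfolding set_lebesgue_integral_def by (rule integral_norm_bound)
  also have "\<dots> = (LINT x:S|M. norm (f x))"
    unfolding set_lebesgue_integral_def
    by (intro Bochner_Integration.integral_cong) (auto simp: norm_mult indicator_def)
  finally show ?thesis .
qed

text \<open>The trivial bound \<open>M0\<close> controls the transform itself and integration by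
  parts controls \<open>x\<^sup>2\<close> times it; adding the two gives a majorant that is also
  finite at 0.\<close>

lemma triangle_transform_decay:
  fixes g g' g'' :: "real \<Rightarrow> complex"
  assumes "R > 0"
    and g: "\<And>\<xi>. (g has_vector_derivative g' \<xi>) (at \<xi>)"
    and g': "\<And>\<xi>. (g' has_vector_derivative g'' \<xi>) (at \<xi>)"
    and g'': "continuous_on UNIV g''"
  shows "\<exists>M. \<forall>x. norm (triangle_transform R g x) \<le> M * inverse (1 + x\<^sup>2)"
proof -
  define M0 where "M0 = (LINT \<xi>:{-R..R}|lborel. norm (of_real (1 - \<bar>\<xi>\<bar> / R) * g \<xi>))"
  define N1 where "N1 = (LINT \<xi>:{-R..0}|lborel. norm (2 * g' \<xi> / of_real R + of_real (1 + \<xi> / R) * g'' \<xi>))"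
  define N2 where "N2 = (LINT \<xi>:{0..R}|lborel. norm (- 2 * g' \<xi> / of_real R + of_real (1 - \<xi> / R) * g'' \<xi>))"
  define M1 where "M1 = norm (2 * g 0 / of_real R) + norm (g R / of_real R) + norm (g (- R) / of_real R) + N1 + N2"
  have 0: "norm (triangle_transform R g x) \<le> M0" for x
    unfolding triangle_transform_def M0_def by (rule norm_set_integral_mult_cis_le)
  have 1: "x\<^sup>2 * norm (triangle_transform R g x) \<le> M1" if x: "x \<noteq> 0" for x
  proof -
    define A where "A = 2 * g 0 / complex_of_real R"
    define B where "B = cis (R * x) * g R / complex_of_real R"
    define C where "C = cis (- (R * x)) * g (- R) / complex_of_real R"
    define D where "D = (LINT \<xi>:{-R..0}|lborel. (2 * g' \<xi> / of_real R + of_real (1 + \<xi> / R) * g'' \<xi>) * cis (\<xi> * x))"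
    define E where "E = (LINT \<xi>:{0..R}|lborel. (- 2 * g' \<xi> / of_real R + of_real (1 - \<xi> / R) * g'' \<xi>) * cis (\<xi> * x))"
    have "x\<^sup>2 * norm (triangle_transform R g x) = norm (A - B - C - D - E)"
      using triangle_transform_split[OF \<open>R > 0\<close> x g g' g''] x
      unfolding A_def B_def C_def D_def E_def by (simp add: norm_divide norm_power)
    also have "\<dots> \<le> norm A + norm B + norm C + norm D + norm E"
      using norm_triangle_ineq4[of "A - B - C - D" E] norm_triangle_ineq4[of "A - B - C" D]
        norm_triangle_ineq4[of "A - B" C] norm_triangle_ineq4[of A B] by linarith
    also have "\<dots> \<le> M1"
    proof -
      have "norm D \<le> N1" "norm E \<le> N2"
        unfolding D_def E_def N1_def N2_def by (rule norm_set_integral_mult_cis_le)+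
      then show ?thesis
        unfolding M1_def A_def B_def C_def by (simp add: norm_mult norm_divide)
    qed
    finally show ?thesis .
  qed
  have "norm (triangle_transform R g x) \<le> (M0 + \<bar>M1\<bar>) * inverse (1 + x\<^sup>2)" for x
  proof -
    have "x\<^sup>2 * norm (triangle_transform R g x) \<le> \<bar>M1\<bar>"
      using 1[of x] by (cases "x = 0") auto
    then have "(1 + x\<^sup>2) * norm (triangle_transform R g x) \<le> M0 + \<bar>M1\<bar>"
      using 0[of x] by (simp add: algebra_simps)
    moreover have "1 + x\<^sup>2 > 0" by (simp add: add_pos_nonneg)
    ultimately show ?thesis by (simp add: field_simps)
  qed
  then show ?thesis by blast
qed

lemma integrable_inverse_one_plus_square: "integrable lborel (\<lambda>x::real. inverse (1 + x\<^sup>2))"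
  using integrable_inverse_1_plus_square by (simp add: set_integrable_def einterval_def)

text \<open>Decay supplies the integrable majorant. Measurability comes from continuity, by reading
  the transform as a Fourier integral at \<open>- x\<close>.\<close>

lemma integrable_triangle_transform:
  fixes g g' g'' :: "real \<Rightarrow> complex"
  assumes "R > 0"
    and g: "\<And>\<xi>. (g has_vector_derivative g' \<xi>) (at \<xi>)"
    and g': "\<And>\<xi>. (g' has_vector_derivative g'' \<xi>) (at \<xi>)"
    and g'': "continuous_on UNIV g''"
  shows "integrable lborel (triangle_transform R g)"
proof -
  have cg: "continuous_on A g" for A
    using g by (intro continuous_at_imp_continuous_on) (auto intro: has_vector_derivative_continuous)
  obtain M where M: "\<And>x. norm (triangle_transform R g x) \<le> M * inverse (1 + x\<^sup>2)"
    using triangle_transform_decay[OF assms] by blast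
  define k where "k \<xi> = indicator {-R..R} \<xi> *\<^sub>R (of_real (1 - \<bar>\<xi>\<bar> / R) * g \<xi>)" for \<xi>
  have "set_integrable lborel {-R..R} (\<lambda>\<xi>. of_real (1 - \<bar>\<xi>\<bar> / R) * g \<xi>)"
    using \<open>R > 0\<close> by (intro borel_integrable_atLeastAtMost' continuous_intros cg) auto
  then have "integrable lborel k"
    unfolding set_integrable_def k_def[abs_def] .
  then have "continuous_on UNIV (\<lambda>x. fourier_int k (- x))"
    by (intro continuous_on_compose2[OF continuous_fourier_int] continuous_intros) auto
  also have "(\<lambda>x. fourier_int k (- x)) = triangle_transform R g"
    by (auto simp: fourier_int_def triangle_transform_def k_def set_lebesgue_integral_def mult.commute)
  finally have meas: "triangle_transform R g \<in> borel_measurable lborel"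
    by (simp add: borel_measurable_continuous_onI)
  show ?thesis
  proof (rule Bochner_Integration.integrable_bound[OF integrable_mult_right[OF integrable_inverse_one_plus_square, of M] meas])
    show "AE x in lborel. norm (triangle_transform R g x) \<le> norm (M * inverse (1 + x\<^sup>2))"
      using M by (intro AE_I2) (smt (verit) real_norm_def)
  qed
qed

section \<open>Fejer kernels\<close>

text \<open>The value at 0 is the junk value 0; only values outside null sets matter.\<close>

definition fejer :: "real \<Rightarrow> real \<Rightarrow> real" where
  "fejer R x = 2 * (1 - cos (R * x)) / (R * x\<^sup>2)"

lemma fejer_measurable [measurable]: "fejer R \<in> borel_measurable borel"
  unfolding fejer_def by measurable

lemma triangle_transform_one:
  assumes "R > 0" "x \<noteq> 0"
  shows "triangle_transform R (\<lambda>_. 1) x = of_real (fejer R x)"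
proof -
  have "triangle_transform R (\<lambda>_. 1) x = (2 / of_real R - cis (R * x) / of_real R - cis (- (R * x)) / of_real R) / of_real (x\<^sup>2)"
    using triangle_transform_split[OF assms, of "\<lambda>_. 1" "\<lambda>_. 0" "\<lambda>_. 0"] by simp
  also have "2 / of_real R - cis (R * x) / of_real R - cis (- (R * x)) / of_real R
      = complex_of_real (2 * (1 - cos (R * x)) / R)"
    by (simp add: complex_eq_iff diff_divide_distrib)
  finally show ?thesis
    by (simp add: fejer_def)
qed

lemma fejer_integrable:
  assumes "R > 0"
  shows "integrable lborel (fejer R)"
proof -
  have "integrable lborel (triangle_transform R (\<lambda>_. 1))"
    by (rule integrable_triangle_transform[OF assms, of _ "\<lambda>_. 0" "\<lambda>_. 0"]) auto
  then have "integrable lborel (\<lambda>x. Re (triangle_transform R (\<lambda>_. 1) x))" by simp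
  moreover have "AE x in lborel. Re (triangle_transform R (\<lambda>_. 1) x) = fejer R x"
    using AE_lborel_singleton[of 0] by eventually_elim (simp add: triangle_transform_one[OF assms])
  ultimately show ?thesis
    using integrable_cong_AE_imp[of lborel "\<lambda>x. Re (triangle_transform R (\<lambda>_. 1) x)" "fejer R"] by auto
qed

lemma fejer_nonneg: "R > 0 \<Longrightarrow> fejer R x \<ge> 0"
  by (simp add: fejer_def)

lemma fejer_integral_scale:
  assumes "R > 0"
  shows "(LINT x|lborel. fejer R x) = (LINT x|lborel. fejer 1 x)"
proof -
  have "fejer R x = R * fejer 1 (0 + R * x)" for x
    using assms by (simp add: fejer_def power2_eq_square)
  then have "(LINT x|lborel. fejer R x) = R * (LINT x|lborel. fejer 1 (0 + R * x))" by simp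
  also have "\<dots> = (LINT x|lborel. fejer 1 x)"
    using lborel_integral_real_affine[of R "fejer 1" 0] assms by simp
  finally show ?thesis .
qed

text \<open>This makes division by the total mass legitimate. On [1, 2] one has
  \<open>cos x \<le> cos 1\<close> and \<open>x\<^sup>2 \<le> 4\<close>, whence the constant
  \<open>2 * (1 - cos 1) / 4\<close>.\<close>

lemma fejer_integral_pos: "(LINT x|lborel. fejer 1 x) > 0"
proof -
  have "0 < (1 - cos (1::real)) / 2"
    using cos_monotone_0_pi[of 0 1] pi_gt3 by simp
  also have "\<dots> = (LINT x|lborel. indicator {1..2::real} x * ((1 - cos (1::real)) / 2))"
    by simp
  also have "\<dots> \<le> (LINT x|lborel. fejer 1 x)"
  proof (intro integral_mono fejer_integrable)
    fix x :: real
    show "indicator {1..2} x * ((1 - cos (1::real)) / 2) \<le> fejer 1 x"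
    proof (cases "x \<in> {1..2}")
      case True
      then have "cos x \<le> cos 1" using pi_gt3 by (intro cos_monotone_0_pi_le) auto
      moreover have "x\<^sup>2 \<le> 2\<^sup>2" using True by (intro power_mono) auto
      moreover have "0 < x\<^sup>2" using True by simp
      ultimately have "2 * (1 - cos 1) / 2\<^sup>2 \<le> 2 * (1 - cos x) / x\<^sup>2"
        by (intro frac_le) auto
      moreover have "indicator {1..2} x * ((1 - cos (1::real)) / 2) = 2 * (1 - cos 1) / 2\<^sup>2"
        using True by simp
      moreover have "fejer 1 x = 2 * (1 - cos x) / x\<^sup>2"
        by (simp add: fejer_def)
      ultimately show ?thesis by (simp only:)
    qed (use fejer_nonneg[of 1 x] in simp)
  qed auto
  finally show ?thesis .
qed

text \<open>Away from the origin the kernel is at most \<open>4 / (R * x\<^sup>2)\<close>, so the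
  mass outside [-h, h] is of order \<open>1 / R\<close>.\<close>

lemma fejer_tail:
  assumes "h > 0" "e > 0"
  obtains R where "R > 0" "(LINT x|lborel. indicator {x. \<bar>x\<bar> > h} x * fejer R x) \<le> e"
proof -
  define N where "N = (LINT x::real|lborel. inverse (1 + x\<^sup>2))"
  have N: "N \<ge> 0" unfolding N_def by (intro Bochner_Integration.integral_nonneg) simp
  define D where "D = 4 * (1 + 1 / h\<^sup>2)"
  have D: "D > 0" using assms by (simp add: D_def add_pos_nonneg)
  \<comment> \<open>For \<open>\<bar>x\<bar> > h\<close> one has
    \<open>1 + x\<^sup>2 \<le> (1 + 1 / h\<^sup>2) * x\<^sup>2\<close>, so \<open>D / R\<close>
    times \<open>inverse (1 + x\<^sup>2)\<close> is a majorant; its integral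
    \<open>D * N / R\<close> equals \<open>e * N / (N + 1)\<close>. Using \<open>N + 1\<close> also
    makes \<open>R\<close> positive from \<open>N \<ge> 0\<close> alone.\<close>
  define R where "R = D * (N + 1) / e"
  have R: "R > 0" using N D assms by (simp add: R_def)
  have "(LINT x|lborel. indicator {x. \<bar>x\<bar> > h} x * fejer R x) \<le> (LINT x|lborel. D / R * inverse (1 + x\<^sup>2))"
  proof (rule integral_mono)
    show "integrable lborel (\<lambda>x. indicator {x. \<bar>x\<bar> > h} x * fejer R x)"
      by (rule Bochner_Integration.integrable_bound[OF fejer_integrable[OF R]]) (auto simp: indicator_def)
    show "integrable lborel (\<lambda>x. D / R * inverse (1 + x\<^sup>2))"
      by (intro integrable_mult_right integrable_inverse_one_plus_square)
    fix x :: real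
    show "indicator {x. \<bar>x\<bar> > h} x * fejer R x \<le> D / R * inverse (1 + x\<^sup>2)"
    proof (cases "\<bar>x\<bar> > h")
      case True
      then have x: "h\<^sup>2 \<le> x\<^sup>2" "x\<^sup>2 > 0"
        using assms by (auto intro!: power_mono[of h "\<bar>x\<bar>" 2, simplified])
      have "1 - cos (R * x) \<le> 2" using cos_ge_minus_one[of "R * x"] by linarith
      then have "2 * (1 - cos (R * x)) \<le> 2 * 2" by (intro mult_left_mono) auto
      then have "fejer R x \<le> (2 * 2) / (R * x\<^sup>2)"
        unfolding fejer_def using R x by (intro divide_right_mono) auto
      also have "\<dots> \<le> D / R * inverse (1 + x\<^sup>2)"
      proof -
        define M where "M = 1 + 1 / h\<^sup>2"
        have M: "M > 0" using assms by (simp add: M_def add_pos_nonneg)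
        have "1 + x\<^sup>2 \<le> M * x\<^sup>2"
          using x assms by (simp add: M_def field_simps)
        then have "inverse (M * x\<^sup>2) \<le> inverse (1 + x\<^sup>2)"
          by (intro le_imp_inverse_le) (auto simp: add_pos_nonneg)
        then have "D / R * inverse (M * x\<^sup>2) \<le> D / R * inverse (1 + x\<^sup>2)"
          using D R by (intro mult_left_mono) auto
        moreover have "D / R * inverse (M * x\<^sup>2) = (2 * 2) / (R * x\<^sup>2)"
          using M R x by (simp add: D_def M_def[symmetric] field_simps)
        ultimately show ?thesis by simp
      qed
      finally show ?thesis using True by simp
    qed (use D R in \<open>auto simp: add_nonneg_nonneg\<close>)
  qed
  also have "\<dots> = D / R * N" by (simp add: N_def)
  also have "\<dots> \<le> e"
    using R D N assms by (simp add: R_def field_simps)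
  finally show thesis using R that by blast
qed

section \<open>Wiener's division and transfer of limits to Fejer averages\<close>

lemma has_vector_derivative_inverse:
  fixes f :: "real \<Rightarrow> complex"
  assumes "(f has_vector_derivative f') (at x)" "f x \<noteq> 0"
  shows "((\<lambda>x. inverse (f x)) has_vector_derivative - (f' * (inverse (f x))\<^sup>2)) (at x)"
proof -
  have "((inverse \<circ> f) has_vector_derivative f' * - (inverse (f x) ^ Suc (Suc 0))) (at x)"
    by (rule field_vector_diff_chain_at[OF assms(1) DERIV_inverse[OF assms(2)]])
  then show ?thesis
    by (simp add: o_def numeral_2_eq_2)
qed

text \<open>
  Wiener's division: the quotient of the triangle on \<open>[-R, R]\<close> by the nonvanishing Fourier transform
  of the kernel is continuous and piecewise twice continuously differentiable, hence the Fourier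
  transform of an integrable function, and the kernel divides the Fejer kernel as a convolution.
\<close>

lemma fejer_divisible:
  fixes \<kappa> :: "real \<Rightarrow> real"
  assumes k0: "integrable lborel \<kappa>" and k1: "integrable lborel (\<lambda>w. w * \<kappa> w)"
    and k2: "integrable lborel (\<lambda>w. w\<^sup>2 * \<kappa> w)"
    and nz: "\<And>\<xi>. fourier_int (\<lambda>w. of_real (\<kappa> w)) \<xi> \<noteq> 0" and "R > 0"
  obtains \<eta> :: "real \<Rightarrow> complex" where "integrable lborel \<eta>"
    "\<And>y. y \<noteq> 0 \<Longrightarrow> (LINT z|lborel. \<eta> z * of_real (\<kappa> (y - z))) = of_real (fejer R y)"
proof -
  have [measurable]: "\<kappa> \<in> borel_measurable borel" using k0 by auto
  define ch where "ch = fourier_int (\<lambda>w. of_real (\<kappa> w))"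
  define ch' where "ch' = fourier_int (\<lambda>w. - \<i> * of_real w * of_real (\<kappa> w))"
  define ch'' where "ch'' = fourier_int (\<lambda>w. - \<i> * of_real w * (- \<i> * of_real w * of_real (\<kappa> w)))"
  have i1: "integrable lborel (\<lambda>w. complex_of_real w * of_real (\<kappa> w))"
    using integrable_of_real[OF k1, where 'a = complex] by simp
  then have i1': "integrable lborel (\<lambda>w. - \<i> * of_real w * of_real (\<kappa> w))"
    using integrable_mult_right[of "- \<i>"] by (simp add: mult.assoc)
  have i2: "integrable lborel (\<lambda>w. complex_of_real w * (of_real w * of_real (\<kappa> w)))"
    using integrable_of_real[OF k2, where 'a = complex] by (simp add: power2_eq_square mult.assoc)
  then have i2': "integrable lborel (\<lambda>w. of_real w * (- \<i> * of_real w * of_real (\<kappa> w)))"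
    using integrable_mult_right[of "- \<i>"] by (simp add: mult_ac)
  then have i2'': "integrable lborel (\<lambda>w. - \<i> * of_real w * (- \<i> * of_real w * of_real (\<kappa> w)))"
    using integrable_mult_right[of "- \<i>"] by (simp add: mult.assoc)
  have d1: "(ch has_vector_derivative ch' \<xi>) (at \<xi>)" for \<xi>
    unfolding ch_def ch'_def using k0 i1 by (intro fourier_int_has_vector_derivative) auto
  have d2: "(ch' has_vector_derivative ch'' \<xi>) (at \<xi>)" for \<xi>
    unfolding ch'_def ch''_def using i1' i2' by (intro fourier_int_has_vector_derivative)
  have cont: "continuous_on UNIV ch" "continuous_on UNIV ch'" "continuous_on UNIV ch''"
    unfolding ch_def ch'_def ch''_def
    using k0 i1' i2'' by (auto intro!: continuous_fourier_int)
  have nz': "ch \<xi> \<noteq> 0" for \<xi> using nz by (simp add: ch_def)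
  define g where "g \<xi> = inverse (ch \<xi>)" for \<xi>
  define g' where "g' \<xi> = - (ch' \<xi> * (g \<xi> * g \<xi>))" for \<xi>
  define g'' where "g'' \<xi> = - (ch' \<xi> * (g \<xi> * g' \<xi> + g' \<xi> * g \<xi>) + ch'' \<xi> * (g \<xi> * g \<xi>))" for \<xi>
  have dg: "(g has_vector_derivative g' \<xi>) (at \<xi>)" for \<xi>
    using has_vector_derivative_inverse[OF d1 nz'] by (simp add: g_def[abs_def] g'_def power2_eq_square)
  have dg': "(g' has_vector_derivative g'' \<xi>) (at \<xi>)" for \<xi>
    unfolding g'_def[abs_def] g''_def
    by (intro has_vector_derivative_minus has_vector_derivative_mult d2 dg[unfolded g'_def])
  have cg: "continuous_on UNIV g"
    unfolding g_def[abs_def] using nz' by (intro continuous_intros cont) auto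
  have cg'': "continuous_on UNIV g''"
    unfolding g''_def[abs_def] g'_def[abs_def] by (intro continuous_intros cont cg)
  define \<eta> where "\<eta> = triangle_transform R g"
  have int_\<eta>: "integrable lborel \<eta>"
    unfolding \<eta>_def by (rule integrable_triangle_transform[OF \<open>R > 0\<close> dg dg' cg''])
  define h where "h \<xi> = indicator {-R..R} \<xi> *\<^sub>R (of_real (1 - \<bar>\<xi>\<bar> / R) * g \<xi>)" for \<xi>
  have cg1: "continuous_on A g" for A using cg by (rule continuous_on_subset) auto
  have "set_integrable lborel {-R..R} (\<lambda>\<xi>. of_real (1 - \<bar>\<xi>\<bar> / R) * g \<xi>)"
    using \<open>R > 0\<close> by (intro borel_integrable_atLeastAtMost' continuous_intros cg1) auto
  then have h: "integrable lborel h"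
    unfolding set_integrable_def h_def[abs_def] .
  then have [measurable]: "h \<in> borel_measurable borel" by auto
  have \<eta>_eq: "\<eta> x = (LINT \<xi>|lborel. h \<xi> * cis (\<xi> * x))" for x
    unfolding \<eta>_def triangle_transform_def set_lebesgue_integral_def h_def by simp
  have "(LINT z|lborel. \<eta> z * of_real (\<kappa> (y - z))) = of_real (fejer R y)" if y: "y \<noteq> 0" for y
  proof -
    define F where "F w \<xi> = of_real (\<kappa> w) * (h \<xi> * cis (\<xi> * (y - w)))" for w \<xi>
    have int_F: "integrable (lborel \<Otimes>\<^sub>M lborel) (case_prod F)"
    proof (rule lborel_pair.Fubini_integrable)
      show "case_prod F \<in> borel_measurable (lborel \<Otimes>\<^sub>M lborel)"
        unfolding F_def by measurable
      have "(\<lambda>w. LINT \<xi>|lborel. norm (case_prod F (w, \<xi>))) = (\<lambda>w. \<bar>\<kappa> w\<bar> * (LINT \<xi>|lborel. norm (h \<xi>)))"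
        by (simp add: F_def norm_mult)
      then show "integrable lborel (\<lambda>w. LINT \<xi>|lborel. norm (case_prod F (w, \<xi>)))"
        using k0 by simp
      show "AE w in lborel. integrable lborel (\<lambda>\<xi>. case_prod F (w, \<xi>))"
        unfolding F_def by (auto intro!: AE_I2 integrable_mult_right integrable_mult_cis h)
    qed
    have "(LINT z|lborel. \<eta> z * of_real (\<kappa> (y - z))) = (LINT w|lborel. \<eta> (y - w) * of_real (\<kappa> w))"
      using lborel_integral_real_affine[of "-1" "\<lambda>z. \<eta> z * of_real (\<kappa> (y - z))" y] by simp
    also have "\<dots> = (LINT w|lborel. LINT \<xi>|lborel. F w \<xi>)"
      unfolding \<eta>_eq F_def by (simp add: mult.commute)
    also have "\<dots> = (LINT \<xi>|lborel. LINT w|lborel. F w \<xi>)"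
      by (rule lborel_pair.Fubini_integral[OF int_F, symmetric])
    also have "\<dots> = (LINT \<xi>|lborel. h \<xi> * cis (\<xi> * y) * ch \<xi>)"
    proof (intro Bochner_Integration.integral_cong refl)
      fix \<xi> :: real
      have "F w \<xi> = (h \<xi> * cis (\<xi> * y)) * (of_real (\<kappa> w) * cis (- (\<xi> * w)))" for w
        by (simp add: F_def algebra_simps cis_mult)
      then show "(LINT w|lborel. F w \<xi>) = h \<xi> * cis (\<xi> * y) * ch \<xi>"
        by (simp add: ch_def fourier_int_def)
    qed
    \<comment> \<open>\<open>h\<close> carries the factor \<open>1 / ch\<close>, so multiplying by
      \<open>ch\<close> leaves the bare triangle, whose transform is the Fejer kernel away from
      0.\<close>
    also have "\<dots> = triangle_transform R (\<lambda>_. 1) y"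
      unfolding triangle_transform_def set_lebesgue_integral_def
      by (intro Bochner_Integration.integral_cong) (auto simp: h_def g_def nz' indicator_def)
    finally show "(LINT z|lborel. \<eta> z * of_real (\<kappa> (y - z))) = of_real (fejer R y)"
      using triangle_transform_one[OF \<open>R > 0\<close> y] by simp
  qed
  then show thesis by (intro that[OF int_\<eta>])
qed

text \<open>Associativity: the Fejer average of \<open>q\<close> is the \<eta>-average of the
  convolution \<open>H\<close> of \<open>q\<close> with \<kappa>. Since \<open>H\<close> is bounded
  and convergent and \<eta> is integrable, dominated convergence carries the limit across.
  Boundedness of \<open>q\<close> is what makes Fubini applicable.\<close>

lemma fejer_averages:
  fixes \<kappa> q :: "real \<Rightarrow> real"
  assumes k0: "integrable lborel \<kappa>" and k1: "integrable lborel (\<lambda>w. w * \<kappa> w)"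
    and k2: "integrable lborel (\<lambda>w. w\<^sup>2 * \<kappa> w)"
    and nz: "\<And>\<xi>. fourier_int (\<lambda>w. of_real (\<kappa> w)) \<xi> \<noteq> 0" and "R > 0"
    and q [measurable]: "q \<in> borel_measurable borel" and B: "\<And>u. \<bar>q u\<bar> \<le> B"
    and lim: "((\<lambda>s. LINT w|lborel. \<kappa> w * q (s + w)) \<longlongrightarrow> L * (LINT w|lborel. \<kappa> w)) at_top"
  shows "((\<lambda>s. LINT y|lborel. fejer R y * q (s + y)) \<longlongrightarrow> L * (LINT y|lborel. fejer R y)) at_top"
proof -
  obtain \<eta> :: "real \<Rightarrow> complex" where \<eta>: "integrable lborel \<eta>"
    "\<And>y. y \<noteq> 0 \<Longrightarrow> (LINT z|lborel. \<eta> z * of_real (\<kappa> (y - z))) = of_real (fejer R y)"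
    using fejer_divisible[OF assms(1-5)] by blast
  have [measurable]: "\<kappa> \<in> borel_measurable borel" "\<eta> \<in> borel_measurable borel"
    using k0 \<eta>(1) by auto
  have assoc: "(LINT z|lborel. \<eta> z * of_real (LINT w|lborel. \<kappa> w * p (s + z + w)))
      = of_real (LINT y|lborel. fejer R y * p (s + y))"
    if [measurable]: "p \<in> borel_measurable borel" and pB: "\<And>u. \<bar>p u\<bar> \<le> C" for p C s
  proof -
    have C: "C \<ge> 0" using pB[of 0] by linarith
    define F where "F z y = \<eta> z * of_real (\<kappa> (y - z) * p (s + y))" for z y
    have kt: "integrable lborel (\<lambda>y. \<kappa> (y - z))" for z
      using lborel_integrable_real_affine[OF k0, of 1 "-z"] by simp
    have ki: "integrable lborel (\<lambda>y. \<kappa> (y - z) * p (s + y))" for z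
    proof (rule Bochner_Integration.integrable_bound[OF integrable_mult_left[OF kt[of z], of C]])
      show "AE y in lborel. norm (\<kappa> (y - z) * p (s + y)) \<le> norm (\<kappa> (y - z) * C)"
        using pB C by (intro AE_I2) (simp add: abs_mult mult_left_mono)
    qed measurable
    have nk: "(LINT y|lborel. \<bar>\<kappa> (y - z) * p (s + y)\<bar>) \<le> C * (LINT w|lborel. \<bar>\<kappa> w\<bar>)" for z
    proof -
      have abs_bound: "\<bar>\<kappa> (y - z) * p (s + y)\<bar> \<le> C * \<bar>\<kappa> (y - z)\<bar>" for y
        using mult_right_mono[OF pB[of "s + y"], of "\<bar>\<kappa> (y - z)\<bar>"] by (simp add: abs_mult mult.commute)
      have "(LINT y|lborel. \<bar>\<kappa> (y - z) * p (s + y)\<bar>) \<le> (LINT y|lborel. C * \<bar>\<kappa> (y - z)\<bar>)"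
        using ki[of z] kt[of z] pB
        by (intro integral_mono) (auto simp: abs_mult[symmetric] intro: abs_bound)
      also have "\<dots> = C * (LINT w|lborel. \<bar>\<kappa> w\<bar>)"
        using lborel_integral_real_affine[of 1 "\<lambda>w. \<bar>\<kappa> w\<bar>" "-z"] by simp
      finally show ?thesis .
    qed
    have int_F: "integrable (lborel \<Otimes>\<^sub>M lborel) (case_prod F)"
    proof (rule lborel_pair.Fubini_integrable)
      show "case_prod F \<in> borel_measurable (lborel \<Otimes>\<^sub>M lborel)"
        unfolding F_def by measurable
      have eq: "(LINT y|lborel. norm (case_prod F (z, y))) = norm (\<eta> z) * (LINT y|lborel. \<bar>\<kappa> (y - z) * p (s + y)\<bar>)" for z
        by (simp add: F_def norm_mult abs_mult del: of_real_mult)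
      show "integrable lborel (\<lambda>z. LINT y|lborel. norm (case_prod F (z, y)))"
        unfolding eq
      proof (rule Bochner_Integration.integrable_bound[OF integrable_mult_left[OF integrable_norm[OF \<eta>(1)], of "C * (LINT w|lborel. \<bar>\<kappa> w\<bar>)"]])
        show "AE z in lborel. norm (norm (\<eta> z) * (LINT y|lborel. \<bar>\<kappa> (y - z) * p (s + y)\<bar>))
            \<le> norm (norm (\<eta> z) * (C * (LINT w|lborel. \<bar>\<kappa> w\<bar>)))"
        proof (rule AE_I2)
          fix z
          have "0 \<le> (LINT y|lborel. \<bar>\<kappa> (y - z) * p (s + y)\<bar>)"
            by (intro Bochner_Integration.integral_nonneg) simp
          then show "norm (norm (\<eta> z) * (LINT y|lborel. \<bar>\<kappa> (y - z) * p (s + y)\<bar>))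
            \<le> norm (norm (\<eta> z) * (C * (LINT w|lborel. \<bar>\<kappa> w\<bar>)))"
            using nk[of z] by (simp add: abs_mult[of "norm (\<eta> z)"] mult_left_mono)
        qed
      qed measurable
      show "AE z in lborel. integrable lborel (\<lambda>y. case_prod F (z, y))"
        unfolding F_def using ki by (auto intro!: AE_I2 integrable_mult_right integrable_of_real simp del: of_real_mult)
    qed
    have "(LINT w|lborel. \<kappa> w * p (s + z + w)) = (LINT y|lborel. \<kappa> (y - z) * p (s + y))" for z
      using lborel_integral_real_affine[of 1 "\<lambda>w. \<kappa> w * p (s + z + w)" "-z"] by simp
    then have "(LINT z|lborel. \<eta> z * of_real (LINT w|lborel. \<kappa> w * p (s + z + w)))
        = (LINT z|lborel. LINT y|lborel. F z y)"
      by (simp add: F_def del: of_real_mult)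
    also have "\<dots> = (LINT y|lborel. LINT z|lborel. F z y)"
      by (rule lborel_pair.Fubini_integral[OF int_F, symmetric])
    also have "\<dots> = (LINT y|lborel. of_real (fejer R y * p (s + y)))"
    proof (rule integral_cong_AE)
      show "AE y in lborel. (LINT z|lborel. F z y) = of_real (fejer R y * p (s + y))"
        using AE_lborel_singleton[of 0]
      proof eventually_elim
        case (elim y)
        have "F z y = \<eta> z * of_real (\<kappa> (y - z)) * of_real (p (s + y))" for z
          by (simp add: F_def)
        then show ?case
          using \<eta>(2)[OF elim] by simp
      qed
      show "(\<lambda>y. LINT z|lborel. F z y) \<in> borel_measurable lborel"
        unfolding F_def by measurable
    qed measurable
    also have "\<dots> = of_real (LINT y|lborel. fejer R y * p (s + y))"
      by (rule integral_complex_of_real)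
    finally show ?thesis .
  qed
  define H where "H s = (LINT w|lborel. \<kappa> w * q (s + w))" for s
  have [measurable]: "H \<in> borel_measurable borel"
    unfolding H_def by measurable
  have H_bound: "\<bar>H s\<bar> \<le> B * (LINT w|lborel. \<bar>\<kappa> w\<bar>)" for s
  proof -
    have "\<bar>H s\<bar> \<le> (LINT w|lborel. \<bar>\<kappa> w * q (s + w)\<bar>)"
      unfolding H_def using integral_norm_bound[of lborel "\<lambda>w. \<kappa> w * q (s + w)"] by simp
    also have "\<dots> \<le> (LINT w|lborel. B * \<bar>\<kappa> w\<bar>)"
    proof (rule integral_mono)
      have "B \<ge> 0" using B[of 0] by linarith
      then show "integrable lborel (\<lambda>w. \<bar>\<kappa> w * q (s + w)\<bar>)"
        using B k0 by (intro Bochner_Integration.integrable_bound[OF integrable_mult_left[OF k0, of B]])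
          (auto simp: abs_mult mult_left_mono)
    qed (use B k0 in \<open>auto simp: abs_mult mult.commute[of B] intro!: mult_left_mono\<close>)
    finally show ?thesis by simp
  qed
  have "((\<lambda>s. LINT z|lborel. \<eta> z * of_real (H (s + z))) \<longlongrightarrow> (LINT z|lborel. \<eta> z * of_real (L * (LINT w|lborel. \<kappa> w)))) at_top"
  proof (rule integral_dominated_convergence_at_top[where w = "\<lambda>z. norm (\<eta> z) * (B * (LINT w|lborel. \<bar>\<kappa> w\<bar>))"])
    show "AE z in lborel. ((\<lambda>s. \<eta> z * of_real (H (s + z))) \<longlongrightarrow> \<eta> z * of_real (L * (LINT w|lborel. \<kappa> w))) at_top"
    proof (rule AE_I2)
      fix z :: real
      have "filterlim (\<lambda>s::real. z + s) at_top at_top"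
        by (rule filterlim_tendsto_add_at_top[OF tendsto_const filterlim_ident])
      then have "filterlim (\<lambda>s::real. s + z) at_top at_top" by (simp add: add.commute)
      from filterlim_compose[OF lim this]
      show "((\<lambda>s. \<eta> z * of_real (H (s + z))) \<longlongrightarrow> \<eta> z * of_real (L * (LINT w|lborel. \<kappa> w))) at_top"
        unfolding H_def by (intro tendsto_mult tendsto_of_real tendsto_const)
    qed
    show "\<forall>\<^sub>F s in at_top. AE z in lborel. norm (\<eta> z * of_real (H (s + z))) \<le> norm (\<eta> z) * (B * (LINT w|lborel. \<bar>\<kappa> w\<bar>))"
      using H_bound by (intro always_eventually allI AE_I2) (simp add: norm_mult mult_left_mono)
  qed (use \<eta>(1) in \<open>auto intro: integrable_mult_left integrable_norm\<close>)
  also have "(\<lambda>s. LINT z|lborel. \<eta> z * of_real (H (s + z))) = (\<lambda>s. of_real (LINT y|lborel. fejer R y * q (s + y)))"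
    unfolding H_def using assoc[OF q B] by simp
  \<comment> \<open>The integral of \<eta> is not computed on its own: applying \<open>assoc\<close>
    to the constant function 1 gives the product of the masses of \<eta> and \<kappa> as the mass of
    the Fejer kernel.\<close>
  also have "(LINT z|lborel. \<eta> z * of_real (L * (LINT w|lborel. \<kappa> w))) =
      of_real L * (LINT z|lborel. \<eta> z * of_real (LINT w|lborel. \<kappa> w * (\<lambda>_. 1) (0 + z + w)))"
    by (simp add: mult_ac)
  also have "\<dots> = of_real L * of_real (LINT y|lborel. fejer R y * (\<lambda>_. 1) (0 + y))"
    by (subst assoc[of "\<lambda>_. 1" 1]) auto
  finally have "((\<lambda>s. complex_of_real (LINT y|lborel. fejer R y * q (s + y))) \<longlongrightarrow> of_real (L * (LINT y|lborel. fejer R y))) at_top"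
    by simp
  from tendsto_Re[OF this] show ?thesis by simp
qed

section \<open>Borel versions of Lebesgue measurable functions\<close>

lemma lebesgue_integral_eq_borel:
  fixes f f' :: "real \<Rightarrow> 'a::{banach, second_countable_topology}"
  assumes "f \<in> borel_measurable lebesgue" "f' \<in> borel_measurable borel"
    and "AE x in lebesgue. f x = f' x"
  shows "(LINT x|lebesgue. f x) = (LINT x|lborel. f' x)"
    and "integrable lebesgue f \<longleftrightarrow> integrable lborel f'"
proof -
  have f': "f' \<in> borel_measurable lborel" using assms(2) by simp
  have "(LINT x|lebesgue. f x) = (LINT x|lebesgue. f' x)"
    by (rule integral_cong_AE) (use assms f' in \<open>auto intro: measurable_completion\<close>)
  then show "(LINT x|lebesgue. f x) = (LINT x|lborel. f' x)"
    using integral_completion[OF f'] by simp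
  have "integrable lebesgue f \<longleftrightarrow> integrable lebesgue f'"
    by (rule integrable_cong_AE) (use assms f' in \<open>auto intro: measurable_completion\<close>)
  then show "integrable lebesgue f \<longleftrightarrow> integrable lborel f'"
    using integrable_completion[OF f'] by simp
qed

lemma AE_lebesgue_translate:
  "AE x in lebesgue. P x \<Longrightarrow> AE x in lebesgue. P (t + x :: real)"
  by (rule AE_distrD[OF measurable_lebesgue_translate]) (unfold lebesgue_distr_translate)

text \<open>The Fubini arguments need joint measurability of expressions such as
  \<open>\<kappa> (y - z)\<close>, which Borel functions provide. Replacing both factors by Borel
  functions equal to them almost everywhere preserves the convolution at every \<open>s\<close>,
  because translates of null sets are null.\<close>

lemma lebesgue_convolution_eq_borel:
  fixes k h k' h' :: "real \<Rightarrow> real"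
  assumes k: "k \<in> borel_measurable lebesgue" and h: "h \<in> borel_measurable lebesgue"
    and [measurable]: "k' \<in> borel_measurable borel" "h' \<in> borel_measurable borel"
    and k_eq: "AE x in lebesgue. k x = k' x" and h_eq: "AE x in lebesgue. h x = h' x"
  shows "(LINT w|lebesgue. k w * h (s + w)) = (LINT w|lborel. k' w * h' (s + w))"
proof (rule lebesgue_integral_eq_borel(1))
  show "(\<lambda>w. k w * h (s + w)) \<in> borel_measurable lebesgue"
    by (intro borel_measurable_times k borel_measurable_lebesgue_translate h)
  show "AE w in lebesgue. k w * h (s + w) = k' w * h' (s + w)"
    using k_eq AE_lebesgue_translate[OF h_eq, of s] by eventually_elim simp
qed measurable

lemma lebesgue_measurable_imp_borel_AE:
  fixes f :: "real \<Rightarrow> real"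
  assumes "f \<in> borel_measurable lebesgue"
  obtains f' where "f' \<in> borel_measurable borel" "AE x in lebesgue. f x = f' x"
proof -
  obtain f' where "f' \<in> borel_measurable lborel" "AE x in lborel. f x = f' x"
    using completion_ex_borel_measurable_real[OF assms] by blast
  then show thesis by (intro that[of f'] AE_completion) auto
qed

text \<open>The factors are only Lebesgue measurable, but the convolution of their Borel versions
  agrees with theirs at every point, not merely almost everywhere; hence the result is genuinely
  Borel.\<close>

lemma borel_measurable_lebesgue_convolution:
  fixes k h :: "real \<Rightarrow> real"
  assumes k: "k \<in> borel_measurable lebesgue" and h: "h \<in> borel_measurable lebesgue"
  shows "(\<lambda>s. LINT w|lebesgue. k w * h (s + w)) \<in> borel_measurable borel"
proof -
  obtain k' where k' [measurable]: "k' \<in> borel_measurable borel" "AE x in lebesgue. k x = k' x"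
    using lebesgue_measurable_imp_borel_AE[OF k] .
  obtain h' where h' [measurable]: "h' \<in> borel_measurable borel" "AE x in lebesgue. h x = h' x"
    using lebesgue_measurable_imp_borel_AE[OF h] .
  have "(\<lambda>s. LINT w|lborel. k' w * h' (s + w)) \<in> borel_measurable borel"
    by measurable
  then show ?thesis
    by (simp add: lebesgue_convolution_eq_borel[OF k h k'(1) h'(1) k'(2) h'(2)])
qed

text \<open>
  Wiener's Tauberian theorem for bounded functions, restricted to normalised Fejer kernels; these are
  nonnegative, which is what the monotonicity argument below needs.
\<close>

lemma wiener_approximate_identity:
  fixes \<kappa> :: "real \<Rightarrow> real"
  assumes k0: "integrable lebesgue \<kappa>" and k1: "integrable lebesgue (\<lambda>w. w * \<kappa> w)"
    and k2: "integrable lebesgue (\<lambda>w. w\<^sup>2 * \<kappa> w)"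
    and nz: "\<And>\<xi>. (LINT w|lebesgue. of_real (\<kappa> w) * cis (- (\<xi> * w))) \<noteq> 0"
    and "h > 0" "e > 0"
  obtains k where "\<And>y. k y \<ge> 0" "integrable lebesgue k" "(LINT y|lebesgue. k y) = 1"
    "(LINT y|lebesgue. indicator {y. \<bar>y\<bar> > h} y * k y) \<le> e"
    "\<forall>q B L. q \<in> borel_measurable lebesgue \<longrightarrow> (\<forall>u. \<bar>q u\<bar> \<le> B) \<longrightarrow>
      ((\<lambda>s. LINT w|lebesgue. \<kappa> w * q (s + w)) \<longlongrightarrow> L * (LINT w|lebesgue. \<kappa> w)) at_top \<longrightarrow>
      ((\<lambda>s. LINT y|lebesgue. k y * q (s + y)) \<longlongrightarrow> L) at_top"
proof -
  have \<kappa>: "\<kappa> \<in> borel_measurable lebesgue" using k0 by auto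
  obtain \<kappa>' where \<kappa>' [measurable]: "\<kappa>' \<in> borel_measurable borel" and eq: "AE x in lebesgue. \<kappa> x = \<kappa>' x"
    using lebesgue_measurable_imp_borel_AE[OF \<kappa>] .
  have c: "(LINT w|lebesgue. \<kappa> w) = (LINT w|lborel. \<kappa>' w)"
    by (rule lebesgue_integral_eq_borel(1)[OF \<kappa> \<kappa>' eq])
  have k0': "integrable lborel \<kappa>'"
    using lebesgue_integral_eq_borel(2)[OF \<kappa> \<kappa>' eq] k0 by simp
  have k1': "integrable lborel (\<lambda>w. w * \<kappa>' w)"
    by (subst lebesgue_integral_eq_borel(2)[of "\<lambda>w. w * \<kappa> w", symmetric]) (use k1 eq in auto)
  have k2': "integrable lborel (\<lambda>w. w\<^sup>2 * \<kappa>' w)"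
    by (subst lebesgue_integral_eq_borel(2)[of "\<lambda>w. w\<^sup>2 * \<kappa> w", symmetric]) (use k2 eq in auto)
  have nz': "fourier_int (\<lambda>w. of_real (\<kappa>' w)) \<xi> \<noteq> 0" for \<xi>
  proof -
    have "(LINT w|lebesgue. of_real (\<kappa> w) * cis (- (\<xi> * w))) = (LINT w|lborel. of_real (\<kappa>' w) * cis (- (\<xi> * w)))"
    proof (rule lebesgue_integral_eq_borel(1))
      have "integrable lebesgue (\<lambda>w. of_real (\<kappa> w) * cis (- (\<xi> * w)))"
        by (intro integrable_mult_cis integrable_of_real k0) (auto intro!: measurable_completion)
      then show "(\<lambda>w. of_real (\<kappa> w) * cis (- (\<xi> * w))) \<in> borel_measurable lebesgue" by auto
      show "AE x in lebesgue. of_real (\<kappa> x) * cis (- (\<xi> * x)) = of_real (\<kappa>' x) * cis (- (\<xi> * x))"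
        using eq by eventually_elim simp
    qed measurable
    then show ?thesis using nz[of \<xi>] by (simp add: fourier_int_def)
  qed
  define P where "P = (LINT x|lborel. fejer 1 x)"
  have P: "P > 0" unfolding P_def by (rule fejer_integral_pos)
  obtain R where R: "R > 0" and tail: "(LINT x|lborel. indicator {x. \<bar>x\<bar> > h} x * fejer R x) \<le> e * P"
    using fejer_tail[of h "e * P"] P \<open>h > 0\<close> \<open>e > 0\<close> by auto
  define k where "k y = fejer R y / P" for y
  have k_borel [measurable]: "k \<in> borel_measurable borel" unfolding k_def by measurable
  have k_leb: "k \<in> borel_measurable lebesgue" by (intro measurable_completion) simp
  show thesis
  proof (rule that[of k])
    show "k y \<ge> 0" for y using fejer_nonneg[OF R, of y] P by (simp add: k_def)
    show "integrable lebesgue k"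
      by (subst integrable_completion) (use fejer_integrable[OF R] in \<open>auto simp: k_def[abs_def]\<close>)
    show "(LINT y|lebesgue. k y) = 1"
      by (subst integral_completion) (use P fejer_integral_scale[OF R] in \<open>auto simp: k_def[abs_def] P_def\<close>)
    have "(LINT y|lebesgue. indicator {y. \<bar>y\<bar> > h} y * k y) = (LINT y|lborel. indicator {y. \<bar>y\<bar> > h} y * k y)"
      by (rule integral_completion) measurable
    also have "\<dots> = (LINT y|lborel. indicator {y. \<bar>y\<bar> > h} y * fejer R y) / P"
      unfolding k_def by simp
    also have "\<dots> \<le> e"
      using tail P by (simp add: divide_le_eq)
    finally show "(LINT y|lebesgue. indicator {y. \<bar>y\<bar> > h} y * k y) \<le> e" .
    show "\<forall>q B L. q \<in> borel_measurable lebesgue \<longrightarrow> (\<forall>u. \<bar>q u\<bar> \<le> B) \<longrightarrow>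
      ((\<lambda>s. LINT w|lebesgue. \<kappa> w * q (s + w)) \<longlongrightarrow> L * (LINT w|lebesgue. \<kappa> w)) at_top \<longrightarrow>
      ((\<lambda>s. LINT y|lebesgue. k y * q (s + y)) \<longlongrightarrow> L) at_top"
    proof (intro allI impI)
      fix q B L
      assume q: "q \<in> borel_measurable lebesgue" and B: "\<forall>u. \<bar>q u\<bar> \<le> B"
        and lim: "((\<lambda>s. LINT w|lebesgue. \<kappa> w * q (s + w)) \<longlongrightarrow> L * (LINT w|lebesgue. \<kappa> w)) at_top"
      obtain q0 where q0 [measurable]: "q0 \<in> borel_measurable borel" and q_eq: "AE x in lebesgue. q x = q0 x"
        using lebesgue_measurable_imp_borel_AE[OF q] .
      \<comment> \<open>A Borel version obeys the bound \<open>B\<close> only almost everywhere.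
        Clamping it to [-B, B] makes the bound hold everywhere and changes it on a null set
        only.\<close>
      define q' where "q' u = max (- B) (min B (q0 u))" for u
      have q' [measurable]: "q' \<in> borel_measurable borel" unfolding q'_def by measurable
      have q'_eq: "AE x in lebesgue. q x = q' x"
        using q_eq
      proof eventually_elim
        case (elim x)
        then show ?case using B[rule_format, of x] unfolding q'_def by linarith
      qed
      have "((\<lambda>s. LINT y|lborel. fejer R y * q' (s + y)) \<longlongrightarrow> L * (LINT y|lborel. fejer R y)) at_top"
      proof (rule fejer_averages[OF k0' k1' k2' nz' R q'])
        show "\<bar>q' u\<bar> \<le> B" for u using B[rule_format, of u] unfolding q'_def by linarith
        show "((\<lambda>s. LINT w|lborel. \<kappa>' w * q' (s + w)) \<longlongrightarrow> L * (LINT w|lborel. \<kappa>' w)) at_top"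
          using lim by (simp add: c lebesgue_convolution_eq_borel[OF \<kappa> q \<kappa>' q' eq q'_eq])
      qed
      then have "((\<lambda>s. (LINT y|lborel. fejer R y * q' (s + y)) / P) \<longlongrightarrow> L * (LINT y|lborel. fejer R y) / P) at_top"
        using P by (intro tendsto_divide tendsto_const) auto
      also have "(\<lambda>s. (LINT y|lborel. fejer R y * q' (s + y)) / P) = (\<lambda>s. LINT y|lborel. k y * q' (s + y))"
        by (simp add: k_def)
      also have "L * (LINT y|lborel. fejer R y) / P = L"
        using P fejer_integral_scale[OF R] by (simp add: P_def)
      finally show "((\<lambda>s. LINT y|lebesgue. k y * q (s + y)) \<longlongrightarrow> L) at_top"
        using lebesgue_convolution_eq_borel[OF k_leb q k_borel q' _ q'_eq] by simp
    qed
  qed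
qed

section \<open>Monotone functions\<close>

context exp_kernel
begin

lemma integrable_kernel_weight: "integrable lebesgue (\<lambda>w. \<kappa> w * exp (\<delta> * \<bar>w\<bar>))"
proof (rule integrable_dominated[where C = 1])
  show "(\<lambda>w. \<kappa> w * exp (\<delta> * \<bar>w\<bar>)) \<in> borel_measurable lebesgue"
    by (intro borel_measurable_times kernel_measurable measurable_completion; measurable)
qed (use kernel_nonneg in \<open>auto simp: abs_mult intro!: mult_left_mono\<close>)

lemma integrable_kernel_moment1: "integrable lebesgue (\<lambda>w. w * \<kappa> w)"
proof (rule integrable_dominated[where C = "1 / \<delta>"])
  fix w :: real
  have "\<delta> * \<bar>w\<bar> \<le> exp (\<delta> * \<bar>w\<bar>)"
    using exp_ge_add_one_self[of "\<delta> * \<bar>w\<bar>"] by linarith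
  also have "\<dots> \<le> exp (-\<theta> * w) + exp (\<delta> * \<bar>w\<bar>)" by simp
  finally have "\<bar>w\<bar> \<le> 1 / \<delta> * (exp (-\<theta> * w) + exp (\<delta> * \<bar>w\<bar>))"
    using \<delta>_pos by (simp add: field_simps)
  from mult_left_mono[OF this kernel_nonneg[of w]]
  show "norm (w * \<kappa> w) \<le> \<kappa> w * (1 / \<delta> * (exp (-\<theta> * w) + exp (\<delta> * \<bar>w\<bar>)))"
    using kernel_nonneg[of w] by (simp add: abs_mult mult.commute)
qed (intro borel_measurable_times kernel_measurable measurable_completion; measurable)

lemma integrable_kernel_moment2: "integrable lebesgue (\<lambda>w. w\<^sup>2 * \<kappa> w)"
proof (rule integrable_dominated[where C = "2 / \<delta>\<^sup>2"])
  fix w :: real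
  have "(\<delta> * \<bar>w\<bar>)\<^sup>2 / 2 \<le> exp (\<delta> * \<bar>w\<bar>)"
    using exp_lower_Taylor_quadratic[of "\<delta> * \<bar>w\<bar>"] \<delta>_pos
      mult_nonneg_nonneg[of \<delta> "\<bar>w\<bar>"] by linarith
  also have "\<dots> \<le> exp (-\<theta> * w) + exp (\<delta> * \<bar>w\<bar>)" by simp
  finally have "w\<^sup>2 \<le> 2 / \<delta>\<^sup>2 * (exp (-\<theta> * w) + exp (\<delta> * \<bar>w\<bar>))"
    using \<delta>_pos by (simp add: field_simps power_mult_distrib)
  from mult_left_mono[OF this kernel_nonneg[of w]]
  show "norm (w\<^sup>2 * \<kappa> w) \<le> \<kappa> w * (2 / \<delta>\<^sup>2 * (exp (-\<theta> * w) + exp (\<delta> * \<bar>w\<bar>)))"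
    using kernel_nonneg[of w] by (simp add: abs_mult mult.commute)
qed (intro borel_measurable_times kernel_measurable measurable_completion; measurable)

section \<open>A priori bounds for the increments of a monotone function\<close>

text \<open>Provides a bounded window of positive mass, through which an increment of the
  convolution controls an increment of the function.\<close>

lemma kernel_mass_interval:
  assumes "(LINT w|lebesgue. \<kappa> w) > 0"
  obtains N :: nat where "(LINT w|lebesgue. indicator {- real N..real N} w * \<kappa> w) > 0"
proof -
  have "(\<lambda>n. LINT w|lebesgue. indicator {- real n..real n} w * \<kappa> w) \<longlonglongrightarrow> (LINT w|lebesgue. \<kappa> w)"
  proof (rule integral_dominated_convergence[where w = \<kappa>])
    show "AE w in lebesgue. (\<lambda>n. indicator {- real n..real n} w * \<kappa> w) \<longlonglongrightarrow> \<kappa> w"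
    proof (rule AE_I2)
      fix w
      obtain m :: nat where m: "\<bar>w\<bar> \<le> real m" using real_arch_simple by blast
      have "\<forall>\<^sub>F n in sequentially. \<kappa> w = indicator {- real n..real n} w * \<kappa> w"
        using eventually_ge_at_top[of m]
      proof eventually_elim
        case (elim n)
        then have "\<bar>w\<bar> \<le> real n" using m by linarith
        then have "w \<in> {- real n..real n}" by auto
        then show ?case by simp
      qed
      then show "(\<lambda>n. indicator {- real n..real n} w * \<kappa> w) \<longlonglongrightarrow> \<kappa> w"
        by (rule Lim_transform_eventually[OF tendsto_const])
    qed
    show "(\<lambda>w. indicator {- real n..real n} w * \<kappa> w) \<in> borel_measurable lebesgue" for n
      by (intro borel_measurable_times kernel_measurable borel_measurable_indicator) auto
  qed (use kernel_integrable kernel_nonneg in \<open>auto simp: indicator_def\<close>)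
  then have "\<forall>\<^sub>F n in sequentially. (LINT w|lebesgue. indicator {- real n..real n} w * \<kappa> w) > 0"
    using assms by (rule order_tendstoD(1))
  then show thesis using that by (meson eventually_sequentially order_refl)
qed

text \<open>With \<open>s = t - N\<close> and \<open>v = 2 * N + 1\<close>, every \<open>w\<close>
  in the window [-N, N] satisfies \<open>s + w \<le> t\<close> and
  \<open>t + 1 \<le> s + v + w\<close>. By monotonicity the integrand of
  \<open>G (s + v) - G s\<close> is then at least \<open>\<kappa> w\<close> times the increment over
  [t, t + 1], and outside the window it is nonnegative. Potter's bound moves the normalisation from
  \<open>s\<close> to \<open>t\<close>.\<close>

lemma unit_increment_bound:
  assumes c: "(LINT w|lebesgue. \<kappa> w) > 0"
    and \<phi>: "mono \<phi>" and a: "additively_slow a"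
    and int: "\<forall>s\<ge>S0. integrable lebesgue (\<lambda>w. \<kappa> w * \<phi> (s + w))"
    and lim: "\<And>v. ((\<lambda>s. ((LINT w|lebesgue. \<kappa> w * \<phi> (s + v + w)) - (LINT w|lebesgue. \<kappa> w * \<phi> (s + w))) / a s) \<longlongrightarrow> v) at_top"
  obtains S C where "C \<ge> 0" "\<And>t. t \<ge> S \<Longrightarrow> a t > 0 \<and> \<phi> (t + 1) - \<phi> t \<le> C * a t"
proof -
  define G where "G s = (LINT w|lebesgue. \<kappa> w * \<phi> (s + w))" for s
  have lim': "((\<lambda>s. (G (s + v) - G s) / a s) \<longlongrightarrow> v) at_top" for v
    using lim unfolding G_def .
  obtain N :: nat where N: "(LINT w|lebesgue. indicator {- real N..real N} w * \<kappa> w) > 0"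
    using kernel_mass_interval[OF c] .
  define m where "m = (LINT w|lebesgue. indicator {- real N..real N} w * \<kappa> w)"
  have m: "m > 0" using N by (simp add: m_def)
  \<comment> \<open>A nonintegrable function has integral 0 by convention, so a positive integral
    proves integrability.\<close>
  have int_m: "integrable lebesgue (\<lambda>w. indicator {- real N..real N} w * \<kappa> w)"
    using N not_integrable_integral_eq by fastforce
  define v where "v = 2 * real N + 1"
  have "\<forall>\<^sub>F s in at_top. (G (s + 1) - G s) / a s > 0"
    by (rule order_tendstoD(1)[OF lim'[of 1]]) simp
  then obtain S1 where S1: "\<And>s. s \<ge> S1 \<Longrightarrow> (G (s + 1) - G s) / a s > 0"
    unfolding eventually_at_top_linorder by blast
  have "\<forall>\<^sub>F s in at_top. (G (s + v) - G s) / a s < v + 1"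
    by (rule order_tendstoD(2)[OF lim'[of v]]) simp
  then obtain S2 where S2: "\<And>s. s \<ge> S2 \<Longrightarrow> (G (s + v) - G s) / a s < v + 1"
    unfolding eventually_at_top_linorder by blast
  obtain S3 where "S3 \<ge> 0" and S3: "\<And>s t. s \<ge> S3 \<Longrightarrow> t \<ge> S3 \<Longrightarrow> a s \<noteq> 0 \<and> \<bar>a t\<bar> \<le> exp (\<delta> * (\<bar>t - s\<bar> + 1)) * \<bar>a s\<bar>"
    using potter_bound[OF a \<delta>_pos] by blast
  define S where "S = max (max S0 S1) (max S2 S3) + real N"
  define C where "C = (v + 1) / m * exp (\<delta> * (real N + 1))"
  \<comment> \<open>The sign of \<open>a\<close> is forced: \<open>G\<close> inherits monotonicity,
    and its unit increments divided by \<open>a\<close> tend to 1.\<close>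
  have pos: "a s > 0" if "s \<ge> S0" "s \<ge> S1" for s
  proof -
    have "G s \<le> G (s + 1)"
      unfolding G_def
      by (intro integral_mono int[rule_format] mult_left_mono kernel_nonneg monoD[OF \<phi>]) (use that in auto)
    then show ?thesis using S1[OF that(2)] by (auto simp: zero_less_divide_iff)
  qed
  have "\<phi> (t + 1) - \<phi> t \<le> C * a t" if t: "t \<ge> S" for t
  proof -
    define s where "s = t - real N"
    have s: "s \<ge> S0" "s \<ge> S1" "s \<ge> S2" "s \<ge> S3" "t \<ge> S3" "t \<ge> S0" "t \<ge> S1"
      using t by (auto simp: s_def S_def)
    have "m * (\<phi> (t + 1) - \<phi> t) = (LINT w|lebesgue. indicator {- real N..real N} w * \<kappa> w * (\<phi> (t + 1) - \<phi> t))"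
      by (simp add: m_def)
    also have "\<dots> \<le> (LINT w|lebesgue. \<kappa> w * \<phi> (s + v + w) - \<kappa> w * \<phi> (s + w))"
    proof (rule integral_mono)
      show "integrable lebesgue (\<lambda>w. indicator {- real N..real N} w * \<kappa> w * (\<phi> (t + 1) - \<phi> t))"
        by (intro integrable_mult_left int_m)
      show "integrable lebesgue (\<lambda>w. \<kappa> w * \<phi> (s + v + w) - \<kappa> w * \<phi> (s + w))"
        using s by (intro Bochner_Integration.integrable_diff int[rule_format]) (auto simp: v_def)
      fix w
      have "indicator {- real N..real N} w * (\<phi> (t + 1) - \<phi> t) \<le> \<phi> (s + v + w) - \<phi> (s + w)"
      proof (cases "w \<in> {- real N..real N}")
        case True
        then have "\<phi> (t + 1) \<le> \<phi> (s + v + w)" "\<phi> (s + w) \<le> \<phi> t"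
          by (auto intro!: monoD[OF \<phi>] simp: s_def v_def)
        then show ?thesis using True by simp
      next
        case False
        have "\<phi> (s + w) \<le> \<phi> (s + v + w)" by (auto intro!: monoD[OF \<phi>] simp: v_def)
        then show ?thesis using False by simp
      qed
      from mult_left_mono[OF this kernel_nonneg[of w]]
      show "indicator {- real N..real N} w * \<kappa> w * (\<phi> (t + 1) - \<phi> t) \<le> \<kappa> w * \<phi> (s + v + w) - \<kappa> w * \<phi> (s + w)"
        by (simp add: algebra_simps)
    qed
    also have "\<dots> = G (s + v) - G s"
      unfolding G_def using s by (intro Bochner_Integration.integral_diff int[rule_format]) (auto simp: v_def)
    also have "\<dots> \<le> (v + 1) * a s"
      using S2[OF s(3)] pos[OF s(1,2)] by (simp add: divide_simps split: if_splits)
    also have "\<dots> \<le> (v + 1) * (exp (\<delta> * (real N + 1)) * a t)"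
      using S3[OF s(5) s(4)] pos[OF s(1,2)] pos[OF s(6,7)]
      by (intro mult_left_mono) (auto simp: s_def v_def)
    finally show ?thesis
      using m by (simp add: C_def field_simps)
  qed
  moreover have "a t > 0" if "t \<ge> S" for t
    using that by (intro pos) (auto simp: S_def)
  moreover have "C \<ge> 0" using m by (simp add: C_def v_def)
  ultimately show thesis using that by blast
qed

text \<open>Unit increments are summed along the way. The rate \<delta> is split into two halves
  \<open>e\<close>: one pays for Potter's bound, the other for the number of summands through
  \<open>n \<le> exp (e * n) / e\<close>. To the left of \<open>S\<close> the total drop of \<phi>
  is at most \<open>D\<close>, because \<phi> is constant below \<open>U\<close>, and Potter's bound
  between \<open>S\<close> and \<open>s\<close> inserts the factor \<open>a s\<close>.\<close>

lemma increment_bound: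
  assumes c: "(LINT w|lebesgue. \<kappa> w) > 0"
    and \<phi>: "mono \<phi>" and const: "\<And>u. u \<le> U \<Longrightarrow> \<phi> u = \<phi> U" and a: "additively_slow a"
    and int: "\<forall>s\<ge>S0. integrable lebesgue (\<lambda>w. \<kappa> w * \<phi> (s + w))"
    and lim: "\<And>v. ((\<lambda>s. ((LINT w|lebesgue. \<kappa> w * \<phi> (s + v + w)) - (LINT w|lebesgue. \<kappa> w * \<phi> (s + w))) / a s) \<longlongrightarrow> v) at_top"
  obtains S C where "C \<ge> 0"
    "\<And>s w. s \<ge> S \<Longrightarrow> a s > 0 \<and> \<bar>\<phi> (s + w) - \<phi> s\<bar> \<le> C * exp (\<delta> * \<bar>w\<bar>) * a s"
proof -
  obtain S1 C1 where C1: "C1 \<ge> 0" "\<And>t. t \<ge> S1 \<Longrightarrow> a t > 0 \<and> \<phi> (t + 1) - \<phi> t \<le> C1 * a t"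
    by (rule unit_increment_bound[OF c \<phi> a int lim]) (rule that)
  define e where "e = \<delta> / 2"
  have e: "e > 0" using \<delta>_pos by (simp add: e_def)
  obtain S2 where "S2 \<ge> 0" and S2: "\<And>s t. s \<ge> S2 \<Longrightarrow> t \<ge> S2 \<Longrightarrow> a s \<noteq> 0 \<and> \<bar>a t\<bar> \<le> exp (e * (\<bar>t - s\<bar> + 1)) * \<bar>a s\<bar>"
    using potter_bound[OF a e] by blast
  define S where "S = max U (max S1 S2)"
  have pos: "a s > 0" if "s \<ge> S" for s using C1(2)[of s] that by (auto simp: S_def)
  have potter: "a t \<le> exp (e * (\<bar>t - s\<bar> + 1)) * a s" if "s \<ge> S" "t \<ge> S" for s t
    using S2[of s t] pos[of s] pos[of t] that by (auto simp: S_def)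
  define C2 where "C2 = C1 / e * exp \<delta>"
  have C2: "C2 \<ge> 0" using C1 e by (simp add: C2_def)
  \<comment> \<open>The point \<open>z\<close> is where \<open>a\<close> is evaluated: the left end
    for steps to the right of \<open>s\<close>, the right end for steps to its left.\<close>
  have ends: "\<phi> y - \<phi> x \<le> C2 * exp (\<delta> * (y - x)) * a z"
    if xyz: "S \<le> x" "x \<le> z" "z \<le> y" for x y z
  proof -
    define n where "n = nat \<lceil>y - x\<rceil>"
    have n: "y \<le> x + real n" "real n \<le> y - x + 1"
      using xyz by (auto simp: n_def) linarith+
    have "\<phi> y - \<phi> x \<le> \<phi> (x + real n) - \<phi> (x + real 0)"
      using monoD[OF \<phi> n(1)] by simp
    also have "\<dots> = (\<Sum>j<n. \<phi> (x + real (Suc j)) - \<phi> (x + real j))"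
      by (rule sum_lessThan_telescope[of "\<lambda>j. \<phi> (x + real j)", symmetric])
    also have "\<dots> \<le> (\<Sum>j<n. C1 * (exp (e * (y - x + 1)) * a z))"
    proof (rule sum_mono)
      fix j assume "j \<in> {..<n}"
      then have "real j \<le> y - x" using n(2) by auto
      then have j: "x + real j \<ge> S" "\<bar>x + real j - z\<bar> \<le> y - x" using xyz by auto
      have "\<phi> (x + real (Suc j)) - \<phi> (x + real j) \<le> C1 * a (x + real j)"
        using C1(2)[of "x + real j"] j by (simp add: S_def add.assoc add.commute[of 1])
      also have "\<dots> \<le> C1 * (exp (e * (y - x + 1)) * a z)"
      proof (rule mult_left_mono[OF _ C1(1)])
        have "a (x + real j) \<le> exp (e * (\<bar>x + real j - z\<bar> + 1)) * a z"
          using xyz j by (intro potter) auto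
        also have "\<dots> \<le> exp (e * (y - x + 1)) * a z"
          using j e pos[of z] xyz by (intro mult_right_mono) auto
        finally show "a (x + real j) \<le> exp (e * (y - x + 1)) * a z" .
      qed
      finally show "\<phi> (x + real (Suc j)) - \<phi> (x + real j) \<le> C1 * (exp (e * (y - x + 1)) * a z)" .
    qed
    also have "\<dots> = real n * (C1 * exp (e * (y - x + 1)) * a z)" by simp
    also have "\<dots> \<le> (exp (e * (y - x + 1)) / e) * (C1 * exp (e * (y - x + 1)) * a z)"
    proof (rule mult_right_mono)
      have "e * (y - x + 1) \<le> exp (e * (y - x + 1))"
        using exp_ge_add_one_self[of "e * (y - x + 1)"] by linarith
      then show "real n \<le> exp (e * (y - x + 1)) / e"
        using n(2) mult_left_mono[OF n(2), of e] e by (simp add: field_simps)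
      show "0 \<le> C1 * exp (e * (y - x + 1)) * a z" using C1 pos[of z] xyz by simp
    qed
    also have "\<dots> = C1 / e * (exp (e * (y - x + 1)) * exp (e * (y - x + 1))) * a z"
      by simp
    also have "exp (e * (y - x + 1)) * exp (e * (y - x + 1)) = exp \<delta> * exp (\<delta> * (y - x))"
      by (simp add: e_def exp_add[symmetric] algebra_simps)
    finally show ?thesis by (simp add: C2_def)
  qed
  define D where "D = \<phi> S - \<phi> U"
  have D: "D \<ge> 0" using monoD[OF \<phi>, of U S] by (simp add: D_def S_def)
  have aS: "a S > 0" by (rule pos) simp
  have low: "\<phi> U \<le> \<phi> u" for u
  proof (cases "u \<le> U")
    case True
    then show ?thesis by (simp only: const[OF True])
  next
    case False
    then show ?thesis by (intro monoD[OF \<phi>]) simp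
  qed
  define C where "C = C2 + D * exp \<delta> / a S"
  have C: "C \<ge> C2" using D aS by (simp add: C_def)
  have "\<bar>\<phi> (s + w) - \<phi> s\<bar> \<le> C * exp (\<delta> * \<bar>w\<bar>) * a s" if s: "s \<ge> S" for s w
  proof -
    have *: "C2 * exp (\<delta> * \<bar>w\<bar>) * a s \<le> C * exp (\<delta> * \<bar>w\<bar>) * a s"
      using C pos[OF s] by (intro mult_right_mono) auto
    consider "w \<ge> 0" | "w < 0" "s + w \<ge> S" | "s + w < S" by linarith
    then show ?thesis
    proof cases
      case 1
      then have "\<bar>\<phi> (s + w) - \<phi> s\<bar> \<le> C2 * exp (\<delta> * \<bar>w\<bar>) * a s"
        using ends[of s s "s + w"] s monoD[OF \<phi>, of s "s + w"] by simp
      with * show ?thesis by linarith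
    next
      case 2
      then have "\<bar>\<phi> (s + w) - \<phi> s\<bar> \<le> C2 * exp (\<delta> * \<bar>w\<bar>) * a s"
        using ends[of "s + w" s s] monoD[OF \<phi>, of "s + w" s] by simp
      with * show ?thesis by linarith
    next
      case 3
      have w: "s - S \<le> \<bar>w\<bar>" using 3 by linarith
      have "\<phi> s - \<phi> S \<le> C2 * exp (\<delta> * (s - S)) * a s"
        using ends[of S s s] s by simp
      also have "\<dots> \<le> C2 * exp (\<delta> * \<bar>w\<bar>) * a s"
        using w C2 pos[OF s] \<delta>_pos by (intro mult_right_mono mult_left_mono) auto
      finally have "\<phi> s - \<phi> S \<le> C2 * exp (\<delta> * \<bar>w\<bar>) * a s" .
      moreover have "D \<le> D * exp \<delta> / a S * exp (\<delta> * \<bar>w\<bar>) * a s"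
      proof -
        have "a S \<le> exp (e * (\<bar>S - s\<bar> + 1)) * a s" using potter[OF s, of S] by simp
        also have "\<dots> \<le> exp (\<delta> + \<delta> * \<bar>w\<bar>) * a s"
        proof (rule mult_right_mono)
          have "e * (\<bar>S - s\<bar> + 1) \<le> \<delta> * (\<bar>w\<bar> + 1)"
            using w s e by (intro mult_mono) (auto simp: e_def)
          then show "exp (e * (\<bar>S - s\<bar> + 1)) \<le> exp (\<delta> + \<delta> * \<bar>w\<bar>)" by (simp add: algebra_simps)
        qed (use pos[OF s] in simp)
        finally have "1 \<le> exp (\<delta> + \<delta> * \<bar>w\<bar>) * a s / a S" using aS by (simp add: field_simps)
        from mult_left_mono[OF this D] show ?thesis by (simp add: exp_add mult_ac)
      qed
      moreover have "\<phi> s - \<phi> (s + w) \<le> (\<phi> s - \<phi> S) + D"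
        using low[of "s + w"] by (simp add: D_def)
      moreover have "C * exp (\<delta> * \<bar>w\<bar>) * a s =
          C2 * exp (\<delta> * \<bar>w\<bar>) * a s + D * exp \<delta> / a S * exp (\<delta> * \<bar>w\<bar>) * a s"
        by (simp add: C_def distrib_right)
      ultimately have "\<phi> s - \<phi> (s + w) \<le> C * exp (\<delta> * \<bar>w\<bar>) * a s" by linarith
      moreover have "\<phi> (s + w) \<le> \<phi> s" using 3 s by (intro monoD[OF \<phi>]) simp
      ultimately show ?thesis by simp
    qed
  qed
  moreover have "C \<ge> 0" using C C2 by simp
  ultimately show thesis using pos by (intro that[of C S]) auto
qed

lemma integrable_kernel_increment:
  assumes \<phi>: "mono \<phi>" and "s \<ge> S"
    and incr: "\<forall>s\<ge>S. \<forall>w. a s > 0 \<and> \<bar>\<phi> (s + w) - \<phi> s\<bar> \<le> C * exp (\<delta> * \<bar>w\<bar>) * a s"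
  shows "integrable lebesgue (\<lambda>w. \<kappa> w * (\<phi> (s + w) - \<phi> s))"
proof (rule integrable_dominated[where C = "C * a s"])
  have "\<phi> \<in> borel_measurable lebesgue"
    using borel_measurable_mono[OF \<phi>] by (intro measurable_completion) simp
  then show "(\<lambda>w. \<kappa> w * (\<phi> (s + w) - \<phi> s)) \<in> borel_measurable lebesgue"
    by (intro borel_measurable_times borel_measurable_diff kernel_measurable borel_measurable_const
        borel_measurable_lebesgue_translate)
  fix w
  have i: "a s > 0 \<and> \<bar>\<phi> (s + w) - \<phi> s\<bar> \<le> C * exp (\<delta> * \<bar>w\<bar>) * a s" for w
    using incr \<open>s \<ge> S\<close> by blast
  have "0 \<le> C * exp (\<delta> * \<bar>0\<bar>) * a s" using i[of 0] by simp
  then have "C * a s * exp (\<delta> * \<bar>w\<bar>) \<le> C * a s * (exp (-\<theta> * w) + exp (\<delta> * \<bar>w\<bar>))"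
    by (intro mult_left_mono) auto
  then have "\<bar>\<phi> (s + w) - \<phi> s\<bar> \<le> C * a s * (exp (-\<theta> * w) + exp (\<delta> * \<bar>w\<bar>))"
    using i[of w] by (simp add: mult_ac)
  from mult_left_mono[OF this kernel_nonneg[of w]]
  show "norm (\<kappa> w * (\<phi> (s + w) - \<phi> s)) \<le> \<kappa> w * (C * a s * (exp (-\<theta> * w) + exp (\<delta> * \<bar>w\<bar>)))"
    using kernel_nonneg[of w] by (simp add: abs_mult)
qed

lemma integrable_kernel_shift:
  assumes \<phi>: "mono \<phi>" and "s \<ge> S"
    and incr: "\<forall>s\<ge>S. \<forall>w. a s > 0 \<and> \<bar>\<phi> (s + w) - \<phi> s\<bar> \<le> C * exp (\<delta> * \<bar>w\<bar>) * a s"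
  shows "integrable lebesgue (\<lambda>w. \<kappa> w * \<phi> (s + w))"
proof -
  have "integrable lebesgue (\<lambda>w. \<kappa> w * (\<phi> (s + w) - \<phi> s) + \<kappa> w * \<phi> s)"
    using integrable_kernel_increment[OF assms] kernel_integrable by simp
  then show ?thesis by (simp add: algebra_simps)
qed

text \<open>
  Normalising the increments at \<open>u\<close> by \<open>a u\<close> instead of by a fixed \<open>a s\<close> makes them a bounded
  function on the whole line, so that Wiener's theorem applies; Potter's bound shows that
  this does not change the limit of the convolution.
\<close>

definition normalised_increment :: "(real \<Rightarrow> real) \<Rightarrow> (real \<Rightarrow> real) \<Rightarrow> real \<Rightarrow> real \<Rightarrow> real \<Rightarrow> real" where
  "normalised_increment \<phi> a S v u = (if u \<ge> S then (\<phi> (u + v) - \<phi> u) / a u else 0)"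

lemma normalised_increment_measurable:
  assumes \<phi>: "mono \<phi>" and a: "additively_slow a"
  shows "normalised_increment \<phi> a S v \<in> borel_measurable lebesgue"
proof -
  have [measurable]: "\<phi> \<in> borel_measurable borel" using borel_measurable_mono[OF \<phi>] by simp
  have "(\<lambda>u. indicator {S..} u * (\<phi> (u + v) - \<phi> u)) \<in> borel_measurable lebesgue"
    by (rule measurable_completion) measurable
  then have "(\<lambda>u. indicator {S..} u * (\<phi> (u + v) - \<phi> u) / a u) \<in> borel_measurable lebesgue"
    using a unfolding additively_slow_def by (intro borel_measurable_divide) auto
  also have "(\<lambda>u. indicator {S..} u * (\<phi> (u + v) - \<phi> u) / a u) = normalised_increment \<phi> a S v"
    by (auto simp: normalised_increment_def indicator_def)
  finally show ?thesis .
qed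

lemma normalised_increment_bounded:
  assumes C: "C \<ge> 0" and incr: "\<forall>s\<ge>S. \<forall>w. a s > 0 \<and> \<bar>\<phi> (s + w) - \<phi> s\<bar> \<le> C * exp (\<delta> * \<bar>w\<bar>) * a s"
  shows "\<bar>normalised_increment \<phi> a S v u\<bar> \<le> C * exp (\<delta> * \<bar>v\<bar>)"
proof (cases "u \<ge> S")
  case True
  then have "a u > 0 \<and> \<bar>\<phi> (u + v) - \<phi> u\<bar> \<le> C * exp (\<delta> * \<bar>v\<bar>) * a u"
    using incr by blast
  then show ?thesis using True by (simp add: normalised_increment_def abs_divide divide_simps)
qed (use C in \<open>simp add: normalised_increment_def\<close>)

text \<open>Where \<open>s\<close> and \<open>s + w\<close> are both beyond \<open>S\<close>, the
  two normalisations differ by \<open>q (s + w) * (a (s + w) / a s - 1)\<close>, which tends to 0 as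
  \<open>q\<close> is bounded. For domination, increments anchored at \<open>s\<close> are bounded
  also where \<open>s + w\<close> lies left of \<open>S\<close>; two of them and one value of
  \<open>q\<close> account for the constant 3.\<close>

lemma normalised_increment_convolution:
  assumes \<phi>: "mono \<phi>" and a: "additively_slow a" and C: "C \<ge> 0"
    and incr: "\<forall>s\<ge>S. \<forall>w. a s > 0 \<and> \<bar>\<phi> (s + w) - \<phi> s\<bar> \<le> C * exp (\<delta> * \<bar>w\<bar>) * a s"
    and lim: "((\<lambda>s. ((LINT w|lebesgue. \<kappa> w * \<phi> (s + v + w)) - (LINT w|lebesgue. \<kappa> w * \<phi> (s + w))) / a s) \<longlongrightarrow> v) at_top"
  shows "((\<lambda>s. LINT w|lebesgue. \<kappa> w * normalised_increment \<phi> a S v (s + w)) \<longlongrightarrow> v) at_top"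
proof -
  define q where "q = normalised_increment \<phi> a S v"
  define B where "B = C * exp (\<delta> * \<bar>v\<bar>)"
  have B: "B \<ge> 0" using C by (simp add: B_def)
  have q_bound: "\<bar>q u\<bar> \<le> B" for u
    unfolding q_def B_def by (rule normalised_increment_bounded[OF C incr])
  have q_meas: "q \<in> borel_measurable lebesgue"
    unfolding q_def by (rule normalised_increment_measurable[OF \<phi> a])
  have \<phi>_meas: "\<phi> \<in> borel_measurable lebesgue"
    using borel_measurable_mono[OF \<phi>] by (intro measurable_completion) simp
  define f where "f s w = \<kappa> w * ((\<phi> (s + v + w) - \<phi> (s + w)) / a s - q (s + w))" for s w
  have f_meas: "f s \<in> borel_measurable lebesgue" for s
    unfolding f_def
    by (intro borel_measurable_times borel_measurable_diff borel_measurable_divide kernel_measurable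
        borel_measurable_const borel_measurable_lebesgue_translate \<phi>_meas q_meas)
  have kq_int: "integrable lebesgue (\<lambda>w. \<kappa> w * q (s + w))" for s
  proof (rule Bochner_Integration.integrable_bound[OF integrable_mult_left[OF kernel_integrable, of B]])
    show "(\<lambda>w. \<kappa> w * q (s + w)) \<in> borel_measurable lebesgue"
      by (intro borel_measurable_times kernel_measurable borel_measurable_lebesgue_translate q_meas)
    show "AE w in lebesgue. norm (\<kappa> w * q (s + w)) \<le> norm (\<kappa> w * B)"
      using q_bound B by (intro AE_I2) (simp add: abs_mult mult_left_mono)
  qed
  have "((\<lambda>s. LINT w|lebesgue. f s w) \<longlongrightarrow> (LINT w::real|lebesgue. 0)) at_top"
  proof (rule integral_dominated_convergence_at_top[where w = "\<lambda>w. 3 * B * (\<kappa> w * exp (\<delta> * \<bar>w\<bar>))"])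
    show "integrable lebesgue (\<lambda>w. 3 * B * (\<kappa> w * exp (\<delta> * \<bar>w\<bar>)))"
      by (intro integrable_mult_right integrable_kernel_weight)
    show "\<forall>\<^sub>F s in at_top. AE w in lebesgue. norm (f s w) \<le> 3 * B * (\<kappa> w * exp (\<delta> * \<bar>w\<bar>))"
      using eventually_ge_at_top[of S]
    proof eventually_elim
      case (elim s)
      show ?case
      proof (rule AE_I2)
        fix w :: real
        have i: "a s > 0 \<and> \<bar>\<phi> (s + w) - \<phi> s\<bar> \<le> C * exp (\<delta> * \<bar>w\<bar>) * a s" for w
          using incr elim by blast
        have as: "a s > 0" using i by blast
        have "\<delta> * \<bar>v + w\<bar> \<le> \<delta> * \<bar>v\<bar> + \<delta> * \<bar>w\<bar>"
          using \<delta>_pos abs_triangle_ineq[of v w] by (simp add: distrib_left[symmetric])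
        then have "C * exp (\<delta> * \<bar>v + w\<bar>) * a s \<le> C * exp (\<delta> * \<bar>v\<bar> + \<delta> * \<bar>w\<bar>) * a s"
          using C as by (intro mult_right_mono mult_left_mono) auto
        then have 1: "\<bar>\<phi> (s + v + w) - \<phi> s\<bar> \<le> B * exp (\<delta> * \<bar>w\<bar>) * a s"
          using i[of "v + w"] by (simp add: B_def exp_add add.assoc mult_ac)
        have "C * exp (\<delta> * \<bar>w\<bar>) * a s \<le> B * exp (\<delta> * \<bar>w\<bar>) * a s"
          using C as \<delta>_pos unfolding B_def by (intro mult_right_mono) (auto simp: mult_le_cancel_left1)
        then have 2: "\<bar>\<phi> (s + w) - \<phi> s\<bar> \<le> B * exp (\<delta> * \<bar>w\<bar>) * a s"
          using i[of w] by linarith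
        have "\<bar>\<phi> (s + v + w) - \<phi> (s + w)\<bar> \<le> 2 * (B * exp (\<delta> * \<bar>w\<bar>)) * a s"
          using 1 2 by linarith
        then have 3: "\<bar>(\<phi> (s + v + w) - \<phi> (s + w)) / a s\<bar> \<le> 2 * (B * exp (\<delta> * \<bar>w\<bar>))"
          using as by (simp add: abs_divide divide_simps)
        have "1 \<le> exp (\<delta> * \<bar>w\<bar>)" using \<delta>_pos by simp
        then have "B \<le> B * exp (\<delta> * \<bar>w\<bar>)" using B by (simp add: mult_le_cancel_left1)
        then have "\<bar>(\<phi> (s + v + w) - \<phi> (s + w)) / a s - q (s + w)\<bar> \<le> 3 * (B * exp (\<delta> * \<bar>w\<bar>))"
          using 3 q_bound[of "s + w"] by linarith
        from mult_left_mono[OF this kernel_nonneg[of w]]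
        show "norm (f s w) \<le> 3 * B * (\<kappa> w * exp (\<delta> * \<bar>w\<bar>))"
          unfolding f_def using kernel_nonneg[of w] by (simp add: abs_mult mult_ac)
      qed
    qed
    show "AE w in lebesgue. ((\<lambda>s. f s w) \<longlongrightarrow> 0) at_top"
    proof (rule AE_I2)
      fix w :: real
      have "((\<lambda>s. \<kappa> w * (B * \<bar>a (s + w) / a s - 1\<bar>)) \<longlongrightarrow> \<kappa> w * (B * \<bar>1 - 1\<bar>)) at_top"
        using a unfolding additively_slow_def by (intro tendsto_intros) auto
      then have "((\<lambda>s. \<kappa> w * (B * \<bar>a (s + w) / a s - 1\<bar>)) \<longlongrightarrow> 0) at_top" by simp
      then show "((\<lambda>s. f s w) \<longlongrightarrow> 0) at_top"
      proof (rule Lim_null_comparison[rotated])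
        show "\<forall>\<^sub>F s in at_top. norm (f s w) \<le> \<kappa> w * (B * \<bar>a (s + w) / a s - 1\<bar>)"
          using eventually_ge_at_top[of "max S (S - w)"]
        proof eventually_elim
          case (elim s)
          have pos: "a s > 0" "a (s + w) > 0" using incr elim by auto
          have "q (s + w) = (\<phi> (s + v + w) - \<phi> (s + w)) / a (s + w)"
            using elim by (simp add: q_def normalised_increment_def add_ac)
          then have "(\<phi> (s + v + w) - \<phi> (s + w)) / a s = q (s + w) * (a (s + w) / a s)"
            using pos by simp
          then have "f s w = \<kappa> w * (q (s + w) * (a (s + w) / a s - 1))"
            unfolding f_def by (simp only: right_diff_distrib mult_1_right)
          then have "norm (f s w) = \<kappa> w * (\<bar>q (s + w)\<bar> * \<bar>a (s + w) / a s - 1\<bar>)"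
            using kernel_nonneg[of w] by (simp add: abs_mult)
          also have "\<dots> \<le> \<kappa> w * (B * \<bar>a (s + w) / a s - 1\<bar>)"
            by (intro mult_left_mono mult_right_mono q_bound kernel_nonneg) auto
          finally show ?case .
        qed
      qed
    qed
  qed (use f_meas in auto)
  then have f0: "((\<lambda>s. LINT w|lebesgue. f s w) \<longlongrightarrow> 0) at_top" by simp
  have "\<forall>\<^sub>F s in at_top. ((LINT w|lebesgue. \<kappa> w * \<phi> (s + v + w)) - (LINT w|lebesgue. \<kappa> w * \<phi> (s + w))) / a s
      - (LINT w|lebesgue. f s w) = (LINT w|lebesgue. \<kappa> w * q (s + w))"
    using eventually_ge_at_top[of "max S (S - v)"]
  proof eventually_elim
    case (elim s)
    have i1: "integrable lebesgue (\<lambda>w. \<kappa> w * \<phi> (s + v + w))"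
      using elim by (intro integrable_kernel_shift[OF \<phi> _ incr]) simp
    have i2: "integrable lebesgue (\<lambda>w. \<kappa> w * \<phi> (s + w))"
      using elim by (intro integrable_kernel_shift[OF \<phi> _ incr]) simp
    have "f s = (\<lambda>w. (\<kappa> w * \<phi> (s + v + w) - \<kappa> w * \<phi> (s + w)) / a s - \<kappa> w * q (s + w))"
      by (simp add: f_def fun_eq_iff right_diff_distrib diff_divide_distrib)
    then have "(LINT w|lebesgue. f s w) = (LINT w|lebesgue. (\<kappa> w * \<phi> (s + v + w) - \<kappa> w * \<phi> (s + w)) / a s) - (LINT w|lebesgue. \<kappa> w * q (s + w))"
      using i1 i2 kq_int[of s] by simp
    then show ?case using i1 i2 by simp
  qed
  moreover have "((\<lambda>s. ((LINT w|lebesgue. \<kappa> w * \<phi> (s + v + w)) - (LINT w|lebesgue. \<kappa> w * \<phi> (s + w))) / a s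
      - (LINT w|lebesgue. f s w)) \<longlongrightarrow> v - 0) at_top"
    by (intro tendsto_diff lim f0)
  ultimately have "((\<lambda>s. LINT w|lebesgue. \<kappa> w * q (s + w)) \<longlongrightarrow> v - 0) at_top"
    by (rule Lim_transform_eventually[rotated])
  then show ?thesis by (simp add: q_def)
qed

text \<open>Let \<open>\<bar>y\<bar> \<le> e\<close>. The interval [s, s + v] is contained in the
  one of length \<open>v + 2 * e\<close> starting at \<open>u = s - e + y\<close>, and contains the
  one of length \<open>v - 2 * e\<close> starting at \<open>u = s + e + y\<close>; monotonicity
  compares the increments. Since \<open>\<bar>u - s\<bar> \<le> 2 * e < 2\<close>, Potter's bound
  with rate \<open>e\<close> costs at most \<open>exp (3 * e)\<close>. The mass of \<open>k\<close>
  outside [-e, e] produces the remaining error terms.\<close>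

lemma increment_limit_bounds:
  assumes nz: "\<And>\<xi>. (LINT w|lebesgue. of_real (\<kappa> w) * cis (- (\<xi> * w))) \<noteq> 0"
    and \<phi>: "mono \<phi>" and a: "additively_slow a" and C: "C \<ge> 0"
    and incr: "\<forall>s\<ge>S. \<forall>w. a s > 0 \<and> \<bar>\<phi> (s + w) - \<phi> s\<bar> \<le> C * exp (\<delta> * \<bar>w\<bar>) * a s"
    and lim: "\<And>v. ((\<lambda>s. ((LINT w|lebesgue. \<kappa> w * \<phi> (s + v + w)) - (LINT w|lebesgue. \<kappa> w * \<phi> (s + w))) / a s) \<longlongrightarrow> v) at_top"
    and c: "c = (LINT w|lebesgue. \<kappa> w)" "c > 0" and v: "v > 0" and e: "0 < e" "e < 1" "2 * e \<le> v"
  shows "\<forall>\<^sub>F s in at_top. (\<phi> (s + v) - \<phi> s) / a s * (1 - e) \<le> exp (3 * e) * ((v + 2 * e) / c + e)"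
    and "\<forall>\<^sub>F s in at_top. exp (- (3 * e)) * ((v - 2 * e) / c - e) - C * exp (\<delta> * v) * e \<le> (\<phi> (s + v) - \<phi> s) / a s"
proof -
  obtain k where k_nonneg: "\<And>y. k y \<ge> 0" and k_int: "integrable lebesgue k" and k_one: "(LINT y|lebesgue. k y) = 1"
    and k_tail: "(LINT y|lebesgue. indicator {y. \<bar>y\<bar> > e} y * k y) \<le> e"
    and k_lim: "\<forall>q B L. q \<in> borel_measurable lebesgue \<longrightarrow> (\<forall>u. \<bar>q u\<bar> \<le> B) \<longrightarrow>
      ((\<lambda>s. LINT w|lebesgue. \<kappa> w * q (s + w)) \<longlongrightarrow> L * (LINT w|lebesgue. \<kappa> w)) at_top \<longrightarrow>
      ((\<lambda>s. LINT y|lebesgue. k y * q (s + y)) \<longlongrightarrow> L) at_top"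
    by (rule wiener_approximate_identity[OF kernel_integrable integrable_kernel_moment1
          integrable_kernel_moment2 nz e(1) e(1)]) (rule that)
  define q where "q = normalised_increment \<phi> a S"
  define tail where "tail = (LINT y|lebesgue. indicator {y. \<bar>y\<bar> > e} y * k y)"
  have k_meas: "k \<in> borel_measurable lebesgue" using k_int by auto
  have tail_set: "{y. \<bar>y\<bar> > e} \<in> sets lebesgue" by (intro sets_completionI_sets) auto
  have tail_int: "integrable lebesgue (\<lambda>y. indicator {y. \<bar>y\<bar> > e} y * k y)"
    using integrable_mult_indicator[OF tail_set k_int] by simp
  have q_bound: "\<bar>q u x\<bar> \<le> C * exp (\<delta> * \<bar>u\<bar>)" for u x
    unfolding q_def by (rule normalised_increment_bounded[OF C incr])
  have q_meas: "q u \<in> borel_measurable lebesgue" for u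
    unfolding q_def by (rule normalised_increment_measurable[OF \<phi> a])
  have kq_int: "integrable lebesgue (\<lambda>y. k y * q u (s + y))" for u s
  proof (rule Bochner_Integration.integrable_bound[OF integrable_mult_left[OF k_int, of "C * exp (\<delta> * \<bar>u\<bar>)"]])
    show "(\<lambda>y. k y * q u (s + y)) \<in> borel_measurable lebesgue"
      by (intro borel_measurable_times k_meas borel_measurable_lebesgue_translate q_meas)
    show "AE y in lebesgue. norm (k y * q u (s + y)) \<le> norm (k y * (C * exp (\<delta> * \<bar>u\<bar>)))"
      using q_bound[of u] k_nonneg C by (intro AE_I2) (simp add: abs_mult mult_left_mono)
  qed
  \<comment> \<open>The convolution of \<kappa> with \<open>q u\<close> tends to \<open>u\<close>,
    that is, to \<open>u / c\<close> times the mass of \<kappa>; \<open>k\<close> has mass 1. The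
    free shift \<open>r\<close> allows the sample points to be centred at \<open>s - e\<close> or
    \<open>s + e\<close>.\<close>
  have avg: "((\<lambda>s. LINT y|lebesgue. k y * q u (s + r + y)) \<longlongrightarrow> u / c) at_top" for u r
  proof -
    have "((\<lambda>s. LINT w|lebesgue. \<kappa> w * q u (s + w)) \<longlongrightarrow> u / c * (LINT w|lebesgue. \<kappa> w)) at_top"
      using normalised_increment_convolution[OF \<phi> a C incr lim[of u]] c by (simp add: q_def)
    with q_meas q_bound have "((\<lambda>s. LINT y|lebesgue. k y * q u (s + y)) \<longlongrightarrow> u / c) at_top"
      by (intro k_lim[rule_format])
    from filterlim_compose[OF this filterlim_plus_const_at_top] show ?thesis .
  qed
  obtain S' where "S' \<ge> 0" and S': "\<And>s t. s \<ge> S' \<Longrightarrow> t \<ge> S' \<Longrightarrow> a s \<noteq> 0 \<and> \<bar>a t\<bar> \<le> exp (e * (\<bar>t - s\<bar> + 1)) * \<bar>a s\<bar>"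
    using potter_bound[OF a e(1)] by blast
  have pos: "a s > 0" if "s \<ge> S" for s using incr that by blast
  have near: "a t \<le> exp (3 * e) * a s" if "s \<ge> max S S'" "t \<ge> max S S'" "\<bar>t - s\<bar> \<le> 2 * e" for s t
  proof -
    have "a t \<le> exp (e * (\<bar>t - s\<bar> + 1)) * a s"
      using S'[of s t] pos[of s] pos[of t] that by simp
    also have "e * (\<bar>t - s\<bar> + 1) \<le> e * 3" using e that by (intro mult_left_mono) auto
    then have "exp (e * (\<bar>t - s\<bar> + 1)) * a s \<le> exp (3 * e) * a s"
      using pos[of s] that by (intro mult_right_mono) auto
    finally show ?thesis .
  qed
  define \<psi> where "\<psi> s = (\<phi> (s + v) - \<phi> s) / a s" for s
  have \<psi>_nonneg: "\<psi> s \<ge> 0" if "s \<ge> S" for s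
    using pos[OF that] monoD[OF \<phi>, of s "s + v"] v by (simp add: \<psi>_def)
  have q_eq: "q u x = (\<phi> (x + u) - \<phi> x) / a x" if "x \<ge> S" for u x
    using that by (simp add: q_def normalised_increment_def)
  have q_nonneg: "q u x \<ge> 0" if "u \<ge> 0" for u x
    using pos[of x] monoD[OF \<phi>, of x "x + u"] that
    by (auto simp: q_def normalised_increment_def)
  \<comment> \<open>On the tail of \<open>k\<close> the right-hand side is dropped, as
    \<open>q\<close> is nonnegative for nonnegative increments; the left-hand side keeps the central
    mass, at least \<open>1 - e\<close>. The threshold exceeds \<open>max S S'\<close> by 2 because
    sample points reach \<open>2 * e\<close> to the left of \<open>s\<close>.\<close>
  have upper: "\<psi> s * (1 - e) \<le> exp (3 * e) * (LINT y|lebesgue. k y * q (v + 2 * e) (s + (- e) + y))"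
    if s: "s \<ge> max S S' + 2" for s
  proof -
    have point: "\<psi> s * (k y - indicator {y. \<bar>y\<bar> > e} y * k y) \<le> exp (3 * e) * (k y * q (v + 2 * e) (s + (- e) + y))" for y
    proof (cases "\<bar>y\<bar> > e")
      case True
      then show ?thesis using q_nonneg[of "v + 2 * e"] v e k_nonneg[of y] by simp
    next
      case False
      define u where "u = s + (- e) + y"
      have u: "u \<ge> max S S'" "\<bar>u - s\<bar> \<le> 2 * e" "u \<le> s" "s + v \<le> u + (v + 2 * e)"
        using False s e by (auto simp: u_def)
      have "\<phi> (s + v) - \<phi> s \<le> \<phi> (u + (v + 2 * e)) - \<phi> u"
        using monoD[OF \<phi> u(3)] monoD[OF \<phi> u(4)] by linarith
      also have "\<dots> = q (v + 2 * e) u * a u"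
        using q_eq[of u] pos[of u] u by simp
      also have "\<dots> \<le> q (v + 2 * e) u * (exp (3 * e) * a s)"
        using near[of s u] s u q_nonneg[of "v + 2 * e" u] v e by (intro mult_left_mono) auto
      finally have "\<psi> s \<le> exp (3 * e) * q (v + 2 * e) u"
        using pos[of s] s by (simp add: \<psi>_def divide_simps mult_ac)
      from mult_left_mono[OF this k_nonneg[of y]] show ?thesis
        using False by (simp add: u_def mult_ac)
    qed
    have "\<psi> s * (1 - e) \<le> \<psi> s * (1 - tail)"
      using \<psi>_nonneg[of s] s k_tail by (intro mult_left_mono) (auto simp: tail_def)
    also have "\<dots> = (LINT y|lebesgue. \<psi> s * (k y - indicator {y. \<bar>y\<bar> > e} y * k y))"
      using k_int tail_int k_one by (simp add: tail_def)
    also have "\<dots> \<le> (LINT y|lebesgue. exp (3 * e) * (k y * q (v + 2 * e) (s + (- e) + y)))"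
      by (intro integral_mono integrable_mult_right Bochner_Integration.integrable_diff k_int tail_int kq_int point)
    finally show ?thesis by simp
  qed
  \<comment> \<open>Now \<open>q\<close> is on the smaller side, so its tail has to be bounded
    instead of dropped, by \<open>C * exp (\<delta> * v)\<close> times the tail mass.\<close>
  have lower: "exp (- (3 * e)) * (LINT y|lebesgue. k y * q (v - 2 * e) (s + e + y)) - C * exp (\<delta> * v) * e \<le> \<psi> s"
    if s: "s \<ge> max S S'" for s
  proof -
    have B: "\<bar>q (v - 2 * e) x\<bar> \<le> C * exp (\<delta> * v)" for x
    proof -
      have "C * exp (\<delta> * \<bar>v - 2 * e\<bar>) \<le> C * exp (\<delta> * v)"
        using C \<delta>_pos e by (intro mult_left_mono) auto
      then show ?thesis using q_bound[of "v - 2 * e" x] by linarith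
    qed
    have point: "exp (- (3 * e)) * (k y * q (v - 2 * e) (s + e + y)) \<le> \<psi> s * k y + C * exp (\<delta> * v) * (indicator {y. \<bar>y\<bar> > e} y * k y)" for y
    proof (cases "\<bar>y\<bar> > e")
      case True
      have "exp (- (3 * e)) * q (v - 2 * e) (s + e + y) \<le> 1 * (C * exp (\<delta> * v))"
        using B[of "s + e + y"] q_nonneg[of "v - 2 * e" "s + e + y"] e by (intro mult_mono) auto
      from mult_left_mono[OF this k_nonneg[of y]] show ?thesis
        using True mult_nonneg_nonneg[OF \<psi>_nonneg[of s] k_nonneg[of y]] s by (simp add: mult_ac)
    next
      case False
      define u where "u = s + e + y"
      have u: "u \<ge> max S S'" "\<bar>s - u\<bar> \<le> 2 * e" "s \<le> u" "u + (v - 2 * e) \<le> s + v"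
        using False s e by (auto simp: u_def)
      have "q (v - 2 * e) u * a s \<le> q (v - 2 * e) u * (exp (3 * e) * a u)"
        using near[of u s] s u q_nonneg[of "v - 2 * e" u] e by (intro mult_left_mono) auto
      also have "\<dots> = exp (3 * e) * (\<phi> (u + (v - 2 * e)) - \<phi> u)"
        using q_eq[of u] pos[of u] u by simp
      also have "\<dots> \<le> exp (3 * e) * (\<phi> (s + v) - \<phi> s)"
        using monoD[OF \<phi> u(3)] monoD[OF \<phi> u(4)] by (intro mult_left_mono) auto
      finally have "exp (- (3 * e)) * q (v - 2 * e) u \<le> \<psi> s"
        using pos[of s] s by (simp add: \<psi>_def exp_minus divide_simps mult_ac)
      from mult_left_mono[OF this k_nonneg[of y]] show ?thesis
        using False by (simp add: u_def mult_ac)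
    qed
    have "exp (- (3 * e)) * (LINT y|lebesgue. k y * q (v - 2 * e) (s + e + y))
        = (LINT y|lebesgue. exp (- (3 * e)) * (k y * q (v - 2 * e) (s + e + y)))"
      by simp
    also have "\<dots> \<le> (LINT y|lebesgue. \<psi> s * k y + C * exp (\<delta> * v) * (indicator {y. \<bar>y\<bar> > e} y * k y))"
      by (intro integral_mono integrable_mult_right Bochner_Integration.integrable_add k_int tail_int kq_int point)
    also have "\<dots> = \<psi> s + C * exp (\<delta> * v) * tail"
      using k_int tail_int k_one by (simp add: tail_def)
    also have "\<dots> \<le> \<psi> s + C * exp (\<delta> * v) * e"
      using k_tail C by (intro add_left_mono mult_left_mono) (auto simp: tail_def)
    finally show ?thesis by linarith
  qed
  have "\<forall>\<^sub>F s in at_top. (LINT y|lebesgue. k y * q (v + 2 * e) (s + (- e) + y)) < (v + 2 * e) / c + e"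
    by (rule order_tendstoD(2)[OF avg]) (use e in simp)
  then show "\<forall>\<^sub>F s in at_top. (\<phi> (s + v) - \<phi> s) / a s * (1 - e) \<le> exp (3 * e) * ((v + 2 * e) / c + e)"
    using eventually_ge_at_top[of "max S S' + 2"]
  proof eventually_elim
    case (elim s)
    have "\<psi> s * (1 - e) \<le> exp (3 * e) * (LINT y|lebesgue. k y * q (v + 2 * e) (s + (- e) + y))"
      using elim by (intro upper)
    also have "\<dots> \<le> exp (3 * e) * ((v + 2 * e) / c + e)"
      using elim by (intro mult_left_mono) auto
    finally show ?case by (simp add: \<psi>_def)
  qed
  have "\<forall>\<^sub>F s in at_top. (LINT y|lebesgue. k y * q (v - 2 * e) (s + e + y)) > (v - 2 * e) / c - e"
    by (rule order_tendstoD(1)[OF avg]) (use e in simp)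
  then show "\<forall>\<^sub>F s in at_top. exp (- (3 * e)) * ((v - 2 * e) / c - e) - C * exp (\<delta> * v) * e \<le> (\<phi> (s + v) - \<phi> s) / a s"
    using eventually_ge_at_top[of "max S S'"]
  proof eventually_elim
    case (elim s)
    have "exp (- (3 * e)) * ((v - 2 * e) / c - e) \<le> exp (- (3 * e)) * (LINT y|lebesgue. k y * q (v - 2 * e) (s + e + y))"
      using elim by (intro mult_left_mono) auto
    with lower[OF elim(2)] show ?case unfolding \<psi>_def by linarith
  qed
qed

text \<open>Both bounds converge to \<open>v / c\<close> as \<open>e\<close> tends to 0 from the
  right. A margin on either side of \<open>v / c\<close> fixes \<open>e\<close>, and only then does
  \<open>s\<close> tend to infinity.\<close>

lemma increment_limit_pos:
  assumes nz: "\<And>\<xi>. (LINT w|lebesgue. of_real (\<kappa> w) * cis (- (\<xi> * w))) \<noteq> 0"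
    and \<phi>: "mono \<phi>" and a: "additively_slow a" and C: "C \<ge> 0"
    and incr: "\<forall>s\<ge>S. \<forall>w. a s > 0 \<and> \<bar>\<phi> (s + w) - \<phi> s\<bar> \<le> C * exp (\<delta> * \<bar>w\<bar>) * a s"
    and lim: "\<And>v. ((\<lambda>s. ((LINT w|lebesgue. \<kappa> w * \<phi> (s + v + w)) - (LINT w|lebesgue. \<kappa> w * \<phi> (s + w))) / a s) \<longlongrightarrow> v) at_top"
    and c: "c = (LINT w|lebesgue. \<kappa> w)" "c > 0" and v: "v > 0"
  shows "((\<lambda>s. (\<phi> (s + v) - \<phi> s) / a s) \<longlongrightarrow> v / c) at_top"
proof (rule order_tendstoI)
  have small: "\<forall>\<^sub>F e in at_right 0. 0 < e \<and> e < 1 \<and> 2 * e \<le> v"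
  proof -
    have "\<forall>\<^sub>F e in at_right 0. e \<in> {0<..<min 1 (v / 2)}"
      using v by (intro eventually_at_right_real) auto
    then show ?thesis by eventually_elim auto
  qed
  note bounds = increment_limit_bounds[OF nz \<phi> a C incr lim c v]
  fix x assume x: "v / c < x"
  have "((\<lambda>e. exp (3 * e) * ((v + 2 * e) / c + e) / (1 - e)) \<longlongrightarrow> exp (3 * 0) * ((v + 2 * 0) / c + 0) / (1 - 0)) (at_right 0)"
    using c by (intro tendsto_intros) auto
  then have "\<forall>\<^sub>F e in at_right 0. exp (3 * e) * ((v + 2 * e) / c + e) / (1 - e) < x"
    using x by (intro order_tendstoD(2)) auto
  with small have "\<forall>\<^sub>F e in at_right (0::real). (0 < e \<and> e < 1 \<and> 2 * e \<le> v) \<and> exp (3 * e) * ((v + 2 * e) / c + e) / (1 - e) < x"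
    by (rule eventually_conj)
  then obtain e where e: "0 < e" "e < 1" "2 * e \<le> v" "exp (3 * e) * ((v + 2 * e) / c + e) / (1 - e) < x"
    using eventually_happens by force
  show "\<forall>\<^sub>F s in at_top. (\<phi> (s + v) - \<phi> s) / a s < x"
    using bounds(1)[OF e(1-3)]
  proof eventually_elim
    case (elim s)
    then have "(\<phi> (s + v) - \<phi> s) / a s \<le> exp (3 * e) * ((v + 2 * e) / c + e) / (1 - e)"
      using e by (simp only: pos_le_divide_eq diff_gt_0_iff_gt)
    then show ?case using e(4) by linarith
  qed
next
  have small: "\<forall>\<^sub>F e in at_right 0. 0 < e \<and> e < 1 \<and> 2 * e \<le> v"
  proof -
    have "\<forall>\<^sub>F e in at_right 0. e \<in> {0<..<min 1 (v / 2)}"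
      using v by (intro eventually_at_right_real) auto
    then show ?thesis by eventually_elim auto
  qed
  note bounds = increment_limit_bounds[OF nz \<phi> a C incr lim c v]
  fix x assume x: "x < v / c"
  have "((\<lambda>e. exp (- (3 * e)) * ((v - 2 * e) / c - e) - C * exp (\<delta> * v) * e) \<longlongrightarrow>
      exp (- (3 * 0)) * ((v - 2 * 0) / c - 0) - C * exp (\<delta> * v) * 0) (at_right 0)"
    using c by (intro tendsto_intros) auto
  then have "\<forall>\<^sub>F e in at_right 0. x < exp (- (3 * e)) * ((v - 2 * e) / c - e) - C * exp (\<delta> * v) * e"
    using x by (intro order_tendstoD(1)) auto
  with small have "\<forall>\<^sub>F e in at_right (0::real). (0 < e \<and> e < 1 \<and> 2 * e \<le> v) \<and> x < exp (- (3 * e)) * ((v - 2 * e) / c - e) - C * exp (\<delta> * v) * e"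
    by (rule eventually_conj)
  then obtain e where e: "0 < e" "e < 1" "2 * e \<le> v" "x < exp (- (3 * e)) * ((v - 2 * e) / c - e) - C * exp (\<delta> * v) * e"
    using eventually_happens by force
  show "\<forall>\<^sub>F s in at_top. x < (\<phi> (s + v) - \<phi> s) / a s"
    using bounds(2)[OF e(1-3)] by eventually_elim (use e(4) in linarith)
qed

text \<open>The second conclusion integrates the increment bound against the kernel. It links \<phi>
  to its convolution up to O(a), which is what later converts a normalisation by the convolution
  into one by \<phi>.\<close>

lemma monotone_tauberian:
  assumes nz: "\<And>\<xi>. (LINT w|lebesgue. of_real (\<kappa> w) * cis (- (\<xi> * w))) \<noteq> 0"
    and \<phi>: "mono \<phi>" and const: "\<And>u. u \<le> U \<Longrightarrow> \<phi> u = \<phi> U" and a: "additively_slow a"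
    and int: "\<forall>s\<ge>S0. integrable lebesgue (\<lambda>w. \<kappa> w * \<phi> (s + w))"
    and lim: "\<And>v. ((\<lambda>s. ((LINT w|lebesgue. \<kappa> w * \<phi> (s + v + w)) - (LINT w|lebesgue. \<kappa> w * \<phi> (s + w))) / a s) \<longlongrightarrow> v) at_top"
    and c: "c = (LINT w|lebesgue. \<kappa> w)" "c > 0"
  shows "((\<lambda>s. (\<phi> (s + v) - \<phi> s) / a s) \<longlongrightarrow> v / c) at_top"
    and "\<exists>M. \<forall>\<^sub>F s in at_top. \<bar>(LINT w|lebesgue. \<kappa> w * \<phi> (s + w)) - c * \<phi> s\<bar> \<le> M * \<bar>a s\<bar>"
proof -
  have "\<exists>S C. C \<ge> 0 \<and> (\<forall>s\<ge>S. \<forall>w. a s > 0 \<and> \<bar>\<phi> (s + w) - \<phi> s\<bar> \<le> C * exp (\<delta> * \<bar>w\<bar>) * a s)"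
    by (rule increment_bound[OF c(2)[unfolded c(1)] \<phi> const a int lim]) auto
  then obtain S C where C: "C \<ge> 0"
    and incr: "\<forall>s\<ge>S. \<forall>w. a s > 0 \<and> \<bar>\<phi> (s + w) - \<phi> s\<bar> \<le> C * exp (\<delta> * \<bar>w\<bar>) * a s"
    by blast
  have pos_lim: "((\<lambda>s. (\<phi> (s + v) - \<phi> s) / a s) \<longlongrightarrow> v / c) at_top" if "v > 0" for v
    by (rule increment_limit_pos[OF nz \<phi> a C incr lim c that])
  consider "v > 0" | "v = 0" | "v < 0" by linarith
  then show "((\<lambda>s. (\<phi> (s + v) - \<phi> s) / a s) \<longlongrightarrow> v / c) at_top"
  proof cases
    \<comment> \<open>A negative shift is a positive one read backwards from \<open>s + v\<close>;
      slow variation replaces \<open>a (s + v)\<close> by \<open>a s\<close>.\<close>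
    case 3
    have "((\<lambda>s. (\<phi> (s + v + (- v)) - \<phi> (s + v)) / a (s + v)) \<longlongrightarrow> - v / c) at_top"
      using filterlim_compose[OF pos_lim[of "- v"] filterlim_plus_const_at_top[of v]] 3 by simp
    then have "((\<lambda>s. - ((\<phi> (s + v + (- v)) - \<phi> (s + v)) / a (s + v) * (a (s + v) / a s))) \<longlongrightarrow> - (- v / c * 1)) at_top"
      using a unfolding additively_slow_def by (intro tendsto_minus tendsto_mult) auto
    then have "((\<lambda>s. - ((\<phi> (s + v + (- v)) - \<phi> (s + v)) / a (s + v) * (a (s + v) / a s))) \<longlongrightarrow> v / c) at_top"
      by simp
    moreover have "\<forall>\<^sub>F s in at_top. - ((\<phi> (s + v + (- v)) - \<phi> (s + v)) / a (s + v) * (a (s + v) / a s)) = (\<phi> (s + v) - \<phi> s) / a s"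
      using eventually_ge_at_top[of "S - v"]
    proof eventually_elim
      case (elim s)
      then have "a (s + v) > 0" using incr by simp
      then show ?case by (simp add: minus_divide_left)
    qed
    ultimately show ?thesis by (rule Lim_transform_eventually)
  qed (use pos_lim in auto)
  define M where "M = C * (LINT w|lebesgue. \<kappa> w * exp (\<delta> * \<bar>w\<bar>))"
  have "\<forall>\<^sub>F s in at_top. \<bar>(LINT w|lebesgue. \<kappa> w * \<phi> (s + w)) - c * \<phi> s\<bar> \<le> M * \<bar>a s\<bar>"
    using eventually_ge_at_top[of S]
  proof eventually_elim
    case (elim s)
    have i: "a s > 0 \<and> \<bar>\<phi> (s + w) - \<phi> s\<bar> \<le> C * exp (\<delta> * \<bar>w\<bar>) * a s" for w
      using incr elim by blast
    have i1: "integrable lebesgue (\<lambda>w. \<kappa> w * (\<phi> (s + w) - \<phi> s))"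
      by (rule integrable_kernel_increment[OF \<phi> elim incr])
    have i2: "integrable lebesgue (\<lambda>w. \<kappa> w * \<phi> (s + w))"
      by (rule integrable_kernel_shift[OF \<phi> elim incr])
    have "(LINT w|lebesgue. \<kappa> w * \<phi> (s + w)) - c * \<phi> s = (LINT w|lebesgue. \<kappa> w * \<phi> (s + w) - \<kappa> w * \<phi> s)"
      using i2 kernel_integrable by (simp add: c)
    also have "\<dots> = (LINT w|lebesgue. \<kappa> w * (\<phi> (s + w) - \<phi> s))"
      by (simp add: right_diff_distrib)
    finally have "\<bar>(LINT w|lebesgue. \<kappa> w * \<phi> (s + w)) - c * \<phi> s\<bar> \<le> (LINT w|lebesgue. \<bar>\<kappa> w * (\<phi> (s + w) - \<phi> s)\<bar>)"
      using integral_norm_bound[of lebesgue "\<lambda>w. \<kappa> w * (\<phi> (s + w) - \<phi> s)"] by simp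
    also have "\<dots> \<le> (LINT w|lebesgue. C * a s * (\<kappa> w * exp (\<delta> * \<bar>w\<bar>)))"
    proof (intro integral_mono integrable_mult_right integrable_kernel_weight integrable_abs i1)
      fix w
      show "\<bar>\<kappa> w * (\<phi> (s + w) - \<phi> s)\<bar> \<le> C * a s * (\<kappa> w * exp (\<delta> * \<bar>w\<bar>))"
        using mult_left_mono[OF conjunct2[OF i[of w]] kernel_nonneg[of w]] kernel_nonneg[of w]
        by (simp add: abs_mult mult_ac)
    qed
    also have "\<dots> = C * a s * (LINT w|lebesgue. \<kappa> w * exp (\<delta> * \<bar>w\<bar>))"
      by (rule integral_mult_right_zero)
    also have "\<dots> = M * \<bar>a s\<bar>" using i[of 0] by (simp add: M_def)
    finally show ?case .
  qed
  then show "\<exists>M. \<forall>\<^sub>F s in at_top. \<bar>(LINT w|lebesgue. \<kappa> w * \<phi> (s + w)) - c * \<phi> s\<bar> \<le> M * \<bar>a s\<bar>"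
    by blast
qed

section \<open>The two halves of the theorem in additive coordinates\<close>

text \<open>The convolution limit is applied first to \<phi>, giving \<open>G / \<phi>\<close> the
  limit \<open>c\<close>, and then to the increment of \<phi> normalised by
  \<open>\<phi> * B\<close>. The convolution of that increment is the increment of \<open>G\<close>,
  and dividing by \<open>G / \<phi>\<close> replaces \<phi> by \<open>G\<close> in the
  normalisation.\<close>

lemma abelian_additive:
  assumes c: "c = (LINT w|lebesgue. \<kappa> w)" "c > 0"
    and \<phi>: "additively_slow \<phi>"
    and bound: "\<And>b. \<exists>C. \<forall>u\<le>b. \<bar>\<phi> u\<bar> \<le> C * exp (-\<theta> * u)"
    and B: "additively_slow B"
    and lim: "\<And>v. ((\<lambda>s. (\<phi> (s + v) / \<phi> s - 1) / B s) \<longlongrightarrow> v) at_top"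
  defines "G \<equiv> \<lambda>s. LINT w|lebesgue. \<kappa> w * \<phi> (s + w)"
  shows "integrable lebesgue (\<lambda>w. \<kappa> w * \<phi> (s + w))"
    and "((\<lambda>s. G s / \<phi> s) \<longlongrightarrow> c) at_top"
    and "((\<lambda>s. G (s + v) / G s) \<longlongrightarrow> 1) at_top"
    and "((\<lambda>s. (G (s + v) / G s - 1) / B s) \<longlongrightarrow> v) at_top"
proof -
  have \<phi>_meas: "\<phi> \<in> borel_measurable lebesgue" using \<phi> by (simp add: additively_slow_def)
  have nz: "\<forall>\<^sub>F s in at_top. \<phi> s \<noteq> 0"
    by (rule additively_slow_eventually_nonzero[OF \<phi>])
  have "((\<lambda>s. \<phi> s / \<phi> s) \<longlongrightarrow> 1) at_top"
    by (rule Lim_transform_eventually[OF tendsto_const]) (use nz in eventually_elim, simp)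
  note l = convolution_slow_limit[OF \<phi> \<phi>_meas this bound]
  show int: "integrable lebesgue (\<lambda>w. \<kappa> w * \<phi> (s + w))" for s by (rule l(1))
  show G\<phi>: "((\<lambda>s. G s / \<phi> s) \<longlongrightarrow> c) at_top"
    using l(2) by (simp add: G_def c)
  have G_nz: "\<forall>\<^sub>F s in at_top. G s \<noteq> 0"
  proof -
    have "\<forall>\<^sub>F s in at_top. G s / \<phi> s > 0" by (rule order_tendstoD(1)[OF G\<phi> c(2)])
    then show ?thesis by eventually_elim auto
  qed
  have G\<phi>': "((\<lambda>s. G (s + v) / \<phi> (s + v)) \<longlongrightarrow> c) at_top" for v
    by (rule filterlim_compose[OF G\<phi> filterlim_plus_const_at_top])
  have nz': "\<forall>\<^sub>F s in at_top. \<phi> (s + v) \<noteq> 0" for v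
    by (rule eventually_compose_filterlim[OF nz filterlim_plus_const_at_top])
  have "((\<lambda>s. G (s + v) / \<phi> (s + v) * (\<phi> (s + v) / \<phi> s) / (G s / \<phi> s)) \<longlongrightarrow> c * 1 / c) at_top" for v
    using \<phi> c(2) unfolding additively_slow_def by (intro tendsto_divide tendsto_mult G\<phi> G\<phi>') auto
  moreover have "\<forall>\<^sub>F s in at_top. G (s + v) / \<phi> (s + v) * (\<phi> (s + v) / \<phi> s) / (G s / \<phi> s) = G (s + v) / G s" for v
    using nz nz'[of v] by eventually_elim simp
  ultimately have "((\<lambda>s. G (s + v) / G s) \<longlongrightarrow> c * 1 / c) at_top" for v
    by (rule Lim_transform_eventually)
  then show "((\<lambda>s. G (s + v) / G s) \<longlongrightarrow> 1) at_top"
    using c(2) by simp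
  define h where "h u = \<phi> (v + u) - \<phi> u" for u
  have h_meas: "h \<in> borel_measurable lebesgue"
    unfolding h_def by (intro borel_measurable_diff borel_measurable_lebesgue_translate \<phi>_meas)
  have h_lim: "((\<lambda>s. h s / (\<phi> s * B s)) \<longlongrightarrow> v) at_top"
  proof (rule Lim_transform_eventually[OF lim[of v]])
    show "\<forall>\<^sub>F s in at_top. (\<phi> (s + v) / \<phi> s - 1) / B s = h s / (\<phi> s * B s)"
      using nz by eventually_elim (simp add: h_def add.commute diff_divide_distrib)
  qed
  have h_bound: "\<exists>C. \<forall>u\<le>b. \<bar>h u\<bar> \<le> C * exp (-\<theta> * u)" for b
  proof -
    obtain C1 where C1: "\<forall>u\<le>b + v. \<bar>\<phi> u\<bar> \<le> C1 * exp (-\<theta> * u)" using bound by blast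
    obtain C2 where C2: "\<forall>u\<le>b. \<bar>\<phi> u\<bar> \<le> C2 * exp (-\<theta> * u)" using bound by blast
    have "\<bar>h u\<bar> \<le> (C1 * exp (-\<theta> * v) + C2) * exp (-\<theta> * u)" if "u \<le> b" for u
    proof -
      have "\<bar>\<phi> (v + u)\<bar> \<le> C1 * exp (-\<theta> * (v + u))" "\<bar>\<phi> u\<bar> \<le> C2 * exp (-\<theta> * u)"
        using C1 C2 that by auto
      moreover have "exp (-\<theta> * (v + u)) = exp (-\<theta> * v) * exp (-\<theta> * u)"
        by (simp add: exp_add[symmetric] algebra_simps)
      ultimately show ?thesis unfolding h_def by (simp add: distrib_right)
    qed
    then show ?thesis by blast
  qed
  have h_conv: "((\<lambda>s. (LINT w|lebesgue. \<kappa> w * h (s + w)) / (\<phi> s * B s)) \<longlongrightarrow> v * c) at_top"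
    using convolution_slow_limit(2)[OF additively_slow_mult[OF \<phi> B] h_meas h_lim h_bound] by (simp add: c)
  have "(LINT w|lebesgue. \<kappa> w * h (s + w)) = G (s + v) - G s" for s
  proof -
    have "\<kappa> w * h (s + w) = \<kappa> w * \<phi> (s + v + w) - \<kappa> w * \<phi> (s + w)" for w
      by (simp add: h_def right_diff_distrib add_ac)
    then show ?thesis using int[of s] int[of "s + v"] by (simp add: G_def)
  qed
  with h_conv have "((\<lambda>s. (G (s + v) - G s) / (\<phi> s * B s) / (G s / \<phi> s)) \<longlongrightarrow> v * c / c) at_top"
    using c(2) by (intro tendsto_divide G\<phi>) simp_all
  moreover have "\<forall>\<^sub>F s in at_top. (G (s + v) - G s) / (\<phi> s * B s) / (G s / \<phi> s) = (G (s + v) / G s - 1) / B s"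
    using nz G_nz additively_slow_eventually_nonzero[OF B] by eventually_elim (simp add: field_simps)
  ultimately have "((\<lambda>s. (G (s + v) / G s - 1) / B s) \<longlongrightarrow> v * c / c) at_top"
    by (rule Lim_transform_eventually)
  then show "((\<lambda>s. (G (s + v) / G s - 1) / B s) \<longlongrightarrow> v) at_top"
    using c(2) by simp
qed

text \<open>\<open>p\<close> freezes \<phi> to the left of \<open>U\<close>, which makes it monotone
  on the whole line and constant near minus infinity. The remainder \<open>h\<close> vanishes beyond
  \<open>U\<close>, so its convolution \<open>D\<close> is o(a) and the hypothesis on
  \<open>G\<close> passes to the convolution \<open>Q\<close> of \<open>p\<close>.\<close>

lemma tauberian_additive:
  fixes \<phi> :: "real \<Rightarrow> real"
  defines "G \<equiv> \<lambda>s. LINT w|lebesgue. \<kappa> w * \<phi> (s + w)"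
  assumes nz: "\<And>\<xi>. (LINT w|lebesgue. of_real (\<kappa> w) * cis (- (\<xi> * w))) \<noteq> 0"
    and c: "c = (LINT w|lebesgue. \<kappa> w)" "c > 0"
    and \<phi>_meas: "\<phi> \<in> borel_measurable lebesgue"
    and bound: "\<And>b. \<exists>C. \<forall>u\<le>b. \<bar>\<phi> u\<bar> \<le> C * exp (-\<theta> * u)"
    and monotone: "mono_on {U..} \<phi> \<or> antimono_on {U..} \<phi>"
    and G: "additively_slow G" and B: "additively_slow B" and B0: "(B \<longlongrightarrow> 0) at_top"
    and lim: "\<And>v. ((\<lambda>s. (G (s + v) / G s - 1) / B s) \<longlongrightarrow> v) at_top"
  shows "((\<lambda>s. \<phi> (s + v) / \<phi> s) \<longlongrightarrow> 1) at_top"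
    and "((\<lambda>s. (\<phi> (s + v) / \<phi> s - 1) / B s) \<longlongrightarrow> v) at_top"
proof -
  define a where "a s = G s * B s" for s
  have a: "additively_slow a"
    unfolding a_def by (rule additively_slow_mult[OF G B])
  obtain S1 where S1: "\<forall>s\<ge>S1. G s \<noteq> 0"
    using additively_slow_eventually_nonzero[OF G] unfolding eventually_at_top_linorder by blast
  have a_nz: "\<forall>\<^sub>F s in at_top. a s \<noteq> 0" by (rule additively_slow_eventually_nonzero[OF a])
  have G_lim: "((\<lambda>s. (G (s + v) - G s) / a s) \<longlongrightarrow> v) at_top" for v
  proof (rule Lim_transform_eventually[OF lim[of v]])
    show "\<forall>\<^sub>F s in at_top. (G (s + v) / G s - 1) / B s = (G (s + v) - G s) / a s"
      using eventually_ge_at_top[of S1]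
      by eventually_elim (use S1 in \<open>simp add: a_def diff_divide_distrib\<close>)
  qed
  \<comment> \<open>Integrability is deduced, not assumed: a nonintegrable integrand would give
    \<open>G s\<close> the default value 0, while slow variation keeps \<open>G\<close> away from 0
    eventually.\<close>
  have G_int: "integrable lebesgue (\<lambda>w. \<kappa> w * \<phi> (s + w))" if "s \<ge> S1" for s
    using S1 that not_integrable_integral_eq unfolding G_def by blast
  define p where "p u = \<phi> (max u U)" for u
  define h where "h u = \<phi> u - p u" for u
  have p_cases: "mono p \<or> antimono p"
    using monotone unfolding monotone_on_def monotone_def p_def by auto
  have p_meas: "p \<in> borel_measurable lebesgue"
  proof -
    have "mono p \<or> mono (\<lambda>u. - p u)"
      using p_cases by (auto simp: mono_def antimono_def)
    then have "p \<in> borel_measurable borel"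
      using borel_measurable_mono[of p] borel_measurable_mono[of "\<lambda>u. - p u"] by auto
    then show ?thesis by (intro measurable_completion) simp
  qed
  have h_meas: "h \<in> borel_measurable lebesgue"
    unfolding h_def by (intro borel_measurable_diff \<phi>_meas p_meas)
  have h0: "h u = 0" if "u \<ge> U" for u using that by (simp add: h_def p_def)
  have h_bound: "\<exists>C. \<forall>u\<le>b. \<bar>h u\<bar> \<le> C * exp (-\<theta> * u)" for b
  proof -
    obtain C where C: "\<forall>u\<le>max b U. \<bar>\<phi> u\<bar> \<le> C * exp (-\<theta> * u)" using bound by blast
    have "\<bar>h u\<bar> \<le> (2 * \<bar>C\<bar>) * exp (-\<theta> * u)" for u
    proof (cases "u \<ge> U")
      case False
      have "\<theta> > 0" using \<delta>_pos \<delta>_le_\<theta> by simp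
      then have "C * exp (-\<theta> * U) \<le> \<bar>C\<bar> * exp (-\<theta> * u)"
        using False by (intro mult_mono) auto
      moreover have "C * exp (-\<theta> * u) \<le> \<bar>C\<bar> * exp (-\<theta> * u)" by (intro mult_right_mono) auto
      moreover have "\<bar>\<phi> u\<bar> \<le> C * exp (-\<theta> * u)" "\<bar>\<phi> U\<bar> \<le> C * exp (-\<theta> * U)"
        using C False by auto
      ultimately show ?thesis using False by (simp add: h_def p_def)
    qed (simp add: h0)
    then show ?thesis by blast
  qed
  have h_lim: "((\<lambda>s. h s / a s) \<longlongrightarrow> 0) at_top"
    by (rule Lim_transform_eventually[OF tendsto_const])
      (use eventually_ge_at_top[of U] in eventually_elim, simp add: h0)
  note conv_h = convolution_slow_limit[OF a h_meas h_lim h_bound]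
  define D where "D s = (LINT w|lebesgue. \<kappa> w * h (s + w))" for s
  define Q where "Q s = (LINT w|lebesgue. \<kappa> w * p (s + w))" for s
  have Da: "((\<lambda>s. D s / a s) \<longlongrightarrow> 0) at_top" using conv_h(2) by (simp add: D_def)
  have p_eq: "\<kappa> w * p (s + w) = \<kappa> w * \<phi> (s + w) - \<kappa> w * h (s + w)" for s w
    by (simp add: h_def algebra_simps)
  have p_int: "integrable lebesgue (\<lambda>w. \<kappa> w * p (s + w))" if "s \<ge> S1" for s
    unfolding p_eq by (intro Bochner_Integration.integrable_diff G_int conv_h(1) that)
  have Q: "Q s = G s - D s" if "s \<ge> S1" for s
    unfolding Q_def p_eq G_def D_def
    by (intro Bochner_Integration.integral_diff G_int conv_h(1) that)
  have Q_lim: "((\<lambda>s. (Q (s + v) - Q s) / a s) \<longlongrightarrow> v) at_top" for v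
  proof -
    have "((\<lambda>s. D (s + v) / a (s + v)) \<longlongrightarrow> 0) at_top"
      by (rule filterlim_compose[OF Da filterlim_plus_const_at_top])
    then have "((\<lambda>s. (G (s + v) - G s) / a s - D (s + v) / a (s + v) * (a (s + v) / a s) + D s / a s) \<longlongrightarrow> v - 0 * 1 + 0) at_top"
      using a unfolding additively_slow_def by (intro tendsto_intros G_lim Da) auto
    moreover have "\<forall>\<^sub>F s in at_top. (G (s + v) - G s) / a s - D (s + v) / a (s + v) * (a (s + v) / a s) + D s / a s = (Q (s + v) - Q s) / a s"
      using eventually_ge_at_top[of "max S1 (S1 - v)"]
        eventually_compose_filterlim[OF a_nz filterlim_plus_const_at_top[of v]]
      by eventually_elim (simp add: Q diff_divide_distrib)
    ultimately show ?thesis by (auto elim: Lim_transform_eventually)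
  qed
  have main: "((\<lambda>s. (p (s + v) - p s) / a s) \<longlongrightarrow> v / c) at_top \<and>
      (\<exists>M. \<forall>\<^sub>F s in at_top. \<bar>Q s - c * p s\<bar> \<le> M * \<bar>a s\<bar>)" for v
    using p_cases
  proof
    assume mono: "mono p"
    have const: "p u = p U" if "u \<le> U" for u using that by (simp add: p_def)
    show ?thesis
      unfolding Q_def
      using monotone_tauberian[OF nz mono const a _ Q_lim[unfolded Q_def] c] p_int by blast
  next
    assume "antimono p"
    \<comment> \<open>Changing the signs of \<open>p\<close> and \<open>a\<close> together leaves
      all quotients of increments by \<open>a\<close> unchanged.\<close>
    then have mono: "mono (\<lambda>u. - p u)" by (auto simp: mono_def antimono_def)
    have const: "- p u = - p U" if "u \<le> U" for u using that by (simp add: p_def)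
    have int: "\<forall>s\<ge>S1. integrable lebesgue (\<lambda>w. \<kappa> w * - p (s + w))"
      using p_int by simp
    have lim': "((\<lambda>s. ((LINT w|lebesgue. \<kappa> w * - p (s + v + w)) - (LINT w|lebesgue. \<kappa> w * - p (s + w))) / - a s) \<longlongrightarrow> v) at_top" for v
    proof -
      have "((LINT w|lebesgue. \<kappa> w * - p (s + v + w)) - (LINT w|lebesgue. \<kappa> w * - p (s + w))) / - a s = (Q (s + v) - Q s) / a s" for s
        by (simp add: Q_def minus_divide_left minus_divide_right[symmetric])
      then show ?thesis using Q_lim by simp
    qed
    note m = monotone_tauberian[OF nz mono const additively_slow_uminus[OF a] int lim' c]
    have eq1: "(- p (s + v) - - p s) / - a s = (p (s + v) - p s) / a s" for s
      using minus_divide_divide[of "p (s + v) - p s" "a s"] by simp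
    have eq2: "\<bar>(LINT w|lebesgue. \<kappa> w * - p (s + w)) - c * - p s\<bar> = \<bar>Q s - c * p s\<bar>" for s
      by (simp add: Q_def)
    show ?thesis
      using m(1)[of v] m(2) unfolding eq1 eq2 abs_minus_cancel by blast
  qed
  obtain M where M: "\<forall>\<^sub>F s in at_top. \<bar>Q s - c * p s\<bar> \<le> M * \<bar>a s\<bar>" using main by blast
  have "((\<lambda>s. (Q s - c * p s) / G s) \<longlongrightarrow> 0) at_top"
  proof (rule Lim_null_comparison)
    show "\<forall>\<^sub>F s in at_top. norm ((Q s - c * p s) / G s) \<le> M * \<bar>B s\<bar>"
      using M eventually_ge_at_top[of S1]
    proof eventually_elim
      case (elim s)
      then have "\<bar>G s\<bar> > 0" using S1 by simp
      then show ?case using elim by (simp add: a_def abs_mult divide_simps mult_ac)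
    qed
    show "((\<lambda>s. M * \<bar>B s\<bar>) \<longlongrightarrow> 0) at_top"
      using tendsto_mult[OF tendsto_const tendsto_rabs[OF B0]] by simp
  qed
  \<comment> \<open>With \<open>Q = G - D\<close> and \<open>p = \<phi>\<close> eventually,
    \<open>c * \<phi> / G = 1 - D / G - (Q - c * p) / G\<close>. Writing \<open>D / G\<close> as
    \<open>D / a * B\<close> shows that both corrections vanish in the limit.\<close>
  then have "((\<lambda>s. (1 - D s / a s * B s - (Q s - c * p s) / G s) / c) \<longlongrightarrow> (1 - 0 * 0 - 0) / c) at_top"
    using c(2) by (intro tendsto_intros Da B0) auto
  moreover have "\<forall>\<^sub>F s in at_top. (1 - D s / a s * B s - (Q s - c * p s) / G s) / c = \<phi> s / G s"
    using eventually_ge_at_top[of "max S1 U"] a_nz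
  proof eventually_elim
    case (elim s)
    then have *: "G s \<noteq> 0" "B s \<noteq> 0" "p s = \<phi> s" using S1 by (auto simp: a_def p_def)
    have "D s / a s * B s = D s / G s" using * by (simp add: a_def)
    moreover have "(Q s - c * p s) / G s = 1 - D s / G s - c * (\<phi> s / G s)"
      using * Q[of s] elim by (simp add: diff_divide_distrib)
    ultimately show ?case using c(2) by simp
  qed
  ultimately have "((\<lambda>s. \<phi> s / G s) \<longlongrightarrow> (1 - 0 * 0 - 0) / c) at_top"
    by (rule Lim_transform_eventually)
  then have \<phi>G: "((\<lambda>s. \<phi> s / G s) \<longlongrightarrow> 1 / c) at_top" by simp
  have "\<forall>\<^sub>F s in at_top. \<phi> s / G s > 0" by (rule order_tendstoD(1)[OF \<phi>G]) (use c in simp)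
  then have \<phi>_nz: "\<forall>\<^sub>F s in at_top. \<phi> s \<noteq> 0" by eventually_elim auto
  have "((\<lambda>s. (p (s + v) - p s) / a s / (\<phi> s / G s)) \<longlongrightarrow> v / c / (1 / c)) at_top"
    using c(2) by (intro tendsto_divide \<phi>G conjunct1[OF main]) simp
  moreover have "\<forall>\<^sub>F s in at_top. (p (s + v) - p s) / a s / (\<phi> s / G s) = (\<phi> (s + v) / \<phi> s - 1) / B s"
    using eventually_ge_at_top[of "max S1 (max U (U - v))"] \<phi>_nz additively_slow_eventually_nonzero[OF B]
  proof eventually_elim
    case (elim s)
    then have "G s \<noteq> 0" "p s = \<phi> s" "p (s + v) = \<phi> (s + v)" using S1 by (auto simp: p_def)
    then show ?case using elim by (simp add: a_def field_simps)
  qed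
  ultimately have "((\<lambda>s. (\<phi> (s + v) / \<phi> s - 1) / B s) \<longlongrightarrow> v / c / (1 / c)) at_top"
    by (rule Lim_transform_eventually)
  then show second: "((\<lambda>s. (\<phi> (s + v) / \<phi> s - 1) / B s) \<longlongrightarrow> v) at_top"
    using c(2) by simp
  \<comment> \<open>The first-order limit is recovered from the second-order one: multiplying the
    latter by \<open>B\<close>, which tends to 0, gives
    \<open>\<phi> (s + v) / \<phi> s - 1\<close>.\<close>
  have "((\<lambda>s. 1 + (\<phi> (s + v) / \<phi> s - 1) / B s * B s) \<longlongrightarrow> 1 + v * 0) at_top"
    by (intro tendsto_intros second B0)
  moreover have "\<forall>\<^sub>F s in at_top. 1 + (\<phi> (s + v) / \<phi> s - 1) / B s * B s = \<phi> (s + v) / \<phi> s"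
    using additively_slow_eventually_nonzero[OF B] by eventually_elim simp
  ultimately have "((\<lambda>s. \<phi> (s + v) / \<phi> s) \<longlongrightarrow> 1 + v * 0) at_top"
    by (rule Lim_transform_eventually)
  then show "((\<lambda>s. \<phi> (s + v) / \<phi> s) \<longlongrightarrow> 1) at_top" by simp
qed

end

section \<open>Passage to additive coordinates\<close>

text \<open>Continuity would only give Borel preimages of Borel sets. A preimage under
  \<open>exp\<close> is an image under \<open>ln\<close>, and a differentiable map sends Lebesgue
  measurable sets to Lebesgue measurable sets.\<close>

lemma measurable_exp_lebesgue: "(exp :: real \<Rightarrow> real) \<in> lebesgue \<rightarrow>\<^sub>M lebesgue"
proof (rule measurableI)
  fix S :: "real set" assume S: "S \<in> sets lebesgue"
  have "ln ` (S \<inter> {0<..}) \<in> sets lebesgue"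
  proof (rule differentiable_image_in_sets_lebesgue)
    show "S \<inter> {0<..} \<in> sets lebesgue" using S by auto
    show "(ln :: real \<Rightarrow> real) differentiable_on S \<inter> {0<..}"
      unfolding differentiable_on_def
    proof
      fix x :: real assume "x \<in> S \<inter> {0<..}"
      then have "ln differentiable (at x)"
        using differentiableI[OF has_field_derivative_imp_has_derivative[OF DERIV_ln_divide[of x]]] by simp
      then show "ln differentiable (at x within S \<inter> {0<..})"
        by (rule differentiable_at_withinI)
    qed
  qed simp
  also have "ln ` (S \<inter> {0<..}) = exp -` S \<inter> space lebesgue"
  proof (intro equalityI subsetI)
    fix u assume "u \<in> exp -` S \<inter> space lebesgue"
    then show "u \<in> ln ` (S \<inter> {0<..})" by (intro image_eqI[of u ln "exp u"]) auto
  qed auto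
  finally show "exp -` S \<inter> space lebesgue \<in> sets lebesgue" .
qed simp

lemma measurable_comp_exp:
  fixes f :: "real \<Rightarrow> real"
  assumes "f \<in> borel_measurable (lebesgue_on {0<..})"
  shows "(\<lambda>u. f (exp u)) \<in> borel_measurable lebesgue"
proof -
  have "(\<lambda>x. if x \<in> {0<..} then f x else 0) \<in> borel_measurable lebesgue"
    by (rule borel_measurable_if_I[OF assms]) auto
  from measurable_compose[OF measurable_exp_lebesgue this] show ?thesis by simp
qed

lemma exp_change_of_variables:
  fixes f :: "real \<Rightarrow> 'a::euclidean_space"
  shows "set_integrable lebesgue {0<..} f \<longleftrightarrow> integrable lebesgue (\<lambda>w. exp w *\<^sub>R f (exp w))"
    and "(LINT x:{0<..}|lebesgue. f x) = (LINT w|lebesgue. exp w *\<^sub>R f (exp w))"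
proof -
  have range: "range (exp :: real \<Rightarrow> real) = {0<..}"
  proof (intro equalityI subsetI)
    fix x :: real assume "x \<in> {0<..}"
    then show "x \<in> range exp" by (intro image_eqI[of x exp "ln x"]) auto
  qed auto
  have cov: "(\<lambda>w. \<bar>exp w\<bar> *\<^sub>R f (exp w)) absolutely_integrable_on UNIV \<and> integral UNIV (\<lambda>w. \<bar>exp w\<bar> *\<^sub>R f (exp w)) = b
      \<longleftrightarrow> f absolutely_integrable_on range exp \<and> integral (range exp) f = b" for b
    by (rule has_absolute_integral_change_of_variables_real) (auto simp: inj_on_def)
  have "f absolutely_integrable_on range exp \<longleftrightarrow> (\<lambda>w. \<bar>exp w\<bar> *\<^sub>R f (exp w)) absolutely_integrable_on UNIV"
    by (rule absolutely_integrable_change_of_variables_real) (auto simp: inj_on_def)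
  then show iff: "set_integrable lebesgue {0<..} f \<longleftrightarrow> integrable lebesgue (\<lambda>w. exp w *\<^sub>R f (exp w))"
    unfolding range by (simp add: set_integrable_def)
  show "(LINT x:{0<..}|lebesgue. f x) = (LINT w|lebesgue. exp w *\<^sub>R f (exp w))"
  proof (cases "set_integrable lebesgue {0<..} f")
    case True
    then have 1: "(LINT x:{0<..}|lebesgue. f x) = integral {0<..} f"
      by (rule set_lebesgue_integral_eq_integral(2))
    have "set_integrable lebesgue UNIV (\<lambda>w. exp w *\<^sub>R f (exp w))"
      using True iff by (simp add: set_integrable_def)
    from set_lebesgue_integral_eq_integral(2)[OF this]
    have 2: "(LINT w|lebesgue. exp w *\<^sub>R f (exp w)) = integral UNIV (\<lambda>w. exp w *\<^sub>R f (exp w))"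
      by (simp add: set_lebesgue_integral_def)
    show ?thesis unfolding 1 2 using cov[of "integral {0<..} f"] True unfolding range by simp
  next
    \<comment> \<open>Both integrals take the default value 0, so the formula holds unconditionally
      and the Mellin convolution can be rewritten before its convergence is known.\<close>
    case False
    then show ?thesis
      using iff by (simp add: set_lebesgue_integral_def set_integrable_def not_integrable_integral_eq)
  qed
qed

definition additive_form :: "real \<Rightarrow> (real \<Rightarrow> real) \<Rightarrow> real \<Rightarrow> real" where
  "additive_form \<alpha> H s = exp (- \<alpha> * s) * H (exp s)"

lemma tendsto_exp_substitution:
  fixes P :: "real \<Rightarrow> real \<Rightarrow> real"
  shows "(\<forall>x>0. ((\<lambda>t. P t x) \<longlongrightarrow> l x) at_top) \<longleftrightarrow> (\<forall>v. ((\<lambda>s. P (exp s) (exp v)) \<longlongrightarrow> l (exp v)) at_top)"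
proof
  assume *: "\<forall>x>0. ((\<lambda>t. P t x) \<longlongrightarrow> l x) at_top"
  show "\<forall>v. ((\<lambda>s. P (exp s) (exp v)) \<longlongrightarrow> l (exp v)) at_top"
  proof
    fix v
    have "((\<lambda>t. P t (exp v)) \<longlongrightarrow> l (exp v)) at_top" using * by simp
    from filterlim_compose[OF this exp_at_top]
    show "((\<lambda>s. P (exp s) (exp v)) \<longlongrightarrow> l (exp v)) at_top" .
  qed
next
  assume *: "\<forall>v. ((\<lambda>s. P (exp s) (exp v)) \<longlongrightarrow> l (exp v)) at_top"
  show "\<forall>x>0. ((\<lambda>t. P t x) \<longlongrightarrow> l x) at_top"
  proof (intro allI impI)
    fix x :: real assume x: "x > 0"
    have "((\<lambda>s. P (exp s) (exp (ln x))) \<longlongrightarrow> l (exp (ln x))) at_top" using * by blast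
    from filterlim_compose[OF this ln_at_top]
    have "((\<lambda>t. P (exp (ln t)) x) \<longlongrightarrow> l x) at_top" using x by simp
    then show "((\<lambda>t. P t x) \<longlongrightarrow> l x) at_top"
      by (rule Lim_transform_eventually) (use eventually_gt_at_top[of 0] in eventually_elim, simp)
  qed
qed

text \<open>True also where \<open>H (exp s) = 0\<close>: both sides are then 0 by the convention
  for division.\<close>

lemma additive_form_ratio:
  "H (exp s * exp v) / H (exp s) = exp (\<alpha> * v) * (additive_form \<alpha> H (s + v) / additive_form \<alpha> H s)"
proof -
  have "exp (- \<alpha> * s) = exp (\<alpha> * v) * exp (- \<alpha> * (s + v))"
    by (simp add: exp_add[symmetric] algebra_simps)
  then show ?thesis
    unfolding additive_form_def by (simp add: exp_add)
qed

lemma RV_iff_additive: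
  "H \<in> RV \<alpha> \<longleftrightarrow> H \<in> borel_measurable (lebesgue_on {0<..}) \<and> const_sign_at_top H \<and>
     (\<forall>v. ((\<lambda>s. additive_form \<alpha> H (s + v) / additive_form \<alpha> H s) \<longlongrightarrow> 1) at_top)"
proof -
  have "((\<lambda>s. H (exp s * exp v) / H (exp s)) \<longlongrightarrow> exp v powr \<alpha>) at_top \<longleftrightarrow>
      ((\<lambda>s. additive_form \<alpha> H (s + v) / additive_form \<alpha> H s) \<longlongrightarrow> 1) at_top" for v
    using tendsto_mult_left_iff[of "exp (\<alpha> * v)" "\<lambda>s. additive_form \<alpha> H (s + v) / additive_form \<alpha> H s" 1 at_top]
    unfolding additive_form_ratio[of H _ _ \<alpha>] by (simp add: powr_def)
  then show ?thesis
    unfolding RV_def using tendsto_exp_substitution[of "\<lambda>t x. H (t * x) / H t" "\<lambda>x. x powr \<alpha>"] by simp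
qed

lemma RV2_0_iff_additive:
  "H \<in> RV2_0 \<alpha> A \<longleftrightarrow> H \<in> RV \<alpha> \<and> const_sign_at_top A \<and>
     (\<forall>v. ((\<lambda>s. (additive_form \<alpha> H (s + v) / additive_form \<alpha> H s - 1) / A (exp s)) \<longlongrightarrow> v) at_top)"
proof -
  have "((\<lambda>s. (H (exp s * exp v) / H (exp s) - exp v powr \<alpha>) / A (exp s)) \<longlongrightarrow> exp v powr \<alpha> * ln (exp v)) at_top \<longleftrightarrow>
      ((\<lambda>s. (additive_form \<alpha> H (s + v) / additive_form \<alpha> H s - 1) / A (exp s)) \<longlongrightarrow> v) at_top" for v
  proof -
    have eq: "(H (exp s * exp v) / H (exp s) - exp v powr \<alpha>) / A (exp s) =
        exp (\<alpha> * v) * ((additive_form \<alpha> H (s + v) / additive_form \<alpha> H s - 1) / A (exp s))" for s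
      unfolding additive_form_ratio[of H _ _ \<alpha>] by (simp add: powr_def right_diff_distrib)
    have eq': "exp v powr \<alpha> * ln (exp v) = exp (\<alpha> * v) * v" by (simp add: powr_def)
    show ?thesis unfolding eq eq' by (rule tendsto_mult_left_iff) simp
  qed
  then show ?thesis
    unfolding RV2_0_def
    using tendsto_exp_substitution[of "\<lambda>t x. (H (t * x) / H t - x powr \<alpha>) / A t" "\<lambda>x. x powr \<alpha> * ln x"] by simp
qed

lemma measurable_additive_form:
  assumes "H \<in> borel_measurable (lebesgue_on {0<..})"
  shows "additive_form \<alpha> H \<in> borel_measurable lebesgue"
  unfolding additive_form_def[abs_def]
  by (rule borel_measurable_times[OF _ measurable_comp_exp[OF assms]])
    (intro measurable_completion; measurable)

lemma measurable_of_additive_form: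
  assumes [measurable]: "additive_form \<alpha> H \<in> borel_measurable borel"
  shows "H \<in> borel_measurable (lebesgue_on {0<..})"
proof -
  have "(\<lambda>l. exp (\<alpha> * ln l) * additive_form \<alpha> H (ln l)) \<in> borel_measurable borel"
    by measurable
  then have "(\<lambda>l. exp (\<alpha> * ln l) * additive_form \<alpha> H (ln l)) \<in> borel_measurable (lebesgue_on {0<..})"
    by (intro measurable_restrict_space1 measurable_completion) simp
  then show ?thesis
    by (rule measurable_cong[THEN iffD1, rotated])
      (auto simp: additive_form_def exp_minus)
qed

lemma additively_slow_additive_form:
  assumes "H \<in> RV \<alpha>"
  shows "additively_slow (additive_form \<alpha> H)"
proof -
  have "additive_form \<alpha> H \<in> borel_measurable lebesgue"
    using assms by (intro measurable_additive_form) (simp add: RV_def)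
  then show ?thesis
    using assms unfolding additively_slow_def RV_iff_additive by blast
qed

text \<open>Boundedness of \<open>F\<close> up to 0 gives order \<open>exp (-\<alpha> * u)\<close>.
  For \<open>u \<le> b\<close> the rate may be raised from \<alpha> to \<theta> at the price of the
  factor \<open>exp ((\<theta> - \<alpha>) * b)\<close>.\<close>

lemma additive_form_bound:
  assumes F: "locally_bounded F" and \<theta>: "\<alpha> \<le> \<theta>"
  shows "\<exists>C. \<forall>u\<le>b. \<bar>additive_form \<alpha> F u\<bar> \<le> C * exp (-\<theta> * u)"
proof -
  have "bounded (F ` {0..exp b})" using F by (simp add: locally_bounded_def)
  then obtain M where M: "\<forall>x\<in>{0..exp b}. \<bar>F x\<bar> \<le> M" by (auto simp: bounded_iff)
  have "\<bar>additive_form \<alpha> F u\<bar> \<le> M * exp ((\<theta> - \<alpha>) * b) * exp (-\<theta> * u)" if "u \<le> b" for u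
  proof -
    have M': "\<bar>F (exp u)\<bar> \<le> M" using M that by simp
    have "(\<theta> - \<alpha>) * u \<le> (\<theta> - \<alpha>) * b" using \<theta> that by (intro mult_left_mono) auto
    then have "- \<alpha> * u \<le> (\<theta> - \<alpha>) * b + - \<theta> * u" by (simp add: algebra_simps)
    then have e: "exp (- \<alpha> * u) \<le> exp ((\<theta> - \<alpha>) * b) * exp (- \<theta> * u)"
      by (simp add: exp_add[symmetric])
    have "\<bar>additive_form \<alpha> F u\<bar> = exp (- \<alpha> * u) * \<bar>F (exp u)\<bar>"
      by (simp add: additive_form_def abs_mult)
    also have "\<dots> \<le> (exp ((\<theta> - \<alpha>) * b) * exp (- \<theta> * u)) * M"
      using e M' by (intro mult_mono) auto
    finally show ?thesis by (simp add: mult_ac)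
  qed
  then show ?thesis by blast
qed

section \<open>The Mellin convolution and its kernel in additive coordinates\<close>

text \<open>In the exponent, \<alpha> compensates the factor in \<open>additive_form\<close>, and 1
  is the Jacobian of \<open>exp\<close>.\<close>

definition additive_kernel :: "real \<Rightarrow> (real \<Rightarrow> real) \<Rightarrow> real \<Rightarrow> real" where
  "additive_kernel \<alpha> K w = exp ((\<alpha> + 1) * w) * K (exp w)"

lemma additive_convolution_integrand:
  "additive_kernel \<alpha> K w * additive_form \<alpha> F (s + w) = exp (- \<alpha> * s) * (exp w *\<^sub>R (K (exp w) * F (exp s * exp w)))"
proof -
  have "exp ((\<alpha> + 1) * w) * exp (- \<alpha> * (s + w)) = exp (- \<alpha> * s) * exp w"
    by (simp add: exp_add[symmetric] algebra_simps)
  then show ?thesis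
    unfolding additive_kernel_def additive_form_def by (simp add: exp_add mult_ac)
qed

lemma additive_form_mellin_conv:
  "additive_form \<alpha> (mellin_conv K F) s = (LINT w|lebesgue. additive_kernel \<alpha> K w * additive_form \<alpha> F (s + w))"
  unfolding additive_convolution_integrand additive_form_def[of _ "mellin_conv K F"] mellin_conv_def
  by (subst exp_change_of_variables(2)) simp

lemma integrable_additive_convolution:
  "integrable lebesgue (\<lambda>w. additive_kernel \<alpha> K w * additive_form \<alpha> F (s + w)) \<longleftrightarrow>
    set_integrable lebesgue {0<..} (\<lambda>x. K x * F (exp s * x))"
  unfolding additive_convolution_integrand by (subst exp_change_of_variables(1)) simp

text \<open>\<open>\<theta> = max \<alpha> \<delta>\<close> is at least \<alpha>, as the bound on
  \<phi> requires, and at least \<delta>, as the locale requires. The weight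
  \<open>exp (-\<theta> * w)\<close> exceeds \<open>exp (\<delta> * \<bar>w\<bar>)\<close> only if
  \<open>w < 0\<close> and \<open>\<theta> = \<alpha>\<close>; there its product with the kernel is
  \<open>exp w * K (exp w)\<close>, whose integral is that of \<open>K\<close> over part of (0,
  1].\<close>

lemma exp_kernel_additive_kernel:
  assumes K: "K \<in> wiener_kernels \<alpha>"
  obtains \<theta> \<delta> where "exp_kernel (additive_kernel \<alpha> K) \<theta> \<delta>" "\<alpha> \<le> \<theta>"
proof -
  obtain \<delta> where \<delta>: "\<delta> > 0"
    and int: "set_integrable lebesgue {0<..} (\<lambda>t. max (t powr (\<alpha> + \<delta>)) (t powr (\<alpha> - \<delta>)) * K t)"
    using K unfolding wiener_kernels_def by blast
  have Kpos: "K t \<ge> 0" if "t \<ge> 0" for t using K that by (simp add: wiener_kernels_def)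
  define \<kappa> where "\<kappa> = additive_kernel \<alpha> K"
  define \<theta> where "\<theta> = max \<alpha> \<delta>"
  have "exp w *\<^sub>R (max (exp w powr (\<alpha> + \<delta>)) (exp w powr (\<alpha> - \<delta>)) * K (exp w)) = \<kappa> w * exp (\<delta> * \<bar>w\<bar>)" for w
  proof -
    have "exp w powr (\<alpha> + \<delta>) = exp (\<alpha> * w) * exp (\<delta> * w)" "exp w powr (\<alpha> - \<delta>) = exp (\<alpha> * w) * exp (- (\<delta> * w))"
      by (simp_all add: powr_def exp_add[symmetric] algebra_simps)
    moreover have "max (exp (\<delta> * w)) (exp (- (\<delta> * w))) = exp (\<delta> * \<bar>w\<bar>)"
      using \<delta> by (cases "w \<ge> 0") (auto simp: max_def mult_le_0_iff zero_le_mult_iff)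
    ultimately have "max (exp w powr (\<alpha> + \<delta>)) (exp w powr (\<alpha> - \<delta>)) = exp (\<alpha> * w) * exp (\<delta> * \<bar>w\<bar>)"
      using max_mult_distrib_left[of "exp (\<alpha> * w)" "exp (\<delta> * w)" "exp (- (\<delta> * w))"] by simp
    moreover have "exp ((\<alpha> + 1) * w) = exp w * exp (\<alpha> * w)"
      by (simp add: exp_add[symmetric] algebra_simps)
    ultimately show ?thesis
      by (simp add: \<kappa>_def additive_kernel_def)
  qed
  then have int_\<delta>: "integrable lebesgue (\<lambda>w. \<kappa> w * exp (\<delta> * \<bar>w\<bar>))"
    using int unfolding exp_change_of_variables(1) by simp
  \<comment> \<open>Measurability of the kernel is recovered from that of the weighted kernel by
    dividing out the weight.\<close>
  have "(\<lambda>w. (\<kappa> w * exp (\<delta> * \<bar>w\<bar>)) * exp (- (\<delta> * \<bar>w\<bar>))) \<in> borel_measurable lebesgue"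
    by (rule borel_measurable_times[OF borel_measurable_integrable[OF int_\<delta>]])
      (intro measurable_completion; measurable)
  then have meas: "\<kappa> \<in> borel_measurable lebesgue"
    by (simp add: mult.assoc exp_add[symmetric])
  have \<kappa>_nonneg: "\<kappa> w \<ge> 0" for w using Kpos[of "exp w"] by (simp add: \<kappa>_def additive_kernel_def)
  have "set_integrable lebesgue {0..1} K" using K by (simp add: wiener_kernels_def)
  then have "set_integrable lebesgue {0<..1} K"
    by (rule set_integrable_subset) auto
  then have "set_integrable lebesgue {0<..} (\<lambda>x. indicator {..1} x * K x)"
    unfolding set_integrable_def
    by (rule back_subst[of "integrable lebesgue"]) (auto simp: indicator_def)
  then have int_near0: "integrable lebesgue (\<lambda>w. exp w * (indicator {..1} (exp w) * K (exp w)))"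
    unfolding exp_change_of_variables(1) by simp
  have "integrable lebesgue (\<lambda>w. \<kappa> w * (exp (-\<theta> * w) + exp (\<delta> * \<bar>w\<bar>)))"
  proof (rule Bochner_Integration.integrable_bound)
    show "integrable lebesgue (\<lambda>w. 2 * (\<kappa> w * exp (\<delta> * \<bar>w\<bar>)) + exp w * (indicator {..1} (exp w) * K (exp w)))"
      by (intro Bochner_Integration.integrable_add integrable_mult_right int_\<delta> int_near0)
    show "(\<lambda>w. \<kappa> w * (exp (-\<theta> * w) + exp (\<delta> * \<bar>w\<bar>))) \<in> borel_measurable lebesgue"
      by (rule borel_measurable_times[OF meas]) (intro measurable_completion; measurable)
    show "AE w in lebesgue. norm (\<kappa> w * (exp (-\<theta> * w) + exp (\<delta> * \<bar>w\<bar>))) \<le>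
        norm (2 * (\<kappa> w * exp (\<delta> * \<bar>w\<bar>)) + exp w * (indicator {..1} (exp w) * K (exp w)))"
    proof (rule AE_I2)
      fix w :: real
      have near0: "exp w * (indicator {..1} (exp w) * K (exp w)) \<ge> 0"
        using Kpos[of "exp w"] by simp
      have "\<kappa> w * exp (-\<theta> * w) \<le> \<kappa> w * exp (\<delta> * \<bar>w\<bar>) + exp w * (indicator {..1} (exp w) * K (exp w))"
      proof (cases "- \<theta> * w \<le> \<delta> * \<bar>w\<bar>")
        case True
        then have "\<kappa> w * exp (-\<theta> * w) \<le> \<kappa> w * exp (\<delta> * \<bar>w\<bar>)"
          by (intro mult_left_mono \<kappa>_nonneg) simp
        with near0 show ?thesis by linarith
      next
        case False
        have "w < 0"
        proof (rule ccontr)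
          assume "\<not> w < 0"
          then have "0 \<le> \<theta> * w" "0 \<le> \<delta> * \<bar>w\<bar>" using \<delta> by (auto simp: \<theta>_def)
          then show False using False by simp
        qed
        moreover have "\<theta> = \<alpha>" using False \<open>w < 0\<close> by (auto simp: \<theta>_def max_def split: if_splits)
        moreover have "exp ((\<alpha> + 1) * w) * exp (- \<alpha> * w) = exp w"
          by (simp add: exp_add[symmetric] algebra_simps)
        ultimately have "\<kappa> w * exp (-\<theta> * w) = exp w * (indicator {..1} (exp w) * K (exp w))"
          by (simp add: \<kappa>_def additive_kernel_def mult_ac)
        moreover have "0 \<le> \<kappa> w * exp (\<delta> * \<bar>w\<bar>)" using \<kappa>_nonneg[of w] by simp
        ultimately show ?thesis by linarith
      qed
      then have "\<kappa> w * (exp (-\<theta> * w) + exp (\<delta> * \<bar>w\<bar>)) \<le> 2 * (\<kappa> w * exp (\<delta> * \<bar>w\<bar>)) + exp w * (indicator {..1} (exp w) * K (exp w))"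
        by (simp add: distrib_left)
      moreover have "0 \<le> \<kappa> w * (exp (-\<theta> * w) + exp (\<delta> * \<bar>w\<bar>))"
        using \<kappa>_nonneg[of w] by (simp add: add_nonneg_nonneg)
      ultimately show "norm (\<kappa> w * (exp (-\<theta> * w) + exp (\<delta> * \<bar>w\<bar>))) \<le>
        norm (2 * (\<kappa> w * exp (\<delta> * \<bar>w\<bar>)) + exp w * (indicator {..1} (exp w) * K (exp w)))"
        unfolding real_norm_def by linarith
    qed
  qed
  then have "exp_kernel \<kappa> \<theta> \<delta>"
    using meas \<kappa>_nonneg \<delta> by (simp add: exp_kernel_def \<theta>_def)
  then show thesis using that[of \<theta> \<delta>] by (simp add: \<kappa>_def \<theta>_def)
qed

lemma additive_kernel_fourier_nonzero:
  assumes K: "K \<in> wiener_kernels \<alpha>"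
  shows "(LINT w|lebesgue. of_real (additive_kernel \<alpha> K w) * cis (- (z * w))) \<noteq> 0"
proof -
  have nonzero: "(LINT t:{0<..}|lebesgue. complex_of_real t powr (complex_of_real \<alpha> - \<i> * complex_of_real z) * complex_of_real (K t)) \<noteq> 0"
    using K unfolding wiener_kernels_def by blast
  have eq: "exp w *\<^sub>R (complex_of_real (exp w) powr (complex_of_real \<alpha> - \<i> * complex_of_real z) * complex_of_real (K (exp w)))
      = of_real (additive_kernel \<alpha> K w) * cis (- (z * w))" for w
  proof -
    have "complex_of_real (exp w) powr (complex_of_real \<alpha> - \<i> * complex_of_real z)
        = exp ((complex_of_real \<alpha> - \<i> * complex_of_real z) * of_real w)"
      by (simp add: powr_def Ln_of_real del: of_real_exp)
    also have "\<dots> = exp (of_real (\<alpha> * w) + \<i> * of_real (- (z * w)))"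
      by (simp add: algebra_simps)
    also have "\<dots> = of_real (exp (\<alpha> * w)) * cis (- (z * w))"
      unfolding exp_add cis_conv_exp exp_of_real ..
    finally have "complex_of_real (exp w) powr (complex_of_real \<alpha> - \<i> * complex_of_real z) = \<dots>" .
    moreover have "additive_kernel \<alpha> K w = exp w * exp (\<alpha> * w) * K (exp w)"
      by (simp add: additive_kernel_def distrib_right exp_add)
    ultimately show ?thesis
      by (simp only: scaleR_conv_of_real of_real_mult mult_ac)
  qed
  from nonzero show ?thesis
    unfolding exp_change_of_variables(2) eq .
qed

text \<open>Convergence of the Mellin integral is a separate conclusion of the Abelian direction
  because \<open>LINT\<close> returns 0 on nonintegrable functions. In the Tauberian direction the
  same convention yields convergence for large arguments, since a regularly varying function is
  eventually nonzero.\<close>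

theorem theorem4p3:
  fixes F K A :: "real \<Rightarrow> real" and \<alpha> :: real
  assumes "F \<in> borel_measurable (lebesgue_on {0..})"
    and "\<forall>t\<ge>0. F t > 0"
    and "locally_bounded F"
    and "K \<in> wiener_kernels \<alpha>"
    and "A \<in> aux_class_0"
  shows "(F \<in> RV2_0 \<alpha> A \<longrightarrow>
            (\<forall>l>0. set_integrable lebesgue {0<..} (\<lambda>x. K x * F (l * x))) \<and>
            mellin_conv K F \<in> RV2_0 \<alpha> A) \<and>
         (mellin_conv K F \<in> RV2_0 \<alpha> A \<and> F \<in> M_class_0 \<alpha> \<longrightarrow> F \<in> RV2_0 \<alpha> A)"
proof -
  define \<phi> where "\<phi> = additive_form \<alpha> F"
  define \<kappa> where "\<kappa> = additive_kernel \<alpha> K"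
  define B where "B s = A (exp s)" for s
  define G where "G s = (LINT w|lebesgue. \<kappa> w * \<phi> (s + w))" for s
  obtain \<theta> \<delta> where "exp_kernel (additive_kernel \<alpha> K) \<theta> \<delta>" and \<alpha>\<theta>: "\<alpha> \<le> \<theta>"
    using exp_kernel_additive_kernel[OF assms(4)] .
  then interpret exp_kernel \<kappa> \<theta> \<delta> by (simp add: \<kappa>_def)
  have nz: "(LINT w|lebesgue. of_real (\<kappa> w) * cis (- (\<xi> * w))) \<noteq> 0" for \<xi>
    unfolding \<kappa>_def by (rule additive_kernel_fourier_nonzero[OF assms(4)])
  define c where "c = (LINT w|lebesgue. \<kappa> w)"
  \<comment> \<open>Frequency 0 in the Wiener condition: the mass of the nonnegative kernel is
    nonzero, hence positive.\<close>
  have "c \<noteq> 0" using nz[of 0] by (simp add: c_def)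
  moreover have "c \<ge> 0" unfolding c_def by (intro Bochner_Integration.integral_nonneg kernel_nonneg)
  ultimately have c: "c > 0" by simp
  have F_meas: "F \<in> borel_measurable (lebesgue_on {0<..})"
    by (rule measurable_restrict_mono[OF assms(1)]) auto
  have F_sign: "const_sign_at_top F"
    unfolding const_sign_at_top_def
    by (rule disjI1) (use eventually_ge_at_top[of 0] in eventually_elim, use assms(2) in simp)
  have \<phi>_pos: "\<phi> s > 0" for s using assms(2) by (simp add: \<phi>_def additive_form_def)
  have \<phi>_meas: "\<phi> \<in> borel_measurable lebesgue"
    unfolding \<phi>_def by (rule measurable_additive_form[OF F_meas])
  have bound: "\<exists>C. \<forall>u\<le>b. \<bar>\<phi> u\<bar> \<le> C * exp (-\<theta> * u)" for b
    unfolding \<phi>_def by (rule additive_form_bound[OF assms(3) \<alpha>\<theta>])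
  have A: "A \<in> RV 0" "(A \<longlongrightarrow> 0) at_top" using assms(5) by (auto simp: aux_class_0_def)
  have "additive_form 0 A = B" by (simp add: additive_form_def B_def fun_eq_iff)
  with additively_slow_additive_form[OF A(1)] have B: "additively_slow B" by simp
  have B0: "(B \<longlongrightarrow> 0) at_top"
    unfolding B_def by (rule filterlim_compose[OF A(2) exp_at_top])
  have G_eq: "additive_form \<alpha> (mellin_conv K F) = G"
    by (simp add: fun_eq_iff additive_form_mellin_conv G_def \<kappa>_def \<phi>_def)
  show ?thesis
  proof (intro conjI impI)
    assume F: "F \<in> RV2_0 \<alpha> A"
    have \<phi>: "additively_slow \<phi>"
      unfolding \<phi>_def using F by (intro additively_slow_additive_form) (simp add: RV2_0_iff_additive)
    have lim: "((\<lambda>s. (\<phi> (s + v) / \<phi> s - 1) / B s) \<longlongrightarrow> v) at_top" for v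
      using F by (simp add: RV2_0_iff_additive \<phi>_def B_def)
    note ab = abelian_additive[OF c_def c \<phi> bound B lim, folded G_def]
    show "\<forall>l>0. set_integrable lebesgue {0<..} (\<lambda>x. K x * F (l * x))"
    proof (intro allI impI)
      fix l :: real assume "l > 0"
      then show "set_integrable lebesgue {0<..} (\<lambda>x. K x * F (l * x))"
        using ab(1)[of "ln l"] by (simp add: \<kappa>_def \<phi>_def integrable_additive_convolution)
    qed
    have sign: "const_sign_at_top (mellin_conv K F)"
    proof -
      have "\<forall>\<^sub>F s in at_top. G s / \<phi> s > 0" by (rule order_tendstoD(1)[OF ab(2) c])
      then have "\<forall>\<^sub>F s in at_top. G s > 0"
      proof eventually_elim
        case (elim s)
        have "G s = G s / \<phi> s * \<phi> s" using \<phi>_pos[of s] by simp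
        with elim \<phi>_pos[of s] show ?case by (metis mult_pos_pos)
      qed
      from eventually_compose_filterlim[OF this ln_at_top]
      have "\<forall>\<^sub>F t in at_top. mellin_conv K F t > 0"
        using eventually_gt_at_top[of 0]
        by eventually_elim (simp add: G_eq[symmetric] additive_form_def zero_less_mult_iff)
      then show ?thesis by (simp add: const_sign_at_top_def)
    qed
    have "mellin_conv K F \<in> borel_measurable (lebesgue_on {0<..})"
      by (rule measurable_of_additive_form[of \<alpha>]) 
        (simp add: G_eq G_def[abs_def] borel_measurable_lebesgue_convolution[OF kernel_measurable \<phi>_meas])
    with sign ab(3,4) F show "mellin_conv K F \<in> RV2_0 \<alpha> A"
      by (simp add: RV2_0_iff_additive RV_iff_additive G_eq B_def)
  next
    assume asm: "mellin_conv K F \<in> RV2_0 \<alpha> A \<and> F \<in> M_class_0 \<alpha>"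
    have "additively_slow (additive_form \<alpha> (mellin_conv K F))"
      using asm by (intro additively_slow_additive_form) (simp add: RV2_0_iff_additive)
    then have G: "additively_slow G" by (simp only: G_eq)
    have lim: "((\<lambda>s. (G (s + v) / G s - 1) / B s) \<longlongrightarrow> v) at_top" for v
      using asm by (simp add: RV2_0_iff_additive G_eq B_def)
    obtain T where T: "T > 0" and mono_T: "mono_on {T..} (\<lambda>t. t powr (-\<alpha>) * F t) \<or> antimono_on {T..} (\<lambda>t. t powr (-\<alpha>) * F t)"
      using asm by (auto simp: M_class_0_def)
    have "\<phi> u = exp u powr (-\<alpha>) * F (exp u)" for u
      by (simp add: \<phi>_def additive_form_def powr_def)
    moreover have "T \<le> exp u" if "ln T \<le> u" for u
      using that T by (metis exp_le_cancel_iff exp_ln)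
    ultimately have "mono_on {ln T..} \<phi> \<or> antimono_on {ln T..} \<phi>"
      using mono_T unfolding monotone_on_def by auto
    note ta = tauberian_additive[OF nz c_def c \<phi>_meas bound this, folded G_def, OF G B B0 lim]
    show "F \<in> RV2_0 \<alpha> A"
      using ta F_meas F_sign asm by (simp add: RV2_0_iff_additive RV_iff_additive \<phi>_def B_def)
  qed
qed

end
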